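(* Let $(M,m,\Pi,\varkappa)$ be a mechanical system with gyroscopic forces, and let $\Psi=\{\psi^\tau:M\to M,\ \tau\in\mathbb{R}\}$ be a one-parameter group of diffeomorphisms of $M$ preserving the Riemannian metric $m$ and the potential $\Pi$. Let $v$ be the generating vector field of $\Psi$ on $M$. Then there exists a first integral of the system (a function on $TM$ constant along the trajectories of the dynamical vector field $X$) of the form $$G(w)=\langle v(p_M(w)),w\rangle+f(p_M(w)),\qquad w\in TM,$$ with some smooth function $f:M\to\mathbb{R}$, if and only if the 1-form $\mathrm{i}_v\varkappa$ is exact on $M$. In this case the function $f$ is determined by the equation $\mathrm{i}_v\varkappa=-\mathrm{d}f$ (that is, a function $G$ of this form is a first integral exactly when $f$ satisfies this equation).
   Context: All objects are smooth. A mechanical system with gyroscopic forces is a 4-tuple $(M,m,\Pi,\varkappa)$, where $M$ is a smooth manifold, $m$ is a Riemannian metric on $M$ (scalar product denoted $\langle\,,\rangle$), $\Pi:M\to\mathbb{R}$ is a function (the potential), and $\varkappa$ is a closed 2-form on $M$ (the form of gyroscopic forces). Let $p_M:TM\to M$ be the canonical projection. The total energy is $H:TM\to\mathbb{R}$, $H(w)=\frac12\langle w,w\rangle+\Pi(p_M(w))$. Let $\theta$ be the 1-form on $TM$ given by $\theta(w)Y=\langle w,Tp_M(Y)\rangle$ for $Y\in T_wTM$, and let $\sigma=\mathrm{d}\theta+p_M^*\varkappa$; $\sigma$ is a symplectic form on $TM$. The dynamics of the system is given by the vector field $X$ on $TM$ defined by $\mathrm{i}_X\sigma=-\mathrm{d}H$,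 where $\mathrm{i}$ denotes the inner product (contraction in the first argument, so $(\mathrm{i}_v\varkappa)(u)=\varkappa(v,u)$). The generating vector field of $\Psi$ is $v(x)=\frac{d}{d\tau}\big|_{\tau=0}\psi^\tau(x)$, $x\in M$. It is not assumed that $\Psi$ preserves $\varkappa$. *)

theory Defs
  imports "HOL-Analysis.Analysis"
begin

section \<open>Smooth maps between open subsets of Euclidean spaces\<close>

primrec Ck_on :: "nat \<Rightarrow> 'e::real_normed_vector set \<Rightarrow> ('e \<Rightarrow> 'f::real_normed_vector) \<Rightarrow> bool" where
  "Ck_on 0 S f \<longleftrightarrow> continuous_on S f"
| "Ck_on (Suc k) S f \<longleftrightarrow>
     (\<forall>x\<in>S. f differentiable (at x)) \<and> (\<forall>u. Ck_on k S (\<lambda>x. frechet_derivative f (at x) u))"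

text \<open>Only used for open sets of finite-dimensional spaces, where it is the usual
  notion of a \<open>C\<^sup>\<infinity>\<close> map.\<close>

definition smooth_on :: "'e::real_normed_vector set \<Rightarrow> ('e \<Rightarrow> 'f::real_normed_vector) \<Rightarrow> bool" where
  "smooth_on S f \<longleftrightarrow> (\<forall>k. Ck_on k S f)"


section \<open>Smooth manifolds\<close>

text \<open>A manifold is given by its atlas; the underlying set is the union of the chart domains and
  its topology is the one induced by the charts, so that the tangent bundle is a manifold in the
  same sense without further data. A chart is a pair of its domain and the coordinate map (whose
  values outside the domain are irrelevant).\<close>

type_synonym ('a, 'e) chart = "'a set \<times> ('a \<Rightarrow> 'e)"

abbreviation dom_of :: "('a, 'e) chart \<Rightarrow> 'a set" where
  "dom_of \<equiv> fst"

abbreviation coord :: "('a, 'e) chart \<Rightarrow> 'a \<Rightarrow> 'e" where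
  "coord \<equiv> snd"

definition img_of :: "('a, 'e) chart \<Rightarrow> 'e set" where
  "img_of c = coord c ` dom_of c"

definition param :: "('a, 'e) chart \<Rightarrow> 'e \<Rightarrow> 'a" where
  "param c = inv_into (dom_of c) (coord c)"

definition points :: "('a, 'e) chart set \<Rightarrow> 'a set" where
  "points A = (\<Union>c\<in>A. dom_of c)"

definition manifold_topology :: "('a, 'e::euclidean_space) chart set \<Rightarrow> 'a topology" where
  "manifold_topology A =
     topology_generated_by {{p \<in> dom_of c. coord c p \<in> W} | c W. c \<in> A \<and> open W}"

definition smooth_manifold :: "('a, 'e::euclidean_space) chart set \<Rightarrow> bool" where
  "smooth_manifold A \<longleftrightarrow>
     (\<forall>c\<in>A. inj_on (coord c) (dom_of c) \<and> open (img_of c)) \<and>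
     (\<forall>c\<in>A. \<forall>d\<in>A. open (coord c ` (dom_of c \<inter> dom_of d)) \<and>
        smooth_on (coord c ` (dom_of c \<inter> dom_of d)) (coord d \<circ> param c)) \<and>
     Hausdorff_space (manifold_topology A) \<and>
     second_countable (manifold_topology A)"

definition chart_at :: "('a, 'e) chart set \<Rightarrow> 'a \<Rightarrow> ('a, 'e) chart" where
  "chart_at A p = (SOME c. c \<in> A \<and> p \<in> dom_of c)"

definition prod_atlas ::
  "('a, 'e) chart set \<Rightarrow> ('b, 'f) chart set \<Rightarrow> ('a \<times> 'b, 'e \<times> 'f) chart set" where
  "prod_atlas A B =
     {(dom_of c \<times> dom_of d, map_prod (coord c) (coord d)) | c d. c \<in> A \<and> d \<in> B}"

definition real_atlas :: "(real, real) chart set" where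
  "real_atlas = {(UNIV, id)}"

definition smooth_fun :: "('a, 'e::euclidean_space) chart set \<Rightarrow> ('a \<Rightarrow> real) \<Rightarrow> bool" where
  "smooth_fun A f \<longleftrightarrow> (\<forall>c\<in>A. smooth_on (img_of c) (f \<circ> param c))"

text \<open>The openness condition says that the map is continuous.\<close>

definition smooth_map ::
  "('a, 'e::euclidean_space) chart set \<Rightarrow> ('b, 'f::euclidean_space) chart set \<Rightarrow> ('a \<Rightarrow> 'b) \<Rightarrow> bool"
where
  "smooth_map A B F \<longleftrightarrow>
     F ` points A \<subseteq> points B \<and>
     (\<forall>c\<in>A. \<forall>d\<in>B. open (coord c ` (dom_of c \<inter> F -` dom_of d)) \<and>
        smooth_on (coord c ` (dom_of c \<inter> F -` dom_of d)) (coord d \<circ> F \<circ> param c))"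

definition diffeomorphism ::
  "('a, 'e::euclidean_space) chart set \<Rightarrow> ('b, 'f::euclidean_space) chart set \<Rightarrow> ('a \<Rightarrow> 'b) \<Rightarrow> bool"
where
  "diffeomorphism A B F \<longleftrightarrow>
     bij_betw F (points A) (points B) \<and> smooth_map A B F \<and>
     smooth_map B A (inv_into (points A) F)"


section \<open>Tangent vectors\<close>

text \<open>A tangent vector at \<open>p\<close> is the family of its coordinate vectors in the charts around
  \<open>p\<close>, related by the derivatives of the coordinate changes; the entries for all other charts are
  set to zero. Its vector space structure is the pointwise one.\<close>

type_synonym ('a, 'e) tvec = "('a, 'e) chart \<Rightarrow> 'e"

definition tangent_space ::
  "('a, 'e::euclidean_space) chart set \<Rightarrow> 'a \<Rightarrow> ('a, 'e) tvec set" where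
  "tangent_space A p = {\<xi>.
     (\<forall>c. c \<notin> A \<or> p \<notin> dom_of c \<longrightarrow> \<xi> c = 0) \<and>
     (\<forall>c\<in>A. \<forall>d\<in>A. p \<in> dom_of c \<inter> dom_of d \<longrightarrow>
        \<xi> d = frechet_derivative (coord d \<circ> param c) (at (coord c p)) (\<xi> c))}"

text \<open>The tangent vector at \<open>p\<close> whose coordinate vector in the chart \<open>c\<close> is \<open>u\<close>.\<close>

definition coord_vector ::
  "('a, 'e::euclidean_space) chart set \<Rightarrow> ('a, 'e) chart \<Rightarrow> 'a \<Rightarrow> 'e \<Rightarrow> ('a, 'e) tvec" where
  "coord_vector A c p u =
     (\<lambda>d. if d \<in> A \<and> p \<in> dom_of d
          then frechet_derivative (coord d \<circ> param c) (at (coord c p)) u else 0)"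

definition tangent_chart ::
  "('a, 'e::euclidean_space) chart set \<Rightarrow> ('a, 'e) chart
     \<Rightarrow> ('a \<times> ('a, 'e) tvec, 'e \<times> 'e) chart" where
  "tangent_chart A c =
     ({(p, \<xi>). p \<in> dom_of c \<and> \<xi> \<in> tangent_space A p}, \<lambda>(p, \<xi>). (coord c p, \<xi> c))"

definition tangent_bundle ::
  "('a, 'e::euclidean_space) chart set \<Rightarrow> ('a \<times> ('a, 'e) tvec, 'e \<times> 'e) chart set" where
  "tangent_bundle A = tangent_chart A ` A"

text \<open>The following notions are computed in an arbitrarily chosen chart at the base point; by the
  chain rule they do not depend on it.\<close>

definition tangent_map ::
  "('a, 'e::euclidean_space) chart set \<Rightarrow> ('b, 'f::euclidean_space) chart set \<Rightarrow> ('a \<Rightarrow> 'b)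
     \<Rightarrow> 'a \<Rightarrow> ('a, 'e) tvec \<Rightarrow> ('b, 'f) tvec" where
  "tangent_map A B F p \<xi> =
     (let c = chart_at A p in
      (\<lambda>d. if d \<in> B \<and> F p \<in> dom_of d
           then frechet_derivative (coord d \<circ> F \<circ> param c) (at (coord c p)) (\<xi> c) else 0))"

definition differential ::
  "('a, 'e::euclidean_space) chart set \<Rightarrow> ('a \<Rightarrow> real) \<Rightarrow> 'a \<Rightarrow> ('a, 'e) tvec \<Rightarrow> real" where
  "differential A f p \<xi> =
     (let c = chart_at A p in frechet_derivative (f \<circ> param c) (at (coord c p)) (\<xi> c))"

definition has_velocity ::
  "('a, 'e::euclidean_space) chart set \<Rightarrow> (real \<Rightarrow> 'a) \<Rightarrow> real \<Rightarrow> ('a, 'e) tvec \<Rightarrow> bool" where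
  "has_velocity A \<gamma> t \<xi> \<longleftrightarrow>
     \<gamma> t \<in> points A \<and> \<xi> \<in> tangent_space A (\<gamma> t) \<and>
     (\<forall>c\<in>A. \<gamma> t \<in> dom_of c \<longrightarrow>
        (\<forall>\<^sub>F s in nhds t. \<gamma> s \<in> dom_of c) \<and>
        ((coord c \<circ> \<gamma>) has_vector_derivative \<xi> c) (at t))"

definition velocity ::
  "('a, 'e::euclidean_space) chart set \<Rightarrow> (real \<Rightarrow> 'a) \<Rightarrow> real \<Rightarrow> ('a, 'e) tvec" where
  "velocity A \<gamma> t = (THE \<xi>. has_velocity A \<gamma> t \<xi>)"


section \<open>Tensor fields and differential forms\<close>

type_synonym ('a, 'e) cov1 = "'a \<Rightarrow> ('a, 'e) tvec \<Rightarrow> real"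
type_synonym ('a, 'e) cov2 = "'a \<Rightarrow> ('a, 'e) tvec \<Rightarrow> ('a, 'e) tvec \<Rightarrow> real"

definition linear_on_tangent ::
  "('a, 'e::euclidean_space) chart set \<Rightarrow> 'a \<Rightarrow> (('a, 'e) tvec \<Rightarrow> real) \<Rightarrow> bool" where
  "linear_on_tangent A p L \<longleftrightarrow>
     (\<forall>\<xi>\<in>tangent_space A p. \<forall>\<eta>\<in>tangent_space A p. \<forall>a b.
        L (\<lambda>c. a *\<^sub>R \<xi> c + b *\<^sub>R \<eta> c) = a * L \<xi> + b * L \<eta>)"

definition smooth_cov2 :: "('a, 'e::euclidean_space) chart set \<Rightarrow> ('a, 'e) cov2 \<Rightarrow> bool" where
  "smooth_cov2 A \<beta> \<longleftrightarrow>
     (\<forall>p\<in>points A. \<forall>\<xi>\<in>tangent_space A p.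
        linear_on_tangent A p (\<lambda>\<eta>. \<beta> p \<xi> \<eta>) \<and> linear_on_tangent A p (\<lambda>\<eta>. \<beta> p \<eta> \<xi>)) \<and>
     (\<forall>c\<in>A. \<forall>u u'. smooth_on (img_of c)
        (\<lambda>x. \<beta> (param c x) (coord_vector A c (param c x) u) (coord_vector A c (param c x) u')))"

definition riemannian_metric :: "('a, 'e::euclidean_space) chart set \<Rightarrow> ('a, 'e) cov2 \<Rightarrow> bool" where
  "riemannian_metric A m \<longleftrightarrow>
     smooth_cov2 A m \<and>
     (\<forall>p\<in>points A. \<forall>\<xi>\<in>tangent_space A p. \<forall>\<eta>\<in>tangent_space A p. m p \<xi> \<eta> = m p \<eta> \<xi>) \<and>
     (\<forall>p\<in>points A. \<forall>\<xi>\<in>tangent_space A p. \<xi> \<noteq> (\<lambda>c. 0) \<longrightarrow> m p \<xi> \<xi> > 0)"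

definition two_form :: "('a, 'e::euclidean_space) chart set \<Rightarrow> ('a, 'e) cov2 \<Rightarrow> bool" where
  "two_form A \<beta> \<longleftrightarrow>
     smooth_cov2 A \<beta> \<and>
     (\<forall>p\<in>points A. \<forall>\<xi>\<in>tangent_space A p. \<forall>\<eta>\<in>tangent_space A p. \<beta> p \<xi> \<eta> = - \<beta> p \<eta> \<xi>)"

text \<open>Exterior derivatives, normalised by
  \<open>d\<omega>(X, Y) = X(\<omega>(Y)) - Y(\<omega>(X)) - \<omega>([X, Y])\<close> (no factor \<open>1/2\<close>) and evaluated on the constant
  extensions of the arguments in a chart, for which the bracket terms vanish.\<close>

definition ext_deriv1 ::
  "('a, 'e::euclidean_space) chart set \<Rightarrow> ('a, 'e) cov1 \<Rightarrow> ('a, 'e) cov2" where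
  "ext_deriv1 A \<omega> p \<xi> \<eta> =
     (let c = chart_at A p;
          D = (\<lambda>u u'. frechet_derivative
                 (\<lambda>x. \<omega> (param c x) (coord_vector A c (param c x) u')) (at (coord c p)) u)
      in D (\<xi> c) (\<eta> c) - D (\<eta> c) (\<xi> c))"

definition ext_deriv2 ::
  "('a, 'e::euclidean_space) chart set \<Rightarrow> ('a, 'e) cov2
     \<Rightarrow> 'a \<Rightarrow> ('a, 'e) tvec \<Rightarrow> ('a, 'e) tvec \<Rightarrow> ('a, 'e) tvec \<Rightarrow> real" where
  "ext_deriv2 A \<beta> p \<xi> \<eta> \<zeta> =
     (let c = chart_at A p;
          D = (\<lambda>u u' u''. frechet_derivative
                 (\<lambda>x. \<beta> (param c x) (coord_vector A c (param c x) u')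
                                   (coord_vector A c (param c x) u'')) (at (coord c p)) u)
      in D (\<xi> c) (\<eta> c) (\<zeta> c) + D (\<eta> c) (\<zeta> c) (\<xi> c) + D (\<zeta> c) (\<xi> c) (\<eta> c))"

definition closed_form2 :: "('a, 'e::euclidean_space) chart set \<Rightarrow> ('a, 'e) cov2 \<Rightarrow> bool" where
  "closed_form2 A \<beta> \<longleftrightarrow>
     (\<forall>p\<in>points A. \<forall>\<xi>\<in>tangent_space A p. \<forall>\<eta>\<in>tangent_space A p. \<forall>\<zeta>\<in>tangent_space A p.
        ext_deriv2 A \<beta> p \<xi> \<eta> \<zeta> = 0)"

definition eq_form1 ::
  "('a, 'e::euclidean_space) chart set \<Rightarrow> ('a, 'e) cov1 \<Rightarrow> ('a, 'e) cov1 \<Rightarrow> bool" where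
  "eq_form1 A \<omega> \<omega>' \<longleftrightarrow> (\<forall>p\<in>points A. \<forall>\<xi>\<in>tangent_space A p. \<omega> p \<xi> = \<omega>' p \<xi>)"

definition exact_form1 :: "('a, 'e::euclidean_space) chart set \<Rightarrow> ('a, 'e) cov1 \<Rightarrow> bool" where
  "exact_form1 A \<omega> \<longleftrightarrow> (\<exists>f. smooth_fun A f \<and> eq_form1 A \<omega> (differential A f))"

definition contraction :: "('a \<Rightarrow> ('a, 'e) tvec) \<Rightarrow> ('a, 'e) cov2 \<Rightarrow> ('a, 'e) cov1" where
  "contraction v \<beta> = (\<lambda>p u. \<beta> p (v p) u)"

definition pullback2 ::
  "('a, 'e::euclidean_space) chart set \<Rightarrow> ('b, 'f::euclidean_space) chart set \<Rightarrow> ('a \<Rightarrow> 'b)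
     \<Rightarrow> ('b, 'f) cov2 \<Rightarrow> ('a, 'e) cov2" where
  "pullback2 A B F \<beta> =
     (\<lambda>p \<xi> \<eta>. \<beta> (F p) (tangent_map A B F p \<xi>) (tangent_map A B F p \<eta>))"


section \<open>Mechanical systems with gyroscopic forces\<close>

definition gyroscopic_system ::
  "('a, 'e::euclidean_space) chart set \<Rightarrow> ('a, 'e) cov2 \<Rightarrow> ('a \<Rightarrow> real) \<Rightarrow> ('a, 'e) cov2 \<Rightarrow> bool"
where
  "gyroscopic_system A m pot \<kappa> \<longleftrightarrow>
     smooth_manifold A \<and> riemannian_metric A m \<and> smooth_fun A pot \<and>
     two_form A \<kappa> \<and> closed_form2 A \<kappa>"

text \<open>A point of the tangent bundle is a pair of a base point and a tangent vector there, and
  the canonical projection is \<open>fst\<close>.\<close>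

definition total_energy ::
  "('a, 'e) cov2 \<Rightarrow> ('a \<Rightarrow> real) \<Rightarrow> 'a \<times> ('a, 'e) tvec \<Rightarrow> real" where
  "total_energy m pot w = 1 / 2 * m (fst w) (snd w) (snd w) + pot (fst w)"

definition theta_form ::
  "('a, 'e::euclidean_space) chart set \<Rightarrow> ('a, 'e) cov2
     \<Rightarrow> ('a \<times> ('a, 'e) tvec, 'e \<times> 'e) cov1" where
  "theta_form A m w Y = m (fst w) (snd w) (tangent_map (tangent_bundle A) A fst w Y)"

definition sigma_form ::
  "('a, 'e::euclidean_space) chart set \<Rightarrow> ('a, 'e) cov2 \<Rightarrow> ('a, 'e) cov2
     \<Rightarrow> ('a \<times> ('a, 'e) tvec, 'e \<times> 'e) cov2" where
  "sigma_form A m \<kappa> w X Y =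
     ext_deriv1 (tangent_bundle A) (theta_form A m) w X Y
     + pullback2 (tangent_bundle A) A fst \<kappa> w X Y"

definition dynamical_field ::
  "('a, 'e::euclidean_space) chart set \<Rightarrow> ('a, 'e) cov2 \<Rightarrow> ('a \<Rightarrow> real) \<Rightarrow> ('a, 'e) cov2
     \<Rightarrow> 'a \<times> ('a, 'e) tvec \<Rightarrow> ('a \<times> ('a, 'e) tvec, 'e \<times> 'e) tvec" where
  "dynamical_field A m pot \<kappa> w =
     (THE X. X \<in> tangent_space (tangent_bundle A) w \<and>
        (\<forall>Y\<in>tangent_space (tangent_bundle A) w.
           sigma_form A m \<kappa> w X Y = - differential (tangent_bundle A) (total_energy m pot) w Y))"

definition trajectory ::
  "('a, 'e::euclidean_space) chart set \<Rightarrow> ('a \<Rightarrow> ('a, 'e) tvec) \<Rightarrow> real set \<Rightarrow> (real \<Rightarrow> 'a) \<Rightarrow> bool"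
where
  "trajectory A X I \<gamma> \<longleftrightarrow>
     open I \<and> is_interval I \<and> (\<forall>t\<in>I. has_velocity A \<gamma> t (X (\<gamma> t)))"

definition first_integral ::
  "('a, 'e::euclidean_space) chart set \<Rightarrow> ('a \<Rightarrow> ('a, 'e) tvec) \<Rightarrow> ('a \<Rightarrow> real) \<Rightarrow> bool" where
  "first_integral A X G \<longleftrightarrow>
     smooth_fun A G \<and> (\<forall>I \<gamma>. trajectory A X I \<gamma> \<longrightarrow> (\<forall>s\<in>I. \<forall>t\<in>I. G (\<gamma> s) = G (\<gamma> t)))"


section \<open>One-parameter groups\<close>

definition one_parameter_group ::
  "('a, 'e::euclidean_space) chart set \<Rightarrow> (real \<Rightarrow> 'a \<Rightarrow> 'a) \<Rightarrow> bool" where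
  "one_parameter_group A \<psi> \<longleftrightarrow>
     (\<forall>\<tau>. diffeomorphism A A (\<psi> \<tau>)) \<and>
     (\<forall>x\<in>points A. \<psi> 0 x = x) \<and>
     (\<forall>s t. \<forall>x\<in>points A. \<psi> (s + t) x = \<psi> s (\<psi> t x)) \<and>
     smooth_map (prod_atlas real_atlas A) A (\<lambda>(\<tau>, x). \<psi> \<tau> x)"

definition generating_field ::
  "('a, 'e::euclidean_space) chart set \<Rightarrow> (real \<Rightarrow> 'a \<Rightarrow> 'a) \<Rightarrow> 'a \<Rightarrow> ('a, 'e) tvec" where
  "generating_field A \<psi> x = velocity A (\<lambda>\<tau>. \<psi> \<tau> x) 0"

definition preserves_metric ::
  "('a, 'e::euclidean_space) chart set \<Rightarrow> ('a, 'e) cov2 \<Rightarrow> ('a \<Rightarrow> 'a) \<Rightarrow> bool" where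
  "preserves_metric A m F \<longleftrightarrow>
     (\<forall>p\<in>points A. \<forall>\<xi>\<in>tangent_space A p. \<forall>\<eta>\<in>tangent_space A p.
        pullback2 A A F m p \<xi> \<eta> = m p \<xi> \<eta>)"

definition preserves_fun :: "('a, 'e) chart set \<Rightarrow> ('a \<Rightarrow> real) \<Rightarrow> ('a \<Rightarrow> 'a) \<Rightarrow> bool" where
  "preserves_fun A f F \<longleftrightarrow> (\<forall>p\<in>points A. f (F p) = f p)"

definition linear_integral ::
  "('a, 'e) cov2 \<Rightarrow> ('a \<Rightarrow> ('a, 'e) tvec) \<Rightarrow> ('a \<Rightarrow> real) \<Rightarrow> 'a \<times> ('a, 'e) tvec \<Rightarrow> real" where
  "linear_integral m v f w = m (fst w) (v (fst w)) (snd w) + f (fst w)"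

end

theory Submission
  imports Defs
begin

text \<open>
  The theorem rests on one identity. For \<open>G(w) = \<langle>v, w\<rangle> + f\<close> the derivative of \<open>G\<close> along the dynamical field
  \<open>X\<close> at a tangent vector \<open>w\<close> over \<open>p\<close> is \<open>\<kappa>(v(p), w) + df(w)\<close>. Indeed, Hamilton's equation
  \<open>i_X \<sigma> = - dH\<close> says that trajectories move with velocity \<open>w\<close> and that their acceleration, paired with
  the metric, is the geodesic term plus the potential force plus the gyroscopic force \<open>- \<kappa>(w, \<sqdot>)\<close>
  (\<open>hamilton_equation_iff\<close>). Pairing with \<open>v\<close>, the geodesic term is cancelled by the Killing equation,
  which is the derivative at time \<open>0\<close> of the invariance of the metric (\<open>killing_equation\<close>), the
  potential force is cancelled by the invariance of the potential, and what remains is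
  \<open>- \<kappa>(w, v) = \<kappa>(v, w)\<close> (\<open>linear_integral_phase_derivative\<close>).

  A smooth function is constant along all trajectories if and only if its derivative along \<open>X\<close> vanishes
  identically (\<open>first_integral_iff\<close>). The direction that concludes from trajectories to points uses a
  trajectory through every tangent vector; it is provided by Picard iteration, the acceleration being
  locally Lipschitz as the solution of a positive definite linear system. Hence \<open>G\<close> is a first integral
  exactly when \<open>i_v \<kappa> = - df\<close>, and such an \<open>f\<close> exists exactly when \<open>i_v \<kappa>\<close> is exact.

  The computation is done in coordinates. It becomes a statement about the manifold because differentials,
  exterior derivatives of 1-forms, tangent maps and velocities may be evaluated in any chart; for the
  exterior derivative this is the symmetry of second derivatives of the transition maps. The same
  facts apply to the tangent bundle, whose atlas is smooth as well (\<open>smooth_atlas_tangent_bundle\<close>).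
\<close>

section \<open>Calculus of smooth maps\<close>

abbreviation \<D> :: "('e::real_normed_vector \<Rightarrow> 'f::real_normed_vector) \<Rightarrow> 'e \<Rightarrow> 'e \<Rightarrow> 'f" where
  "\<D> f x \<equiv> frechet_derivative f (at x)"

lemma Ck_on_cong:
  "\<lbrakk>Ck_on k S f; open S; \<And>x. x \<in> S \<Longrightarrow> f x = g x\<rbrakk> \<Longrightarrow> Ck_on k S g"
proof (induction k arbitrary: f g)
  case 0
  then show ?case by (metis Ck_on.simps(1) continuous_on_cong)
next
  case (Suc k)
  have der: "(g has_derivative \<D> f x) (at x)" if x: "x \<in> S" for x
  proof (rule has_derivative_transform_within_open[OF _ \<open>open S\<close> x])
    show "(f has_derivative \<D> f x) (at x)"
      using Suc.prems(1) x by (simp add: frechet_derivative_works)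
  qed (rule Suc.prems(3))
  have "Ck_on k S (\<lambda>x. \<D> g x u)" for u
  proof (rule Suc.IH)
    show "Ck_on k S (\<lambda>x. \<D> f x u)" using Suc.prems(1) by simp
    show "\<D> f x u = \<D> g x u" if "x \<in> S" for x
      using frechet_derivative_at[OF der[OF that]] by simp
  qed (rule Suc.prems)
  with der show ?case by (auto simp only: Ck_on.simps differentiable_def)
qed

lemma Ck_on_SucI:
  assumes "open S" and der: "\<And>x. x \<in> S \<Longrightarrow> (f has_derivative f' x) (at x)"
    and Ck: "\<And>u. Ck_on k S (\<lambda>x. f' x u)"
  shows "Ck_on (Suc k) S f"
proof -
  have "Ck_on k S (\<lambda>x. \<D> f x u)" for u
  proof (rule Ck_on_cong[OF Ck \<open>open S\<close>])
    show "f' x u = \<D> f x u" if "x \<in> S" for x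
      using frechet_derivative_at[OF der[OF that]] by simp
  qed
  with der show ?thesis by (auto simp only: Ck_on.simps differentiable_def)
qed

lemma Ck_on_Suc_has_derivative:
  "\<lbrakk>Ck_on (Suc k) S f; x \<in> S\<rbrakk> \<Longrightarrow> (f has_derivative \<D> f x) (at x)"
  by (simp add: frechet_derivative_works)

lemma Ck_on_Suc_deriv: "Ck_on (Suc k) S f \<Longrightarrow> Ck_on k S (\<lambda>x. \<D> f x u)"
  by simp

lemma Ck_on_SucD: "Ck_on (Suc k) S f \<Longrightarrow> Ck_on k S f"
proof (induction k arbitrary: f)
  case 0
  then show ?case
    by (simp add: differentiable_imp_continuous_on differentiable_on_def differentiable_at_withinI)
next
  case (Suc k)
  have "Ck_on k S (\<lambda>x. \<D> f x u)" for u
    by (rule Suc.IH[OF Ck_on_Suc_deriv[OF Suc.prems]])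
  moreover have "\<forall>x\<in>S. f differentiable (at x)" using Suc.prems by simp
  ultimately show ?case by simp
qed

lemma Ck_on_const: "Ck_on k S (\<lambda>x. c)"
  by (induction k arbitrary: c) auto

lemma Ck_on_bounded_linear_compose:
  assumes "bounded_linear L" "open S"
  shows "Ck_on k S f \<Longrightarrow> Ck_on k S (\<lambda>x. L (f x))"
proof (induction k arbitrary: f)
  case 0
  then show ?case
    using assms(1) bounded_linear.continuous_on by auto
next
  case (Suc k)
  show ?case
    by (rule Ck_on_SucI[OF assms(2)], rule bounded_linear.has_derivative[OF assms(1)],
      rule Ck_on_Suc_has_derivative[OF Suc.prems], assumption, rule Suc.IH,
      rule Ck_on_Suc_deriv[OF Suc.prems])
qed

lemma Ck_on_bounded_linear:
  assumes "bounded_linear L" "open S"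
  shows "Ck_on k S L"
proof (cases k)
  case 0
  then show ?thesis using assms linear_continuous_on by auto
next
  case (Suc j)
  show ?thesis unfolding Suc
    by (rule Ck_on_SucI[OF assms(2) bounded_linear_imp_has_derivative[OF assms(1)] Ck_on_const])
qed

lemma Ck_on_add:
  assumes "open S"
  shows "\<lbrakk>Ck_on k S f; Ck_on k S g\<rbrakk> \<Longrightarrow> Ck_on k S (\<lambda>x. f x + g x)"
proof (induction k arbitrary: f g)
  case 0
  then show ?case by (auto intro: continuous_on_add)
next
  case (Suc k)
  show ?case
  proof (rule Ck_on_SucI[OF assms])
    show "((\<lambda>x. f x + g x) has_derivative (\<lambda>u. \<D> f x u + \<D> g x u)) (at x)" if "x \<in> S" for x
      using that Suc.prems by (intro has_derivative_add Ck_on_Suc_has_derivative)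
    show "Ck_on k S (\<lambda>x. \<D> f x u + \<D> g x u)" for u
      using Suc.prems by (intro Suc.IH Ck_on_Suc_deriv)
  qed
qed

lemma Ck_on_sum:
  assumes "open S"
  shows "(\<And>i. i \<in> I \<Longrightarrow> Ck_on k S (f i)) \<Longrightarrow> Ck_on k S (\<lambda>x. \<Sum>i\<in>I. f i x)"
  by (induction I rule: infinite_finite_induct) (simp_all add: Ck_on_const Ck_on_add[OF assms])

lemma Ck_on_scaleR:
  assumes "open S"
  shows "\<lbrakk>Ck_on k S a; Ck_on k S b\<rbrakk> \<Longrightarrow> Ck_on k S (\<lambda>x. a x *\<^sub>R b x)"
proof (induction k arbitrary: a b)
  case 0
  then show ?case by (auto intro: continuous_on_scaleR)
next
  case (Suc k)
  show ?case
  proof (rule Ck_on_SucI[OF assms])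
    show "((\<lambda>x. a x *\<^sub>R b x) has_derivative (\<lambda>u. a x *\<^sub>R \<D> b x u + \<D> a x u *\<^sub>R b x)) (at x)"
      if "x \<in> S" for x
      using that Suc.prems by (intro has_derivative_scaleR Ck_on_Suc_has_derivative)
    show "Ck_on k S (\<lambda>x. a x *\<^sub>R \<D> b x u + \<D> a x u *\<^sub>R b x)" for u
      by (intro Ck_on_add[OF assms] Suc.IH Ck_on_Suc_deriv[OF Suc.prems(1)]
          Ck_on_Suc_deriv[OF Suc.prems(2)] Ck_on_SucD[OF Suc.prems(1)] Ck_on_SucD[OF Suc.prems(2)])
  qed
qed

lemma linear_eq_sum_Basis:
  fixes h :: "'f::euclidean_space \<Rightarrow> 'g::real_vector"
  assumes "linear h"
  shows "h u = (\<Sum>i\<in>Basis. (u \<bullet> i) *\<^sub>R h i)"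
proof -
  have "h u = h (\<Sum>i\<in>Basis. (u \<bullet> i) *\<^sub>R i)" by (simp add: euclidean_representation)
  also have "\<dots> = (\<Sum>i\<in>Basis. (u \<bullet> i) *\<^sub>R h i)"
    using assms by (simp add: linear_sum linear_cmul)
  finally show ?thesis .
qed

text \<open>Expanding the argument in an orthonormal basis turns pointwise evaluation of a family of linear
  maps into sums and products. This is the form in which the product rule, the chain rule and the
  smoothness of tensors on a bundle are used throughout.\<close>

lemma Ck_on_linear_family:
  fixes h :: "'e::real_normed_vector \<Rightarrow> 'f::euclidean_space \<Rightarrow> 'g::real_normed_vector"
  assumes S: "open S" and lin: "\<And>x. x \<in> S \<Longrightarrow> linear (h x)"
    and h: "\<And>u. Ck_on k S (\<lambda>x. h x u)" and L: "Ck_on k S L"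
  shows "Ck_on k S (\<lambda>x. h x (L x))"
proof (rule Ck_on_cong[OF _ S])
  show "Ck_on k S (\<lambda>x. \<Sum>i\<in>Basis. (L x \<bullet> i) *\<^sub>R h x i)"
    by (intro Ck_on_sum[OF S] Ck_on_scaleR[OF S] h
        Ck_on_bounded_linear_compose[OF bounded_linear_inner_left S] L)
  show "(\<Sum>i\<in>Basis. (L x \<bullet> i) *\<^sub>R h x i) = h x (L x)" if "x \<in> S" for x
    using linear_eq_sum_Basis[OF lin[OF that], of "L x"] by simp
qed

text \<open>By the chain rule the derivative of a composite is a family of linear maps evaluated at a
  derivative, so that the order of smoothness drops by one and induction applies.\<close>

lemma Ck_on_compose:
  fixes g :: "'e::real_normed_vector \<Rightarrow> 'f::euclidean_space"
    and f :: "'f \<Rightarrow> 'g::real_normed_vector"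
  assumes S: "open S" and T: "open T" and gS: "g ` S \<subseteq> T"
  shows "\<lbrakk>Ck_on k T f; Ck_on k S g\<rbrakk> \<Longrightarrow> Ck_on k S (\<lambda>x. f (g x))"
proof (induction k arbitrary: f)
  case 0
  then show ?case using continuous_on_compose2[of T f S g] gS by auto
next
  case (Suc k)
  show ?case
  proof (rule Ck_on_SucI[OF S])
    show "((\<lambda>x. f (g x)) has_derivative (\<lambda>u. \<D> f (g x) (\<D> g x u))) (at x)" if "x \<in> S" for x
      using that gS
      by (intro has_derivative_compose[of g "\<D> g x" x UNIV f "\<D> f (g x)"]
          Ck_on_Suc_has_derivative[OF Suc.prems(1)] Ck_on_Suc_has_derivative[OF Suc.prems(2)])
        blast+
    show "Ck_on k S (\<lambda>x. \<D> f (g x) (\<D> g x u))" for u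
    proof (rule Ck_on_linear_family[OF S])
      show "linear (\<D> f (g x))" if "x \<in> S" for x
        using Suc.prems(1) that gS by (intro linear_frechet_derivative) auto
      show "Ck_on k S (\<lambda>x. \<D> f (g x) w)" for w
        by (rule Suc.IH[OF Ck_on_Suc_deriv[OF Suc.prems(1)] Ck_on_SucD[OF Suc.prems(2)]])
      show "Ck_on k S (\<lambda>x. \<D> g x u)" by (rule Ck_on_Suc_deriv[OF Suc.prems(2)])
    qed
  qed
qed

lemma Ck_on_Pair:
  assumes S: "open S" and "Ck_on k S f" "Ck_on k S g"
  shows "Ck_on k S (\<lambda>x. (f x, g x))"
proof -
  have "Ck_on k S (\<lambda>x. (f x, 0) + (0, g x))"
    using assms
    by (intro Ck_on_add[OF S]
        Ck_on_bounded_linear_compose[OF bounded_linear_Pair[OF bounded_linear_ident bounded_linear_zero] S]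
        Ck_on_bounded_linear_compose[OF bounded_linear_Pair[OF bounded_linear_zero bounded_linear_ident] S])
  then show ?thesis by simp
qed

lemma smooth_on_cong:
  "\<lbrakk>smooth_on S f; open S; \<And>x. x \<in> S \<Longrightarrow> f x = g x\<rbrakk> \<Longrightarrow> smooth_on S g"
  unfolding smooth_on_def using Ck_on_cong by blast

lemma smooth_on_bounded_linear: "\<lbrakk>bounded_linear L; open S\<rbrakk> \<Longrightarrow> smooth_on S L"
  by (simp add: smooth_on_def Ck_on_bounded_linear)

lemma smooth_on_const: "smooth_on S (\<lambda>x. c)"
  by (simp add: smooth_on_def Ck_on_const)

lemma smooth_on_add:
  "\<lbrakk>open S; smooth_on S f; smooth_on S g\<rbrakk> \<Longrightarrow> smooth_on S (\<lambda>x. f x + g x)"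
  by (simp add: smooth_on_def Ck_on_add)

lemma smooth_on_uminus:
  "\<lbrakk>open S; smooth_on S f\<rbrakk> \<Longrightarrow> smooth_on S (\<lambda>x. - f x)"
  unfolding smooth_on_def
  by (blast intro: Ck_on_bounded_linear_compose[OF bounded_linear_minus[OF bounded_linear_ident]])

lemma smooth_on_linear_family:
  fixes h :: "'e::real_normed_vector \<Rightarrow> 'f::euclidean_space \<Rightarrow> 'g::real_normed_vector"
  assumes "open S" "\<And>x. x \<in> S \<Longrightarrow> linear (h x)"
    and "\<And>u. smooth_on S (\<lambda>x. h x u)" "smooth_on S L"
  shows "smooth_on S (\<lambda>x. h x (L x))"
  using assms Ck_on_linear_family[of S h _ L] by (simp add: smooth_on_def)

lemma smooth_on_compose:
  fixes g :: "'e::real_normed_vector \<Rightarrow> 'f::euclidean_space"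
    and f :: "'f \<Rightarrow> 'g::real_normed_vector"
  assumes "smooth_on T f" "smooth_on S g" "open S" "open T" "g ` S \<subseteq> T"
  shows "smooth_on S (\<lambda>x. f (g x))"
  using assms Ck_on_compose[of S T g _ f] by (simp add: smooth_on_def)

lemma smooth_on_Pair:
  "\<lbrakk>open S; smooth_on S f; smooth_on S g\<rbrakk> \<Longrightarrow> smooth_on S (\<lambda>x. (f x, g x))"
  by (simp add: smooth_on_def Ck_on_Pair)

lemma smooth_on_differentiable: "\<lbrakk>smooth_on S f; x \<in> S\<rbrakk> \<Longrightarrow> f differentiable (at x)"
  unfolding smooth_on_def using Ck_on.simps(2)[of 0 S f] by blast

lemma smooth_on_has_derivative: "\<lbrakk>smooth_on S f; x \<in> S\<rbrakk> \<Longrightarrow> (f has_derivative \<D> f x) (at x)"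
  using smooth_on_differentiable frechet_derivative_works by blast

lemma smooth_on_linear_deriv: "\<lbrakk>smooth_on S f; x \<in> S\<rbrakk> \<Longrightarrow> linear (\<D> f x)"
  using smooth_on_differentiable linear_frechet_derivative by blast

lemma smooth_on_deriv: "smooth_on S f \<Longrightarrow> smooth_on S (\<lambda>x. \<D> f x u)"
  unfolding smooth_on_def using Ck_on.simps(2)[of _ S f] by blast

lemma smooth_on_continuous: "smooth_on S f \<Longrightarrow> continuous_on S f"
  unfolding smooth_on_def using Ck_on.simps(1)[of S f] by blast

lemma frechet_derivative_cong_open:
  assumes "\<And>x. x \<in> S \<Longrightarrow> f x = g x" "open S" "x \<in> S"
  shows "\<D> f x = \<D> g x"
proof -
  have "(f has_derivative f') (at x) \<longleftrightarrow> (g has_derivative f') (at x)" for f'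
    using has_derivative_transform_within_open[OF _ assms(2,3), of f f' UNIV g]
      has_derivative_transform_within_open[OF _ assms(2,3), of g f' UNIV f] assms(1) by auto
  then show ?thesis by (simp add: frechet_derivative_def)
qed

text \<open>The product rule for evaluating linear maps that depend on a point; the infinitesimal companion
  of \<open>Ck_on_linear_family\<close>.\<close>

lemma has_derivative_linear_family:
  fixes h :: "'e::euclidean_space \<Rightarrow> 'f::euclidean_space \<Rightarrow> 'g::real_normed_vector"
  assumes S: "open S" "x \<in> S" and lin: "\<And>y. y \<in> S \<Longrightarrow> linear (h y)"
    and h: "\<And>u. ((\<lambda>y. h y u) has_derivative h' u) (at x)"
    and L: "(L has_derivative L') (at x)"
  shows "((\<lambda>y. h y (L y)) has_derivative (\<lambda>a. h' (L x) a + h x (L' a))) (at x)"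
proof -
  have h'_sum: "h' u = (\<lambda>a. \<Sum>i\<in>Basis. (u \<bullet> i) *\<^sub>R h' i a)" for u
  proof (rule has_derivative_unique[OF h])
    have "((\<lambda>y. \<Sum>i\<in>Basis. (u \<bullet> i) *\<^sub>R h y i) has_derivative (\<lambda>a. \<Sum>i\<in>Basis. (u \<bullet> i) *\<^sub>R h' i a)) (at x)"
      by (intro has_derivative_sum has_derivative_scaleR_right h)
    then show "((\<lambda>y. h y u) has_derivative (\<lambda>a. \<Sum>i\<in>Basis. (u \<bullet> i) *\<^sub>R h' i a)) (at x)"
      by (rule has_derivative_transform_within_open[OF _ S])
        (rule linear_eq_sum_Basis[OF lin, symmetric])
  qed
  have "((\<lambda>y. \<Sum>i\<in>Basis. (L y \<bullet> i) *\<^sub>R h y i) has_derivative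
      (\<lambda>a. \<Sum>i\<in>Basis. (L x \<bullet> i) *\<^sub>R h' i a + (L' a \<bullet> i) *\<^sub>R h x i)) (at x)"
    by (intro has_derivative_sum has_derivative_scaleR h has_derivative_inner_left L)
  also have "(\<lambda>a. \<Sum>i\<in>Basis. (L x \<bullet> i) *\<^sub>R h' i a + (L' a \<bullet> i) *\<^sub>R h x i)
      = (\<lambda>a. h' (L x) a + h x (L' a))"
  proof
    fix a
    show "(\<Sum>i\<in>Basis. (L x \<bullet> i) *\<^sub>R h' i a + (L' a \<bullet> i) *\<^sub>R h x i) = h' (L x) a + h x (L' a)"
      by (simp add: sum.distrib h'_sum[of "L x"] linear_eq_sum_Basis[OF lin[OF S(2)], of "L' a"])
  qed
  finally show ?thesis
    by (rule has_derivative_transform_within_open[OF _ S])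
      (rule linear_eq_sum_Basis[OF lin, symmetric])
qed

section \<open>Symmetry of second derivatives\<close>

text \<open>The second difference over a small parallelogram is symmetric in \<open>u\<close> and \<open>w\<close>, while the mean value
  theorem makes it a mixed second derivative at a nearby point. Comparing both orders in the limit
  gives the symmetry of second derivatives.\<close>

lemma second_difference_mean_value:
  fixes f :: "'e::euclidean_space \<Rightarrow> real"
  assumes dif: "\<And>y. y \<in> ball x r \<Longrightarrow> f differentiable (at y)"
    and dif2: "\<And>y. y \<in> ball x r \<Longrightarrow> (\<lambda>y. \<D> f y u) differentiable (at y)"
    and h: "0 < h" "h * (norm u + norm w) < r"
  obtains y where "dist x y \<le> h * (norm u + norm w)"
    "f (x + h *\<^sub>R u + h *\<^sub>R w) - f (x + h *\<^sub>R u) - f (x + h *\<^sub>R w) + f x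
       = h * h * \<D> (\<lambda>y. \<D> f y u) y w"
proof -
  have near: "dist x (x + s *\<^sub>R u + t *\<^sub>R w) \<le> h * (norm u + norm w)"
    if "0 \<le> s" "s \<le> h" "0 \<le> t" "t \<le> h" for s t
  proof -
    have "norm (s *\<^sub>R u + t *\<^sub>R w) \<le> s * norm u + t * norm w"
      using that norm_triangle_ineq[of "s *\<^sub>R u" "t *\<^sub>R w"] by simp
    also have "\<dots> \<le> h * norm u + h * norm w"
      using that by (intro add_mono mult_right_mono) auto
    finally show ?thesis
      using norm_minus_cancel[of "s *\<^sub>R u + t *\<^sub>R w"] by (simp add: dist_norm algebra_simps)
  qed
  have inb: "x + s *\<^sub>R u + t *\<^sub>R w \<in> ball x r"
    if "0 \<le> s" "s \<le> h" "0 \<le> t" "t \<le> h" for s t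
    using near[OF that] h by simp
  have line: "((\<lambda>s. g (z + s *\<^sub>R a)) has_real_derivative \<D> g (z + s *\<^sub>R a) a) (at s)"
    if "g differentiable (at (z + s *\<^sub>R a))" for g :: "'e \<Rightarrow> real" and z a s
  proof -
    have "((\<lambda>s. z + s *\<^sub>R a) has_derivative (\<lambda>c. c *\<^sub>R a)) (at s)"
      by (auto intro!: derivative_eq_intros)
    then have "((\<lambda>s. g (z + s *\<^sub>R a)) has_derivative (\<lambda>c. \<D> g (z + s *\<^sub>R a) (c *\<^sub>R a))) (at s)"
      by (rule has_derivative_compose) (use that frechet_derivative_works in blast)
    then show ?thesis
      by (simp add: has_field_derivative_def linear_cmul[OF linear_frechet_derivative[OF that]]
          mult_commute_abs)
  qed
  \<comment> \<open>Two applications of the mean value theorem, first along \<open>u\<close>, then along \<open>w\<close>.\<close>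
  define \<phi> where "\<phi> = (\<lambda>s. f (x + h *\<^sub>R w + s *\<^sub>R u) - f (x + s *\<^sub>R u))"
  have "\<exists>s>0. s < h \<and> \<phi> h - \<phi> 0
      = (h - 0) * (\<D> f (x + h *\<^sub>R w + s *\<^sub>R u) u - \<D> f (x + s *\<^sub>R u) u)"
  proof (rule MVT2)
    fix s assume "0 \<le> s" "s \<le> h"
    then show "DERIV \<phi> s :> \<D> f (x + h *\<^sub>R w + s *\<^sub>R u) u - \<D> f (x + s *\<^sub>R u) u"
      unfolding \<phi>_def using inb[of s h] inb[of s 0] h
      by (intro DERIV_diff line dif) (auto simp: algebra_simps)
  qed (use h in auto)
  then obtain s where s: "0 < s" "s < h"
    "\<phi> h - \<phi> 0 = h * (\<D> f (x + h *\<^sub>R w + s *\<^sub>R u) u - \<D> f (x + s *\<^sub>R u) u)" by auto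
  define \<eta> where "\<eta> = (\<lambda>t. \<D> f (x + s *\<^sub>R u + t *\<^sub>R w) u)"
  have "\<exists>t>0. t < h \<and> \<eta> h - \<eta> 0 = (h - 0) * \<D> (\<lambda>y. \<D> f y u) (x + s *\<^sub>R u + t *\<^sub>R w) w"
  proof (rule MVT2)
    fix t assume "0 \<le> t" "t \<le> h"
    then show "DERIV \<eta> t :> \<D> (\<lambda>y. \<D> f y u) (x + s *\<^sub>R u + t *\<^sub>R w) w"
      unfolding \<eta>_def using inb[of s t] s by (intro line dif2) auto
  qed (use h in auto)
  then obtain t where t: "0 < t" "t < h"
    "\<eta> h - \<eta> 0 = h * \<D> (\<lambda>y. \<D> f y u) (x + s *\<^sub>R u + t *\<^sub>R w) w" by auto
  have "\<phi> h - \<phi> 0 = h * (\<eta> h - \<eta> 0)"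
    using s(3) by (simp add: \<eta>_def algebra_simps)
  then have "\<phi> h - \<phi> 0 = h * h * \<D> (\<lambda>y. \<D> f y u) (x + s *\<^sub>R u + t *\<^sub>R w) w"
    using t(3) by simp
  then show ?thesis
    using that[of "x + s *\<^sub>R u + t *\<^sub>R w"] near[of s t] s t by (simp add: \<phi>_def algebra_simps)
qed

lemma second_derivative_symmetric_real:
  fixes f :: "'e::euclidean_space \<Rightarrow> real"
  assumes S: "open S" "x \<in> S" and f: "Ck_on 2 S f"
  shows "\<D> (\<lambda>y. \<D> f y u) x w = \<D> (\<lambda>y. \<D> f y w) x u"
proof -
  obtain r where r: "0 < r" "ball x r \<subseteq> S" using S openE by blast
  have f2: "Ck_on (Suc (Suc 0)) S f" using f by (simp add: numeral_2_eq_2)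
  have dif: "f differentiable (at y)" "(\<lambda>y. \<D> f y a) differentiable (at y)" if "y \<in> ball x r" for y a
    using f2 that r by auto
  have cont: "continuous (at x) (\<lambda>y. \<D> (\<lambda>y. \<D> f y a) y b)" for a b
  proof -
    have "continuous_on S (\<lambda>y. \<D> (\<lambda>y. \<D> f y a) y b)" using f2 by simp
    then show ?thesis using S by (simp add: continuous_on_eq_continuous_at)
  qed
  define K where "K = norm u + norm w"
  have K: "0 \<le> K" by (simp add: K_def)
  have "\<bar>\<D> (\<lambda>y. \<D> f y u) x w - \<D> (\<lambda>y. \<D> f y w) x u\<bar> < 2 * e" if "e > 0" for e
  proof -
    obtain d1 where d1: "d1 > 0"
      "\<And>y. dist y x < d1 \<Longrightarrow> \<bar>\<D> (\<lambda>y. \<D> f y u) y w - \<D> (\<lambda>y. \<D> f y u) x w\<bar> < e"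
      using cont[of u w] \<open>e > 0\<close> unfolding continuous_at_eps_delta
      by (metis dist_real_def dist_commute dist_norm)
    obtain d2 where d2: "d2 > 0"
      "\<And>y. dist y x < d2 \<Longrightarrow> \<bar>\<D> (\<lambda>y. \<D> f y w) y u - \<D> (\<lambda>y. \<D> f y w) x u\<bar> < e"
      using cont[of w u] \<open>e > 0\<close> unfolding continuous_at_eps_delta
      by (metis dist_real_def dist_commute dist_norm)
    define d where "d = min r (min d1 d2)"
    \<comment> \<open>Small enough for both mean value points to lie within \<open>d\<close> of \<open>x\<close>.\<close>
    define h where "h = d / (K + 1)"
    have d: "d > 0" using d1 d2 r by (simp add: d_def)
    have h: "h > 0" using d K by (simp add: h_def)
    have hK: "h * K < d"
      using d K by (simp add: h_def field_simps)
    then have hK': "h * (norm u + norm w) < r" "h * (norm w + norm u) < r"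
      by (simp_all add: d_def K_def add.commute)
    obtain y1 where y1: "dist x y1 \<le> h * K"
      "f (x + h *\<^sub>R u + h *\<^sub>R w) - f (x + h *\<^sub>R u) - f (x + h *\<^sub>R w) + f x
       = h * h * \<D> (\<lambda>y. \<D> f y u) y1 w"
      using second_difference_mean_value[OF dif(1) dif(2) h hK'(1)] unfolding K_def by blast
    obtain y2 where y2: "dist x y2 \<le> h * K"
      "f (x + h *\<^sub>R w + h *\<^sub>R u) - f (x + h *\<^sub>R w) - f (x + h *\<^sub>R u) + f x
       = h * h * \<D> (\<lambda>y. \<D> f y w) y2 u"
      using second_difference_mean_value[OF dif(1) dif(2) h hK'(2)] unfolding K_def
      by (metis add.commute)
    have "h * h * \<D> (\<lambda>y. \<D> f y u) y1 w = h * h * \<D> (\<lambda>y. \<D> f y w) y2 u"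
      unfolding y1(2)[symmetric] y2(2)[symmetric] by (simp add: algebra_simps)
    then have "\<D> (\<lambda>y. \<D> f y u) y1 w = \<D> (\<lambda>y. \<D> f y w) y2 u" using h by simp
    moreover have "\<bar>\<D> (\<lambda>y. \<D> f y u) y1 w - \<D> (\<lambda>y. \<D> f y u) x w\<bar> < e"
      using d1(2)[of y1] y1(1) hK by (simp add: d_def dist_commute)
    moreover have "\<bar>\<D> (\<lambda>y. \<D> f y w) y2 u - \<D> (\<lambda>y. \<D> f y w) x u\<bar> < e"
      using d2(2)[of y2] y2(1) hK by (simp add: d_def dist_commute)
    ultimately show ?thesis by linarith
  qed
  from this[of "\<bar>\<D> (\<lambda>y. \<D> f y u) x w - \<D> (\<lambda>y. \<D> f y w) x u\<bar> / 2"] show ?thesis by auto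
qed

lemma smooth_on_second_derivative_symmetric:
  fixes f :: "'e::euclidean_space \<Rightarrow> 'f::euclidean_space"
  assumes f: "smooth_on S f" and S: "open S" "x \<in> S"
  shows "\<D> (\<lambda>y. \<D> f y u) x w = \<D> (\<lambda>y. \<D> f y w) x u"
proof (rule euclidean_eqI)
  fix i :: 'f assume "i \<in> Basis"
  have comp: "\<D> (\<lambda>y. g y \<bullet> i) y a = \<D> g y a \<bullet> i" if "smooth_on S g" "y \<in> S" for g :: "'e \<Rightarrow> 'f" and y a
    using frechet_derivative_at[OF has_derivative_inner_left[OF smooth_on_has_derivative[OF that]], of i]
    by metis
  have second: "\<D> (\<lambda>y. \<D> (\<lambda>y. f y \<bullet> i) y a) x b = \<D> (\<lambda>y. \<D> f y a) x b \<bullet> i" for a b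
  proof -
    have "\<D> (\<lambda>y. \<D> (\<lambda>y. f y \<bullet> i) y a) x b = \<D> (\<lambda>y. \<D> f y a \<bullet> i) x b"
      by (rule arg_cong[where f = "\<lambda>L. L b"], rule frechet_derivative_cong_open[OF comp[OF f] S])
    also have "\<dots> = \<D> (\<lambda>y. \<D> f y a) x b \<bullet> i"
      by (rule comp[OF smooth_on_deriv[OF f] S(2)])
    finally show ?thesis .
  qed
  have "Ck_on 2 S (\<lambda>y. f y \<bullet> i)"
    using f S unfolding smooth_on_def
    by (blast intro: Ck_on_bounded_linear_compose[OF bounded_linear_inner_left])
  from second_derivative_symmetric_real[OF S this, of u w]
  show "\<D> (\<lambda>y. \<D> f y u) x w \<bullet> i = \<D> (\<lambda>y. \<D> f y w) x u \<bullet> i"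
    by (simp add: second)
qed

section \<open>Tangent vectors, functions and 1-forms in charts\<close>

abbreviation transition :: "('a, 'e) chart \<Rightarrow> ('a, 'f) chart \<Rightarrow> 'e \<Rightarrow> 'f" where
  "transition c d \<equiv> coord d \<circ> param c"

abbreviation overlap :: "('a, 'e) chart \<Rightarrow> ('a, 'f) chart \<Rightarrow> 'e set" where
  "overlap c d \<equiv> coord c ` (dom_of c \<inter> dom_of d)"

lemma param_in_dom: "x \<in> img_of c \<Longrightarrow> param c x \<in> dom_of c"
  by (simp add: img_of_def param_def inv_into_into)

lemma coord_param: "x \<in> img_of c \<Longrightarrow> coord c (param c x) = x"
  by (simp add: img_of_def param_def f_inv_into_f)

lemma coord_in_img: "p \<in> dom_of c \<Longrightarrow> coord c p \<in> img_of c"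
  by (simp add: img_of_def)

lemma points_iff: "p \<in> points B \<longleftrightarrow> (\<exists>c\<in>B. p \<in> dom_of c)"
  by (auto simp: points_def)

lemma chart_at:
  assumes "p \<in> points B"
  shows "chart_at B p \<in> B" "p \<in> dom_of (chart_at B p)"
proof -
  have "\<exists>c. c \<in> B \<and> p \<in> dom_of c" using assms by (simp add: points_iff Bex_def)
  from someI_ex[OF this] show "chart_at B p \<in> B" "p \<in> dom_of (chart_at B p)"
    unfolding chart_at_def by (rule conjunct1, rule conjunct2)
qed

definition cov1_coeff ::
  "('a, 'e::euclidean_space) chart set \<Rightarrow> ('a, 'e) cov1 \<Rightarrow> ('a, 'e) chart \<Rightarrow> 'e \<Rightarrow> 'e \<Rightarrow> real" where
  "cov1_coeff B \<omega> c x u = \<omega> (param c x) (coord_vector B c (param c x) u)"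

definition smooth_cov1 :: "('a, 'e::euclidean_space) chart set \<Rightarrow> ('a, 'e) cov1 \<Rightarrow> bool" where
  "smooth_cov1 B \<omega> \<longleftrightarrow> (\<forall>p\<in>points B. linear_on_tangent B p (\<omega> p)) \<and>
     (\<forall>c\<in>B. \<forall>u. smooth_on (img_of c) (\<lambda>x. cov1_coeff B \<omega> c x u))"

text \<open>The part of the definition of a manifold that makes calculus in charts possible. It is separated
  from the topological conditions so that it can be inherited by the tangent bundle.\<close>

locale smooth_atlas =
  fixes B :: "('a, 'e::euclidean_space) chart set"
  assumes inj_coord: "c \<in> B \<Longrightarrow> inj_on (coord c) (dom_of c)"
    and open_img: "c \<in> B \<Longrightarrow> open (img_of c)"
    and open_overlap: "\<lbrakk>c \<in> B; d \<in> B\<rbrakk> \<Longrightarrow> open (overlap c d)"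
    and smooth_transition: "\<lbrakk>c \<in> B; d \<in> B\<rbrakk> \<Longrightarrow> smooth_on (overlap c d) (transition c d)"
begin

lemma param_coord: "\<lbrakk>c \<in> B; p \<in> dom_of c\<rbrakk> \<Longrightarrow> param c (coord c p) = p"
  by (simp add: param_def inj_coord)

lemma coord_image_iff:
  assumes "c \<in> B"
  shows "x \<in> coord c ` (dom_of c \<inter> U) \<longleftrightarrow> x \<in> img_of c \<and> param c x \<in> U"
  using param_coord[OF assms] param_in_dom[of x c] coord_param[of x c]
  by (auto simp: img_of_def image_iff)

lemma transition_has_derivative:
  assumes "c \<in> B" "d \<in> B" "p \<in> dom_of c" "p \<in> dom_of d"
  shows "(transition c d has_derivative \<D> (transition c d) (coord c p)) (at (coord c p))"
  using smooth_on_has_derivative[OF smooth_transition] assms by blast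

lemma linear_deriv_transition:
  assumes "c \<in> B" "d \<in> B" "p \<in> dom_of c" "p \<in> dom_of d"
  shows "linear (\<D> (transition c d) (coord c p))"
  using smooth_on_linear_deriv[OF smooth_transition] assms by blast

lemma deriv_transition_self:
  assumes "c \<in> B" "p \<in> dom_of c"
  shows "\<D> (transition c c) (coord c p) u = u"
proof -
  have "\<D> (transition c c) (coord c p) = \<D> (\<lambda>x. x) (coord c p)"
    by (rule frechet_derivative_cong_open[OF _ open_img[OF assms(1)] coord_in_img[OF assms(2)]])
      (simp add: coord_param)
  then show ?thesis by simp
qed

lemma deriv_transition_trans:
  assumes "c \<in> B" "d \<in> B" "e \<in> B" "p \<in> dom_of c" "p \<in> dom_of d" "p \<in> dom_of e"
  shows "\<D> (transition d e) (coord d p) (\<D> (transition c d) (coord c p) u)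
       = \<D> (transition c e) (coord c p) u"
proof -
  have eq: "transition c d (coord c p) = coord d p" by (simp add: assms param_coord)
  have "((\<lambda>x. transition d e (transition c d x)) has_derivative
      (\<lambda>u. \<D> (transition d e) (coord d p) (\<D> (transition c d) (coord c p) u))) (at (coord c p))"
    by (rule has_derivative_compose[OF transition_has_derivative[OF assms(1,2,4,5)]])
      (simp only: eq, rule transition_has_derivative[OF assms(2,3,5,6)])
  then have "(transition c e has_derivative
      (\<lambda>u. \<D> (transition d e) (coord d p) (\<D> (transition c d) (coord c p) u))) (at (coord c p))"
    by (rule has_derivative_transform_within_open[OF _ open_overlap[of c d]])
      (use assms in \<open>auto simp: param_coord\<close>)
  then show ?thesis by (rule fun_cong[OF frechet_derivative_at])
qed

lemma coord_vector_apply: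
  assumes "d \<in> B" "p \<in> dom_of d"
  shows "coord_vector B c p u d = \<D> (transition c d) (coord c p) u"
  using assms by (simp add: coord_vector_def)

lemma coord_vector_apply_self:
  assumes "c \<in> B" "p \<in> dom_of c"
  shows "coord_vector B c p u c = u"
  using assms by (simp add: coord_vector_apply deriv_transition_self)

lemma coord_vector_in_tangent_space:
  assumes "c \<in> B" "p \<in> dom_of c"
  shows "coord_vector B c p u \<in> tangent_space B p"
  using assms deriv_transition_trans[of c]
  by (auto simp: tangent_space_def coord_vector_def)

lemma tangent_space_apply:
  assumes "\<xi> \<in> tangent_space B p" "c \<in> B" "d \<in> B" "p \<in> dom_of c" "p \<in> dom_of d"
  shows "\<xi> d = \<D> (transition c d) (coord c p) (\<xi> c)"
  using assms unfolding tangent_space_def by blast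

lemma coord_vector_of_tangent:
  assumes "\<xi> \<in> tangent_space B p" "c \<in> B" "p \<in> dom_of c"
  shows "coord_vector B c p (\<xi> c) = \<xi>"
proof
  fix d
  show "coord_vector B c p (\<xi> c) d = \<xi> d"
  proof (cases "d \<in> B \<and> p \<in> dom_of d")
    case True
    then show ?thesis by (simp only: coord_vector_apply tangent_space_apply[OF assms(1,2) _ assms(3)])
  next
    case False
    moreover from this have "\<xi> d = 0" using assms(1) unfolding tangent_space_def by blast
    ultimately show ?thesis by (auto simp: coord_vector_def)
  qed
qed

lemma tangent_eqI:
  assumes "\<xi> \<in> tangent_space B p" "\<eta> \<in> tangent_space B p" "c \<in> B" "p \<in> dom_of c" "\<xi> c = \<eta> c"
  shows "\<xi> = \<eta>"
  by (rule trans[OF coord_vector_of_tangent[OF assms(1,3,4), symmetric]])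
    (simp only: assms(5) coord_vector_of_tangent[OF assms(2,3,4)])

lemma coord_vector_change:
  assumes "c \<in> B" "d \<in> B" "p \<in> dom_of c" "p \<in> dom_of d"
  shows "coord_vector B d p (\<D> (transition c d) (coord c p) u) = coord_vector B c p u"
  using coord_vector_of_tangent[OF coord_vector_in_tangent_space[OF assms(1,3)] assms(2,4), of u]
  by (simp add: coord_vector_apply assms)

lemma coord_vector_combination:
  assumes "c \<in> B" "p \<in> dom_of c"
  shows "coord_vector B c p (a *\<^sub>R u + b *\<^sub>R w)
       = (\<lambda>d. a *\<^sub>R coord_vector B c p u d + b *\<^sub>R coord_vector B c p w d)"
proof
  fix d
  show "coord_vector B c p (a *\<^sub>R u + b *\<^sub>R w) d
      = a *\<^sub>R coord_vector B c p u d + b *\<^sub>R coord_vector B c p w d"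
  proof (cases "d \<in> B \<and> p \<in> dom_of d")
    case True
    then show ?thesis
      using linear_deriv_transition[of c d p] assms
      by (simp add: coord_vector_apply linear_add linear_cmul)
  qed (auto simp: coord_vector_def)
qed

lemma linear_coord_vector:
  assumes "linear_on_tangent B p L" "c \<in> B" "p \<in> dom_of c"
  shows "linear (\<lambda>u. L (coord_vector B c p u))"
proof (rule linearI)
  have *: "L (coord_vector B c p (a *\<^sub>R u + b *\<^sub>R w))
      = a * L (coord_vector B c p u) + b * L (coord_vector B c p w)" for a b u w
    using assms coord_vector_in_tangent_space[OF assms(2,3)]
    by (simp add: coord_vector_combination linear_on_tangent_def)
  show "L (coord_vector B c p (u + w)) = L (coord_vector B c p u) + L (coord_vector B c p w)" for u w
    using *[of 1 u 1 w] by simp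
  show "L (coord_vector B c p (r *\<^sub>R u)) = r *\<^sub>R L (coord_vector B c p u)" for r u
    using *[of r u 0 0] by simp
qed

lemma smooth_fun_has_derivative:
  assumes "smooth_fun B f" "c \<in> B" "p \<in> dom_of c"
  shows "((f \<circ> param c) has_derivative \<D> (f \<circ> param c) (coord c p)) (at (coord c p))"
  using assms by (intro smooth_on_has_derivative[of "img_of c"] coord_in_img) (simp_all add: smooth_fun_def)

text \<open>The chart at which a differential is computed is chosen arbitrarily; the chain rule for the
  transition map shows that every chart gives the same value.\<close>

lemma differential_chart:
  assumes f: "smooth_fun B f" and \<xi>: "\<xi> \<in> tangent_space B p" and c: "c \<in> B" "p \<in> dom_of c"
  shows "differential B f p \<xi> = \<D> (f \<circ> param c) (coord c p) (\<xi> c)"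
proof -
  define d where "d = chart_at B p"
  have d: "d \<in> B" "p \<in> dom_of d" using chart_at[of p B] c by (auto simp: d_def points_iff)
  have eq: "transition c d (coord c p) = coord d p" by (simp add: c param_coord)
  have "((\<lambda>x. (f \<circ> param d) (transition c d x)) has_derivative
      (\<lambda>u. \<D> (f \<circ> param d) (coord d p) (\<D> (transition c d) (coord c p) u))) (at (coord c p))"
    by (rule has_derivative_compose[OF transition_has_derivative[OF c(1) d(1) c(2) d(2)]])
      (simp only: eq, rule smooth_fun_has_derivative[OF f d])
  then have "((f \<circ> param c) has_derivative
      (\<lambda>u. \<D> (f \<circ> param d) (coord d p) (\<D> (transition c d) (coord c p) u))) (at (coord c p))"
    by (rule has_derivative_transform_within_open[OF _ open_overlap[OF c(1) d(1)]])
      (use c d in \<open>auto simp: param_coord\<close>)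
  then have "\<D> (f \<circ> param c) (coord c p)
      = (\<lambda>u. \<D> (f \<circ> param d) (coord d p) (\<D> (transition c d) (coord c p) u))"
    by (rule frechet_derivative_at[symmetric])
  then show ?thesis
    using tangent_space_apply[OF \<xi> c(1) d(1) c(2) d(2)] by (simp add: differential_def d_def Let_def)
qed

lemma cov1_coeff_change:
  assumes "c \<in> B" "d \<in> B" "x \<in> overlap c d"
  shows "cov1_coeff B \<omega> c x u = cov1_coeff B \<omega> d (transition c d x) (\<D> (transition c d) x u)"
proof -
  obtain p where p: "x = coord c p" "p \<in> dom_of c" "p \<in> dom_of d" using assms by blast
  show ?thesis
    unfolding cov1_coeff_def p(1)
    using assms p coord_vector_change[of c d p u] by (simp add: param_coord)
qed

lemma linear_cov1_coeff:
  assumes "smooth_cov1 B \<omega>" "c \<in> B" "x \<in> img_of c"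
  shows "linear (cov1_coeff B \<omega> c x)"
proof -
  have p: "param c x \<in> dom_of c" by (rule param_in_dom[OF assms(3)])
  then have "param c x \<in> points B" using assms(2) by (auto simp: points_iff)
  then have "linear_on_tangent B (param c x) (\<omega> (param c x))"
    using assms(1) by (simp add: smooth_cov1_def)
  from linear_coord_vector[OF this assms(2) p] show ?thesis by (simp add: cov1_coeff_def[abs_def])
qed

text \<open>Under a change of chart the second derivatives of the transition map enter, but they are symmetric
  and cancel in the alternating expression.\<close>

lemma ext_deriv1_chart:
  assumes \<omega>: "smooth_cov1 B \<omega>" and \<xi>: "\<xi> \<in> tangent_space B p" and \<eta>: "\<eta> \<in> tangent_space B p"
    and c: "c \<in> B" "p \<in> dom_of c"
  shows "ext_deriv1 B \<omega> p \<xi> \<eta> = \<D> (\<lambda>x. cov1_coeff B \<omega> c x (\<eta> c)) (coord c p) (\<xi> c)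
      - \<D> (\<lambda>x. cov1_coeff B \<omega> c x (\<xi> c)) (coord c p) (\<eta> c)"
proof -
  define d where "d = chart_at B p"
  have d: "d \<in> B" "p \<in> dom_of d" using chart_at[of p B] c by (auto simp: d_def points_iff)
  define T where "T = transition c d"
  define x where "x = coord c p"
  have x: "x \<in> overlap c d" using c d by (auto simp: x_def)
  have Tx: "T x = coord d p" by (simp add: T_def x_def c param_coord)
  have openO: "open (overlap c d)" by (rule open_overlap[OF c(1) d(1)])
  have smT: "smooth_on (overlap c d) T" unfolding T_def by (rule smooth_transition[OF c(1) d(1)])
  have T': "(T has_derivative \<D> T x) (at x)" by (rule smooth_on_has_derivative[OF smT x])
  have Tim: "T y \<in> img_of d" if "y \<in> overlap c d" for y
    using that c d by (auto simp: T_def param_coord coord_in_img)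
  let ?h = "\<lambda>y u. cov1_coeff B \<omega> d y u"
  have dh: "((\<lambda>y. ?h (T y) u) has_derivative (\<lambda>a. \<D> (\<lambda>y. ?h y u) (T x) (\<D> T x a))) (at x)" for u
    by (rule has_derivative_compose[OF T' smooth_on_has_derivative])
      (use \<omega> d Tim[OF x] in \<open>auto simp: smooth_cov1_def\<close>)
  have D: "\<D> (\<lambda>y. cov1_coeff B \<omega> c y u) x a
      = \<D> (\<lambda>y. ?h y (\<D> T x u)) (T x) (\<D> T x a) + ?h (T x) (\<D> (\<lambda>y. \<D> T y u) x a)" for u a
  proof -
    have "((\<lambda>y. ?h (T y) (\<D> T y u)) has_derivative
        (\<lambda>a. \<D> (\<lambda>y. ?h y (\<D> T x u)) (T x) (\<D> T x a) + ?h (T x) (\<D> (\<lambda>y. \<D> T y u) x a))) (at x)"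
      by (rule has_derivative_linear_family[OF openO x _ dh
            smooth_on_has_derivative[OF smooth_on_deriv[OF smT] x]])
        (rule linear_cov1_coeff[OF \<omega> d(1) Tim])
    then have "((\<lambda>y. cov1_coeff B \<omega> c y u) has_derivative
        (\<lambda>a. \<D> (\<lambda>y. ?h y (\<D> T x u)) (T x) (\<D> T x a) + ?h (T x) (\<D> (\<lambda>y. \<D> T y u) x a))) (at x)"
      by (rule has_derivative_transform_within_open[OF _ openO x])
        (rule cov1_coeff_change[OF c(1) d(1), folded T_def, symmetric])
    then show ?thesis by (rule fun_cong[OF frechet_derivative_at, symmetric])
  qed
  have "\<xi> d = \<D> T x (\<xi> c)" "\<eta> d = \<D> T x (\<eta> c)"
    using tangent_space_apply[OF \<xi> c(1) d(1) c(2) d(2)] tangent_space_apply[OF \<eta> c(1) d(1) c(2) d(2)]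
    by (simp_all add: T_def x_def)
  moreover have "\<D> (\<lambda>y. \<D> T y (\<eta> c)) x (\<xi> c) = \<D> (\<lambda>y. \<D> T y (\<xi> c)) x (\<eta> c)"
    by (rule smooth_on_second_derivative_symmetric[OF smT openO x])
  ultimately show ?thesis
    unfolding x_def[symmetric] D
    by (simp add: ext_deriv1_def d_def[symmetric] Let_def Tx cov1_coeff_def[symmetric])
qed

text \<open>A velocity has to be checked in one chart only: continuity in that chart keeps the curve inside
  the overlap with every other chart, where the transition map carries the derivative over.\<close>

lemma has_velocityI:
  assumes \<xi>: "\<xi> \<in> tangent_space B (\<gamma> t)" and c: "c \<in> B" "\<gamma> t \<in> dom_of c"
    and ev: "\<forall>\<^sub>F s in nhds t. \<gamma> s \<in> dom_of c"
    and der: "((coord c \<circ> \<gamma>) has_vector_derivative \<xi> c) (at t)"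
  shows "has_velocity B \<gamma> t \<xi>"
  unfolding has_velocity_def
proof (intro conjI ballI impI)
  show "\<gamma> t \<in> points B" using c by (auto simp: points_iff)
  fix d assume d: "d \<in> B" "\<gamma> t \<in> dom_of d"
  have "\<forall>\<^sub>F s in nhds t. coord c (\<gamma> s) \<in> overlap c d"
  proof -
    have "isCont (coord c \<circ> \<gamma>) t" using der by (rule has_vector_derivative_continuous)
    then have "((coord c \<circ> \<gamma>) \<longlongrightarrow> (coord c \<circ> \<gamma>) t) (nhds t)"
      by (simp only: continuous_within tendsto_at_iff_tendsto_nhds)
    from topological_tendstoD[OF this open_overlap[OF c(1) d(1)]] c d
    show ?thesis by auto
  qed
  with ev have ev2: "\<forall>\<^sub>F s in nhds t. \<gamma> s \<in> dom_of c \<and> \<gamma> s \<in> dom_of d"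
  proof eventually_elim
    case (elim s)
    then show ?case using coord_image_iff[OF c(1), of _ "dom_of d"] param_coord[OF c(1)] by auto
  qed
  then show "\<forall>\<^sub>F s in nhds t. \<gamma> s \<in> dom_of d" by eventually_elim simp
  have at: "(coord c \<circ> \<gamma>) t = coord c (\<gamma> t)" by simp
  have "((\<lambda>s. transition c d ((coord c \<circ> \<gamma>) s)) has_derivative
      (\<lambda>h. \<D> (transition c d) (coord c (\<gamma> t)) (h *\<^sub>R \<xi> c))) (at t)"
    by (rule has_derivative_compose[OF der[unfolded has_vector_derivative_def]])
      (simp only: at, rule transition_has_derivative[OF c(1) d(1) c(2) d(2)])
  then have "((\<lambda>s. transition c d ((coord c \<circ> \<gamma>) s)) has_derivative (\<lambda>h. h *\<^sub>R \<xi> d)) (at t)"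
    using linear_cmul[OF linear_deriv_transition[OF c(1) d(1) c(2) d(2)]]
      tangent_space_apply[OF \<xi> c(1) d(1) c(2) d(2)] by simp
  then have "((coord d \<circ> \<gamma>) has_derivative (\<lambda>h. h *\<^sub>R \<xi> d)) (at t)"
  proof (rule has_derivative_transform_eventually)
    have "\<forall>\<^sub>F s in nhds t. transition c d ((coord c \<circ> \<gamma>) s) = (coord d \<circ> \<gamma>) s"
      using ev2 by eventually_elim (simp add: param_coord c)
    then show "\<forall>\<^sub>F s in at t. transition c d ((coord c \<circ> \<gamma>) s) = (coord d \<circ> \<gamma>) s"
      by (simp add: eventually_nhds_conv_at)
  qed (use c in \<open>auto simp: param_coord\<close>)
  then show "((coord d \<circ> \<gamma>) has_vector_derivative \<xi> d) (at t)"
    by (simp add: has_vector_derivative_def)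
qed (rule \<xi>)

lemma velocity_eqI:
  assumes "has_velocity B \<gamma> t \<xi>"
  shows "velocity B \<gamma> t = \<xi>"
  unfolding velocity_def
proof (rule the_equality, rule assms)
  fix \<eta> assume \<eta>: "has_velocity B \<gamma> t \<eta>"
  obtain c where c: "c \<in> B" "\<gamma> t \<in> dom_of c" using assms by (auto simp: has_velocity_def points_iff)
  have "\<eta> c = \<xi> c"
    using assms \<eta> c vector_derivative_unique_at[of "coord c \<circ> \<gamma>" "\<eta> c" t "\<xi> c"]
    by (simp add: has_velocity_def)
  then show "\<eta> = \<xi>"
    using tangent_eqI[of \<eta> "\<gamma> t" \<xi> c] assms \<eta> c by (simp add: has_velocity_def)
qed

lemma has_velocity_differential:
  assumes "has_velocity B \<gamma> t \<xi>" and f: "smooth_fun B f"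
  shows "((\<lambda>s. f (\<gamma> s)) has_real_derivative differential B f (\<gamma> t) \<xi>) (at t)"
proof -
  obtain c where c: "c \<in> B" "\<gamma> t \<in> dom_of c" using assms by (auto simp: has_velocity_def points_iff)
  have \<xi>: "\<xi> \<in> tangent_space B (\<gamma> t)" and ev: "\<forall>\<^sub>F s in nhds t. \<gamma> s \<in> dom_of c"
    and der: "((coord c \<circ> \<gamma>) has_vector_derivative \<xi> c) (at t)"
    using assms c by (auto simp: has_velocity_def)
  have f': "((f \<circ> param c) has_derivative \<D> (f \<circ> param c) (coord c (\<gamma> t))) (at ((coord c \<circ> \<gamma>) t))"
    using smooth_fun_has_derivative[OF f c] by simp
  have "((\<lambda>s. (f \<circ> param c) ((coord c \<circ> \<gamma>) s)) has_derivative
      (\<lambda>h. \<D> (f \<circ> param c) (coord c (\<gamma> t)) (h *\<^sub>R \<xi> c))) (at t)"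
    by (rule has_derivative_compose[OF der[unfolded has_vector_derivative_def] f'])
  then have "((\<lambda>s. f (\<gamma> s)) has_derivative
      (\<lambda>h. \<D> (f \<circ> param c) (coord c (\<gamma> t)) (h *\<^sub>R \<xi> c))) (at t)"
  proof (rule has_derivative_transform_eventually)
    have "\<forall>\<^sub>F s in nhds t. (f \<circ> param c) ((coord c \<circ> \<gamma>) s) = f (\<gamma> s)"
      using ev by eventually_elim (simp add: param_coord c)
    then show "\<forall>\<^sub>F s in at t. (f \<circ> param c) ((coord c \<circ> \<gamma>) s) = f (\<gamma> s)"
      by (simp add: eventually_nhds_conv_at)
  qed (use c in \<open>auto simp: param_coord\<close>)
  moreover have "linear (\<D> (f \<circ> param c) (coord c (\<gamma> t)))"
    using f' has_derivative_linear by blast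
  ultimately show ?thesis
    using differential_chart[OF f \<xi> c]
    by (simp add: has_field_derivative_def linear_cmul mult_commute_abs)
qed

end

text \<open>The tangent map of \<open>F\<close> is the derivative of any of its coordinate expressions, by the chain rule
  on both sides.\<close>

lemma tangent_map_chart:
  assumes "smooth_atlas B" "smooth_atlas C" and F: "smooth_map B C F"
    and \<xi>: "\<xi> \<in> tangent_space B p" and c: "c \<in> B" "p \<in> dom_of c" and d: "d \<in> C" "F p \<in> dom_of d"
  shows "tangent_map B C F p \<xi>
       = coord_vector C d (F p) (\<D> (coord d \<circ> F \<circ> param c) (coord c p) (\<xi> c))"
proof
  interpret B: smooth_atlas B by fact
  interpret C: smooth_atlas C by fact
  define b where "b = chart_at B p"
  have b: "b \<in> B" "p \<in> dom_of b" using chart_at[of p B] c by (auto simp: b_def points_iff)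
  have op: "open (coord c' ` (dom_of c' \<inter> F -` dom_of d'))"
    and sm: "smooth_on (coord c' ` (dom_of c' \<inter> F -` dom_of d')) (coord d' \<circ> F \<circ> param c')"
    if "c' \<in> B" "d' \<in> C" for c' d'
    using F that by (auto simp: smooth_map_def)
  fix e
  show "tangent_map B C F p \<xi> e
      = coord_vector C d (F p) (\<D> (coord d \<circ> F \<circ> param c) (coord c p) (\<xi> c)) e"
  proof (cases "e \<in> C \<and> F p \<in> dom_of e")
    case True
    then have e: "e \<in> C" "F p \<in> dom_of e" by auto
    \<comment> \<open>Locally, \<open>F\<close> in the charts \<open>b\<close> and \<open>e\<close> is its expression \<open>G\<close> in \<open>c\<close> and \<open>d\<close> between two transitions.\<close>
    define G where "G = coord d \<circ> F \<circ> param c"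
    have G: "(G has_derivative \<D> G (coord c p)) (at (coord c p))" unfolding G_def
      by (rule smooth_on_has_derivative[OF sm[OF c(1) d(1)]]) (use c d in auto)
    have Gp: "G (coord c p) = coord d (F p)" by (simp add: G_def B.param_coord c)
    have Tp: "transition b c (coord b p) = coord c p" by (simp add: B.param_coord b)
    have "((\<lambda>x. G (transition b c x)) has_derivative
        (\<lambda>u. \<D> G (coord c p) (\<D> (transition b c) (coord b p) u))) (at (coord b p))"
      by (rule has_derivative_compose[OF B.transition_has_derivative[OF b(1) c(1) b(2) c(2)]])
        (use G Tp in simp)
    then have "((\<lambda>x. transition d e (G (transition b c x))) has_derivative
        (\<lambda>u. \<D> (transition d e) (coord d (F p)) (\<D> G (coord c p) (\<D> (transition b c) (coord b p) u))))
        (at (coord b p))"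
      by (rule has_derivative_compose)
        (use C.transition_has_derivative[OF d(1) e(1) d(2) e(2)] in \<open>simp only: Gp Tp\<close>)
    then have "((coord e \<circ> F \<circ> param b) has_derivative
        (\<lambda>u. \<D> (transition d e) (coord d (F p)) (\<D> G (coord c p) (\<D> (transition b c) (coord b p) u))))
        (at (coord b p))"
    proof (rule has_derivative_transform_within_open)
      let ?W = "overlap b c \<inter> (coord b ` (dom_of b \<inter> F -` dom_of d))"
      show "open ?W" by (intro open_Int B.open_overlap op b c d)
      show "coord b p \<in> ?W" using b c d by auto
      show "transition d e (G (transition b c x)) = (coord e \<circ> F \<circ> param b) x" if "x \<in> ?W" for x
      proof -
        have "param b x \<in> dom_of c" "F (param b x) \<in> dom_of d"
          using that B.coord_image_iff[OF b(1), of x "dom_of c"]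
            B.coord_image_iff[OF b(1), of x "F -` dom_of d"] by simp_all
        then show ?thesis by (simp add: G_def B.param_coord c C.param_coord d)
      qed
    qed
    then have D: "\<D> (coord e \<circ> F \<circ> param b) (coord b p)
        = (\<lambda>u. \<D> (transition d e) (coord d (F p)) (\<D> G (coord c p) (\<D> (transition b c) (coord b p) u)))"
      by (rule frechet_derivative_at[symmetric])
    have "tangent_map B C F p \<xi> e = \<D> (coord e \<circ> F \<circ> param b) (coord b p) (\<xi> b)"
      using e by (simp add: tangent_map_def b_def Let_def)
    also have "\<dots> = \<D> (transition d e) (coord d (F p)) (\<D> G (coord c p) (\<xi> c))"
      unfolding D using B.tangent_space_apply[OF \<xi> b(1) c(1) b(2) c(2)] by simp
    finally show ?thesis using e by (simp add: C.coord_vector_apply G_def)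
  next
    case False
    then show ?thesis by (auto simp: tangent_map_def coord_vector_def Let_def)
  qed
qed

section \<open>Local existence of solutions of differential equations\<close>

text \<open>Picard iteration: the solution is the fixed point of a contraction of the space of bounded
  continuous curves.\<close>

lemma picard_local_existence:
  fixes V :: "'e::euclidean_space \<Rightarrow> 'e"
  assumes r: "0 < r" and L: "0 \<le> L"
    and lip: "\<And>x y. \<lbrakk>x \<in> cball z r; y \<in> cball z r\<rbrakk> \<Longrightarrow> norm (V x - V y) \<le> L * norm (x - y)"
  obtains e \<gamma> where "0 < e" "\<gamma> 0 = z"
    "\<And>t. \<bar>t\<bar> < e \<Longrightarrow> \<gamma> t \<in> cball z r \<and> (\<gamma> has_vector_derivative V (\<gamma> t)) (at t)"
proof -
  \<comment> \<open>Composing with the nearest-point retraction onto the ball gives a globally Lipschitz bounded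
    field; it agrees with \<open>V\<close> along the solution, which does not leave the ball before time \<open>e\<close>.\<close>
  define W where "W = (\<lambda>x. V (closest_point (cball z r) x))"
  have ne: "cball z r \<noteq> {}" using r by simp
  have cp: "closest_point (cball z r) x \<in> cball z r" for x
    by (rule closest_point_in_set) (use ne in auto)
  have lipW: "norm (W x - W y) \<le> L * norm (x - y)" for x y
  proof -
    have "norm (W x - W y) \<le> L * dist (closest_point (cball z r) x) (closest_point (cball z r) y)"
      unfolding W_def using lip[OF cp cp] by (simp add: dist_norm)
    also have "\<dots> \<le> L * dist x y"
      by (rule mult_left_mono[OF closest_point_lipschitz L]) (use ne in auto)
    finally show ?thesis by (simp add: dist_norm)
  qed
  define M where "M = norm (V z) + L * r"
  have M: "0 \<le> M" using r L by (simp add: M_def)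
  have bW: "norm (W x) \<le> M" for x
  proof -
    have "norm (W x - V z) \<le> L * norm (closest_point (cball z r) x - z)"
      unfolding W_def using lip[OF cp, of z x] r by simp
    also have "\<dots> \<le> L * r"
      using cp[of x] by (intro mult_left_mono L) (simp add: dist_norm norm_minus_commute)
    finally show ?thesis
      using norm_triangle_sub[of "W x" "V z"] by (simp add: M_def)
  qed
  have contW: "continuous_on UNIV W"
    by (rule continuous_on_iff[THEN iffD2])
      (metis UNIV_I lipW L lipschitz_onI lipschitz_on_continuous_on continuous_on_iff dist_norm)
  \<comment> \<open>The Picard operator integrates over at most \<open>2e\<close> and once more over \<open>e\<close>, whence the factor
    \<open>3\<close>: \<open>3eL \<le> 1/2\<close> makes it a contraction, \<open>3eM \<le> r\<close> confines its fixed point to the ball.\<close>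
  define e where "e = min (1 / (6 * (L + 1))) (r / (3 * (M + 1)))"
  have e: "0 < e" using r L M by (simp add: e_def)
  have eL: "3 * e * L \<le> 1 / 2"
  proof -
    have "3 * e * L \<le> 3 * (1 / (6 * (L + 1))) * L"
      by (intro mult_right_mono L) (simp add: e_def)
    also have "\<dots> \<le> 1 / 2" using L by (simp add: field_simps)
    finally show ?thesis .
  qed
  have eM: "3 * e * M \<le> r"
  proof -
    have "3 * e * M \<le> 3 * (r / (3 * (M + 1))) * M"
      by (intro mult_right_mono M) (simp add: e_def)
    also have "\<dots> \<le> r" using M r by (simp add: field_simps)
    finally show ?thesis .
  qed
  define J where "J = (\<lambda>y t. integral {-e..t} (\<lambda>s. W (y s)))" for y :: "real \<Rightarrow> 'e"
  define cl where "cl = (\<lambda>t::real. max (-e) (min e t))"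
  have cl: "cl t \<in> {-e..e}" for t using e by (auto simp: cl_def)
  \<comment> \<open>\<open>J y t - J y 0\<close> is the integral from \<open>0\<close> to \<open>t\<close> for either sign of \<open>t\<close>; clamping the time makes
    the operator act on bounded continuous functions on the whole line.\<close>
  define T where "T = (\<lambda>y t. z + J y (cl t) - J y 0)"
  have contWy: "continuous_on A (\<lambda>s. W (y s))" if "continuous_on UNIV y" for y :: "real \<Rightarrow> 'e" and A
    using continuous_on_compose2[OF contW that] continuous_on_subset by blast
  have derJ: "(J y has_vector_derivative W (y t)) (at t within {-e..e})"
    if "continuous_on UNIV y" "t \<in> {-e..e}" for y t
    unfolding J_def using integral_has_vector_derivative[OF contWy[OF that(1)] that(2)] .
  have contJ: "continuous_on {-e..e} (J y)" if "continuous_on UNIV y" for y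
    unfolding continuous_on_eq_continuous_within
    using has_vector_derivative_continuous[OF derJ[OF that]] by blast
  have Tb: "T y \<in> bcontfun" if y: "continuous_on UNIV y" for y
  proof -
    have c: "continuous_on {-e..e} (\<lambda>t. z + J y t - J y 0)"
      by (intro continuous_intros contJ y)
    have "continuous_on UNIV (\<lambda>t. (\<lambda>t. z + J y t - J y 0) (cl t))"
      by (rule continuous_on_compose2[OF c]) (use cl in \<open>auto simp: cl_def intro!: continuous_intros\<close>)
    moreover have "bounded (range (T y))"
    proof (rule bounded_subset)
      show "bounded ((\<lambda>t. z + J y t - J y 0) ` {-e..e})"
        by (intro compact_imp_bounded compact_continuous_image c) simp
      show "range (T y) \<subseteq> (\<lambda>t. z + J y t - J y 0) ` {-e..e}" using cl by (auto simp: T_def)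
    qed
    ultimately show ?thesis by (simp add: bcontfun_def T_def)
  qed
  have int: "norm (integral {-e..t} f) \<le> K * (t + e)"
    if "continuous_on UNIV f" "\<And>s. norm (f s) \<le> K" "t \<in> {-e..e}" for f :: "real \<Rightarrow> 'e" and K t
    using integral_bound[of "-e" t f K] that continuous_on_subset by fastforce
  define F where "F = (\<lambda>y. Bcontfun (T (apply_bcontfun y)))"
  have F: "apply_bcontfun (F y) = T (apply_bcontfun y)" for y
    unfolding F_def by (rule Bcontfun_inverse) (rule Tb, simp)
  have contr: "dist (F y) (F w) \<le> 1 / 2 * dist y w" for y w
  proof (rule dist_bound)
    fix t
    have integrable: "(\<lambda>s. W (apply_bcontfun y s)) integrable_on {-e..t'}" for y :: "real \<Rightarrow>\<^sub>C 'e" and t'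
      by (intro integrable_continuous_real contWy) simp
    have J: "J y t' - J w t' = integral {-e..t'} (\<lambda>s. W (y s) - W (w s))" for t'
      unfolding J_def by (rule integral_diff[symmetric]) (rule integrable)+
    have bd: "norm (W (y s) - W (w s)) \<le> L * dist y w" for s
    proof -
      have "norm (W (y s) - W (w s)) \<le> L * dist (y s) (w s)" using lipW by (simp add: dist_norm)
      also have "\<dots> \<le> L * dist y w" by (intro mult_left_mono L dist_bounded)
      finally show ?thesis .
    qed
    have Jb: "norm (J y t' - J w t') \<le> L * dist y w * (t' + e)" if "t' \<in> {-e..e}" for t'
      unfolding J by (rule int[OF _ bd that]) (intro continuous_intros contWy, simp_all)
    have "norm (F y t - F w t) = norm ((J y (cl t) - J w (cl t)) - (J y 0 - J w 0))"
      by (simp add: F T_def algebra_simps)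
    also have "\<dots> \<le> L * dist y w * (cl t + e) + L * dist y w * (0 + e)"
      using e by (intro order_trans[OF norm_triangle_ineq4] add_mono Jb cl) auto
    also have "\<dots> \<le> L * dist y w * (e + e) + L * dist y w * (0 + e)"
      using cl[of t] L by (intro add_mono mult_left_mono) auto
    also have "\<dots> = 3 * e * L * dist y w" by (simp add: algebra_simps)
    also have "\<dots> \<le> 1 / 2 * dist y w" by (intro mult_right_mono eL) simp
    finally show "dist (F y t) (F w t) \<le> 1 / 2 * dist y w" by (simp add: dist_norm)
  qed
  have "\<exists>!y. F y = y" by (rule banach_fix_type[of "1 / 2"]) (use contr in auto)
  then obtain y where "F y = y" by blast
  then have y: "apply_bcontfun y t = z + J y (cl t) - J y 0" for t
    using fun_cong[OF F[of y], of t] by (simp add: T_def)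
  show ?thesis
  proof (rule that[of e "apply_bcontfun y"])
    show "y 0 = z" using y[of 0] e by (simp add: cl_def)
    fix t assume t: "\<bar>t\<bar> < e"
    have cl_eq: "cl s = s" if "s \<in> {-e<..<e}" for s using that by (auto simp: cl_def)
    have Jb: "norm (J y t') \<le> M * (t' + e)" if "t' \<in> {-e..e}" for t'
      unfolding J_def by (rule int[OF _ bW that]) (intro contWy, simp)
    have "norm (y t - z) = norm (J y (cl t) - J y 0)" unfolding y[of t] by simp
    also have "\<dots> \<le> M * (cl t + e) + M * (0 + e)"
      using e by (intro order_trans[OF norm_triangle_ineq4] add_mono Jb cl) auto
    also have "\<dots> \<le> M * (e + e) + M * (0 + e)"
      using cl[of t] M by (intro add_mono mult_left_mono) auto
    also have "\<dots> \<le> r" using eM by (simp add: algebra_simps)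
    finally have yt: "y t \<in> cball z r" by (simp add: dist_norm norm_minus_commute)
    have "(J y has_vector_derivative W (y t)) (at t within {-e..e})" 
      by (rule derJ) (use t in auto)
    then have "(J y has_vector_derivative W (y t)) (at t)"
      using at_within_interior[of t "{-e..e}"] t
      by (simp add: interior_atLeastAtMost_real abs_less_iff)
    then have "((\<lambda>s. z + J y s - J y 0) has_vector_derivative W (y t)) (at t)"
      by (auto intro!: derivative_eq_intros)
    then have "(apply_bcontfun y has_vector_derivative W (y t)) (at t)"
    proof (rule has_vector_derivative_transform_within_open)
      show "z + J y s - J y 0 = apply_bcontfun y s" if "s \<in> {-e<..<e}" for s
        unfolding y[of s] cl_eq[OF that] ..
    qed (use t in auto)
    moreover have "W (y t) = V (y t)" by (simp add: W_def closest_point_self[OF yt])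
    ultimately show "y t \<in> cball z r \<and> (apply_bcontfun y has_vector_derivative V (y t)) (at t)"
      using yt by simp
  qed (rule e)
qed

lemma smooth_on_lipschitz_cball:
  fixes f :: "'e::euclidean_space \<Rightarrow> 'f::real_normed_vector"
  assumes f: "smooth_on S f" and S: "cball z r \<subseteq> S"
  obtains L where "0 \<le> L"
    "\<And>x y. \<lbrakk>x \<in> cball z r; y \<in> cball z r\<rbrakk> \<Longrightarrow> norm (f x - f y) \<le> L * norm (x - y)"
proof -
  have "continuous_on (cball z r) (\<lambda>x. \<Sum>i\<in>Basis. norm (\<D> f x i))"
    by (intro continuous_intros continuous_on_subset[OF smooth_on_continuous[OF smooth_on_deriv[OF f]] S])
  then have "bounded ((\<lambda>x. \<Sum>i\<in>Basis. norm (\<D> f x i)) ` cball z r)"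
    by (intro compact_imp_bounded compact_continuous_image compact_cball)
  then obtain L where L: "0 < L" "\<And>x. x \<in> cball z r \<Longrightarrow> (\<Sum>i\<in>Basis. norm (\<D> f x i)) \<le> L"
    unfolding bounded_pos by (auto simp: abs_le_iff)
  have der: "(f has_derivative \<D> f x) (at x within cball z r)" if "x \<in> cball z r" for x
    using smooth_on_has_derivative[OF f] S that has_derivative_at_withinI by blast
  have "onorm (\<D> f x) \<le> L" if x: "x \<in> cball z r" for x
  proof (rule onorm_le)
    fix u :: 'e
    have "norm (\<D> f x u) \<le> (\<Sum>i\<in>Basis. norm ((u \<bullet> i) *\<^sub>R \<D> f x i))"
      using linear_eq_sum_Basis[OF has_derivative_linear[OF der[OF x]], of u] norm_sum by metis
    also have "\<dots> \<le> (\<Sum>i\<in>Basis. norm u * norm (\<D> f x i))"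
      by (intro sum_mono) (simp add: mult_right_mono Basis_le_norm)
    also have "\<dots> \<le> norm u * L"
      unfolding sum_distrib_left[symmetric] by (intro mult_left_mono L x) simp
    finally show "norm (\<D> f x u) \<le> L * norm u" by (simp add: mult.commute)
  qed
  then show ?thesis
    using that[of L] differentiable_bound[OF convex_cball der] L(1) by (meson less_imp_le)
qed

text \<open>Solving a positive definite linear system with smooth data gives a locally Lipschitz solution,
  which is what Picard iteration asks of the acceleration. A uniform lower bound of the quadratic
  forms near \<open>z\<close> controls both the size of the solutions and their differences.\<close>

lemma positive_definite_solution_lipschitz:
  fixes G :: "'z::euclidean_space \<Rightarrow> 'e::euclidean_space \<Rightarrow> 'e"
  assumes S: "open S" "z \<in> S"
    and lin: "\<And>x. x \<in> S \<Longrightarrow> linear (G x)" and G: "\<And>w. smooth_on S (\<lambda>x. G x w)"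
    and pos: "\<And>x w. \<lbrakk>x \<in> S; w \<noteq> 0\<rbrakk> \<Longrightarrow> G x w \<bullet> w > 0"
    and F: "smooth_on S F" and sol: "\<And>x. x \<in> S \<Longrightarrow> G x (b x) = F x"
  obtains r L where "0 < r" "cball z r \<subseteq> S" "0 \<le> L"
    "\<And>x y. \<lbrakk>x \<in> cball z r; y \<in> cball z r\<rbrakk> \<Longrightarrow> norm (b x - b y) \<le> L * norm (x - y)"
proof -
  obtain r where r: "0 < r" "cball z r \<subseteq> S" using S open_contains_cball by blast
  have "smooth_on (S \<times> UNIV) (\<lambda>p. G (fst p) (snd p))"
  proof (rule smooth_on_linear_family[where h = "\<lambda>p. G (fst p)" and L = snd])
    show "open (S \<times> (UNIV :: 'e set))" by (intro open_Times S) simp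
    then show "smooth_on (S \<times> (UNIV :: 'e set)) (\<lambda>p. G (fst p) w)" for w
      by (intro smooth_on_compose[OF G] smooth_on_bounded_linear bounded_linear_fst S) auto
    show "smooth_on (S \<times> UNIV) (snd :: 'z \<times> 'e \<Rightarrow> 'e)"
      by (intro smooth_on_bounded_linear bounded_linear_snd open_Times S) simp
  qed (use lin in auto)
  then have "continuous_on (S \<times> UNIV) (\<lambda>p. G (fst p) (snd p))"
    by (rule smooth_on_continuous)
  then have "continuous_on (cball z r \<times> sphere 0 1) (\<lambda>p. G (fst p) (snd p) \<bullet> snd p)"
    by (intro continuous_intros) (erule continuous_on_subset, use r in auto)
  moreover have "compact (cball z r \<times> sphere (0::'e) 1)" by (intro compact_Times) auto
  moreover have "cball z r \<times> sphere (0::'e) 1 \<noteq> {}" using r by auto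
  ultimately have "\<exists>p\<in>cball z r \<times> sphere 0 1. \<forall>q\<in>cball z r \<times> sphere 0 1.
      G (fst p) (snd p) \<bullet> snd p \<le> G (fst q) (snd q) \<bullet> snd q"
    using continuous_attains_inf[of "cball z r \<times> sphere 0 1" "\<lambda>p. G (fst p) (snd p) \<bullet> snd p"] by blast
  then obtain p where p: "p \<in> cball z r \<times> sphere 0 1"
    "\<And>q. q \<in> cball z r \<times> sphere 0 1 \<Longrightarrow> G (fst p) (snd p) \<bullet> snd p \<le> G (fst q) (snd q) \<bullet> snd q"
    by blast
  \<comment> \<open>The least value of the quadratic forms on the unit sphere bounds them all from below.\<close>
  define l where "l = G (fst p) (snd p) \<bullet> snd p"
  have l: "l > 0" unfolding l_def using p(1) r by (intro pos) auto
  have coercive: "l * norm w * norm w \<le> G x w \<bullet> w" if x: "x \<in> cball z r" for x w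
  proof (cases "w = 0")
    case True
    then show ?thesis by simp
  next
    case False
    have "l \<le> G x (w /\<^sub>R norm w) \<bullet> (w /\<^sub>R norm w)"
      using p(2)[of "(x, w /\<^sub>R norm w)"] x False by (simp add: l_def)
    also have "\<dots> = (G x w \<bullet> w) / (norm w * norm w)"
      using lin[of x] x r by (simp add: subset_iff linear_cmul field_simps)
    finally show ?thesis using False by (simp add: field_simps)
  qed
  obtain LF where LF: "0 \<le> LF"
    "\<And>x y. \<lbrakk>x \<in> cball z r; y \<in> cball z r\<rbrakk> \<Longrightarrow> norm (F x - F y) \<le> LF * norm (x - y)"
    using smooth_on_lipschitz_cball[OF F r(2)] by metis
  have "\<exists>L\<ge>0. \<forall>x\<in>cball z r. \<forall>y\<in>cball z r. norm (G x w - G y w) \<le> L * norm (x - y)" for w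
    using smooth_on_lipschitz_cball[OF G r(2), of w] by metis
  then obtain LG where LG: "\<And>w. 0 \<le> LG w"
    "\<And>w x y. \<lbrakk>x \<in> cball z r; y \<in> cball z r\<rbrakk> \<Longrightarrow> norm (G x w - G y w) \<le> LG w * norm (x - y)"
    by metis
  define K where "K = (\<Sum>i\<in>Basis. LG i)"
  have K: "0 \<le> K" unfolding K_def by (intro sum_nonneg LG(1))
  have GK: "norm (G x w - G y w) \<le> K * norm w * norm (x - y)"
    if x: "x \<in> cball z r" and y: "y \<in> cball z r" for x y w
  proof -
    have "G x w - G y w = (\<Sum>i\<in>Basis. (w \<bullet> i) *\<^sub>R (G x i - G y i))"
      using linear_eq_sum_Basis[OF lin, of x w] linear_eq_sum_Basis[OF lin, of y w] x y r(2)
      by (simp add: subset_iff scaleR_diff_right sum_subtractf)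
    also have "norm \<dots> \<le> (\<Sum>i\<in>Basis. norm w * (LG i * norm (x - y)))"
      by (intro sum_norm_le) (simp add: mult_mono' Basis_le_norm LG(2)[OF x y])
    also have "\<dots> = K * norm w * norm (x - y)"
      by (simp add: K_def sum_distrib_left sum_distrib_right algebra_simps)
    finally show ?thesis .
  qed
  have "bounded (F ` cball z r)"
    by (intro compact_imp_bounded compact_continuous_image compact_cball
        continuous_on_subset[OF smooth_on_continuous[OF F] r(2)])
  then obtain BF where BF: "BF > 0" "\<And>x. x \<in> cball z r \<Longrightarrow> norm (F x) \<le> BF"
    unfolding bounded_pos by auto
  have bb: "norm (b x) \<le> BF / l" if x: "x \<in> cball z r" for x
  proof (cases "b x = 0")
    case True
    then show ?thesis using BF l by simp
  next
    case False
    have "l * norm (b x) * norm (b x) \<le> F x \<bullet> b x"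
      using coercive[OF x, of "b x"] sol[of x] x r by auto
    also have "\<dots> \<le> BF * norm (b x)"
      by (rule order_trans[OF norm_cauchy_schwarz]) (intro mult_right_mono BF x norm_ge_zero)
    finally show ?thesis using False l by (simp add: field_simps)
  qed
  define L where "L = (LF + K * (BF / l)) / l"
  have L: "0 \<le> L" using LF K BF l by (simp add: L_def)
  have "norm (b x - b y) \<le> L * norm (x - y)" if x: "x \<in> cball z r" and y: "y \<in> cball z r" for x y
  proof (cases "b x = b y")
    case True
    then show ?thesis using L by simp
  next
    case False
    define w where "w = b x - b y"
    have w: "norm w > 0" using False by (simp add: w_def)
    \<comment> \<open>The difference of the two solutions solves the system at \<open>x\<close> with a small right-hand side.\<close>
    have "G x w = F x - F y - (G x (b y) - G y (b y))"
      using linear_diff[OF lin[of x], of "b x" "b y"] sol[of x] sol[of y] x y r(2)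
      by (simp add: w_def subset_iff)
    then have "norm (G x w) \<le> LF * norm (x - y) + K * norm (b y) * norm (x - y)"
      using norm_triangle_ineq4[of "F x - F y" "G x (b y) - G y (b y)"] LF(2)[OF x y] GK[OF x y, of "b y"]
      by simp
    also have "\<dots> \<le> LF * norm (x - y) + K * (BF / l) * norm (x - y)"
      by (intro add_left_mono mult_right_mono mult_left_mono K bb y norm_ge_zero)
    also have "\<dots> = l * (L * norm (x - y))" using l by (simp add: L_def field_simps)
    finally have 1: "norm (G x w) \<le> l * (L * norm (x - y))" .
    have "l * norm w * norm w \<le> norm (G x w) * norm w"
      by (rule order_trans[OF coercive[OF x] norm_cauchy_schwarz])
    then have "l * norm w \<le> norm (G x w)" using w by simp
    with 1 have "l * norm w \<le> l * (L * norm (x - y))" by linarith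
    then show ?thesis using l by (simp add: w_def)
  qed
  with r L show ?thesis by (intro that)
qed

section \<open>Mechanics in an open set of Euclidean space\<close>

lemma smooth_on_compose_fst:
  fixes f :: "'e::euclidean_space \<Rightarrow> 'g::real_normed_vector"
  assumes "open S" "smooth_on S f"
  shows "smooth_on (S \<times> (UNIV :: 'f::euclidean_space set)) (\<lambda>z. f (fst z))"
  by (rule smooth_on_compose[OF assms(2) smooth_on_bounded_linear[OF bounded_linear_fst]])
    (use assms(1) in \<open>auto intro: open_Times\<close>)

lemma smooth_on_linear_family_snd:
  fixes h :: "'e::euclidean_space \<Rightarrow> 'f::euclidean_space \<Rightarrow> 'g::real_normed_vector"
  assumes "open S" "\<And>x. x \<in> S \<Longrightarrow> linear (h x)" "\<And>u. smooth_on S (\<lambda>x. h x u)"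
  shows "smooth_on (S \<times> UNIV) (\<lambda>z. h (fst z) (snd z))"
  by (rule smooth_on_linear_family[where h = "\<lambda>z. h (fst z)" and L = snd])
    (use assms in \<open>auto intro: open_Times smooth_on_compose_fst smooth_on_bounded_linear bounded_linear_snd\<close>)

lemma linear_deriv_family:
  fixes h :: "'e::euclidean_space \<Rightarrow> 'f::euclidean_space \<Rightarrow> 'g::real_normed_vector"
  assumes S: "open S" "x \<in> S" and lin: "\<And>y. y \<in> S \<Longrightarrow> linear (h y)"
    and h: "\<And>u. smooth_on S (\<lambda>y. h y u)"
  shows "linear (\<lambda>u. \<D> (\<lambda>y. h y u) x a)"
proof (rule linearI)
  have der: "((\<lambda>y. h y u) has_derivative \<D> (\<lambda>y. h y u) x) (at x)" for u
    by (rule smooth_on_has_derivative[OF h S(2)])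
  show "\<D> (\<lambda>y. h y (u + w)) x a = \<D> (\<lambda>y. h y u) x a + \<D> (\<lambda>y. h y w) x a" for u w
  proof (rule fun_cong[OF frechet_derivative_at, symmetric])
    show "((\<lambda>y. h y (u + w)) has_derivative (\<lambda>a. \<D> (\<lambda>y. h y u) x a + \<D> (\<lambda>y. h y w) x a)) (at x)"
      by (rule has_derivative_transform_within_open[OF has_derivative_add[OF der der] S])
        (simp add: linear_add lin)
  qed
  show "\<D> (\<lambda>y. h y (r *\<^sub>R u)) x a = r *\<^sub>R \<D> (\<lambda>y. h y u) x a" for r u
  proof (rule fun_cong[OF frechet_derivative_at, symmetric])
    show "((\<lambda>y. h y (r *\<^sub>R u)) has_derivative (\<lambda>a. r *\<^sub>R \<D> (\<lambda>y. h y u) x a)) (at x)"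
      by (rule has_derivative_transform_within_open[OF has_derivative_scaleR_right[OF der] S])
        (simp add: linear_cmul lin)
  qed
qed

lemma has_derivative_linear_family_fst:
  fixes h :: "'e::euclidean_space \<Rightarrow> 'f::euclidean_space \<Rightarrow> 'g::real_normed_vector"
  assumes S: "open S" "x \<in> S" and lin: "\<And>y. y \<in> S \<Longrightarrow> linear (h y)"
    and h: "\<And>u. smooth_on S (\<lambda>y. h y u)"
  shows "((\<lambda>z. h (fst z) (snd z)) has_derivative (\<lambda>w. \<D> (\<lambda>y. h y u) x (fst w) + h x (snd w))) (at (x, u))"
proof -
  have fst': "(fst has_derivative fst) (at (x, u))" and snd': "(snd has_derivative snd) (at (x, u))"
    by (intro bounded_linear_imp_has_derivative bounded_linear_fst bounded_linear_snd)+
  have "((\<lambda>z. h (fst z) a) has_derivative (\<lambda>w. \<D> (\<lambda>y. h y a) x (fst w))) (at (x, u))" for a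
    by (rule has_derivative_compose[OF fst']) (use smooth_on_has_derivative[OF h S(2)] in simp)
  from has_derivative_linear_family[where h = "\<lambda>z. h (fst z)" and S = "S \<times> UNIV", OF _ _ _ this snd']
  show ?thesis using S lin by (simp add: open_Times mem_Times_iff)
qed

text \<open>A system in one chart: \<open>S\<close> is the image of the chart, \<open>g\<close>, \<open>k\<close> and \<open>P\<close> are the coefficients of the
  metric, of the gyroscopic form and the potential.\<close>

locale local_mechanics =
  fixes S :: "'e::euclidean_space set"
    and g k :: "'e \<Rightarrow> 'e \<Rightarrow> 'e \<Rightarrow> real" and P :: "'e \<Rightarrow> real"
  assumes open_S: "open S"
    and g_lin1: "x \<in> S \<Longrightarrow> linear (\<lambda>u. g x u a)" and g_lin2: "x \<in> S \<Longrightarrow> linear (g x u)"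
    and g_sym: "x \<in> S \<Longrightarrow> g x u a = g x a u" and g_pos: "\<lbrakk>x \<in> S; u \<noteq> 0\<rbrakk> \<Longrightarrow> g x u u > 0"
    and g_smooth: "smooth_on S (\<lambda>x. g x u a)"
    and k_lin1: "x \<in> S \<Longrightarrow> linear (\<lambda>u. k x u a)" and k_lin2: "x \<in> S \<Longrightarrow> linear (k x u)"
    and k_smooth: "smooth_on S (\<lambda>x. k x u a)"
    and P_smooth: "smooth_on S P"
begin

text \<open>The covector \<open>a \<mapsto> g(b, a)\<close> of the acceleration \<open>b\<close> at position \<open>x\<close> and velocity \<open>u\<close>: the Christoffel terms
  of the metric, the gyroscopic force \<open>- k(u, a)\<close> and the potential force.\<close>

definition force :: "'e \<Rightarrow> 'e \<Rightarrow> 'e \<Rightarrow> real" where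
  "force x u a = - \<D> (\<lambda>y. g y u a) x u + 1 / 2 * \<D> (\<lambda>y. g y u u) x a - k x u a - \<D> P x a"

definition accel :: "'e \<Rightarrow> 'e \<Rightarrow> 'e" where
  "accel x u = (THE b. \<forall>a. g x b a = force x u a)"

lemma open_phase_space: "open (S \<times> (UNIV :: 'e set))"
  by (intro open_Times open_S open_UNIV)

lemma linear_force:
  assumes x: "x \<in> S"
  shows "linear (force x u)"
proof -
  have 1: "linear (\<lambda>a. \<D> (\<lambda>y. g y u a) x u)"
    by (rule linear_deriv_family[OF open_S x g_lin2 g_smooth])
  have 2: "linear (\<D> (\<lambda>y. g y u u) x)" by (rule smooth_on_linear_deriv[OF g_smooth x])
  have 3: "linear (\<D> P x)" by (rule smooth_on_linear_deriv[OF P_smooth x])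
  show ?thesis
    unfolding force_def[abs_def]
    by (rule linearI)
      (simp_all add: linear_add[OF 1] linear_add[OF 2] linear_add[OF 3] linear_add[OF k_lin2[OF x]]
        linear_cmul[OF 1] linear_cmul[OF 2] linear_cmul[OF 3] linear_cmul[OF k_lin2[OF x]] algebra_simps)
qed

lemma smooth_force: "smooth_on (S \<times> UNIV) (\<lambda>z. force (fst z) (snd z) a)"
proof -
  note O = open_phase_space
  have snd_smooth: "smooth_on (S \<times> UNIV) (snd :: 'e \<times> 'e \<Rightarrow> 'e)"
    by (rule smooth_on_bounded_linear[OF bounded_linear_snd O])
  have t1: "smooth_on (S \<times> UNIV) (\<lambda>z. \<D> (\<lambda>y. g y (snd z) a) (fst z) (snd z))"
  proof (rule smooth_on_linear_family[where h = "\<lambda>z w. \<D> (\<lambda>y. g y w a) (fst z) (snd z)" and L = snd, OF O])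
    show "linear (\<lambda>w. \<D> (\<lambda>y. g y w a) (fst z) (snd z))" if "z \<in> S \<times> UNIV" for z
      by (rule linear_deriv_family[OF open_S _ g_lin1 g_smooth]) (use that in auto)
    show "smooth_on (S \<times> UNIV) (\<lambda>z. \<D> (\<lambda>y. g y w a) (fst z) (snd z))" for w
      by (rule smooth_on_linear_family_snd[OF open_S])
        (auto intro: smooth_on_linear_deriv[OF g_smooth] smooth_on_deriv[OF g_smooth])
  qed (rule snd_smooth)
  have t2: "smooth_on (S \<times> UNIV) (\<lambda>z. \<D> (\<lambda>y. g y (snd z) (snd z)) (fst z) a)"
  proof (rule smooth_on_linear_family[where h = "\<lambda>z w. \<D> (\<lambda>y. g y w (snd z)) (fst z) a" and L = snd, OF O])
    show "linear (\<lambda>w. \<D> (\<lambda>y. g y w (snd z)) (fst z) a)" if "z \<in> S \<times> UNIV" for z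
      by (rule linear_deriv_family[OF open_S _ g_lin1 g_smooth]) (use that in auto)
    show "smooth_on (S \<times> UNIV) (\<lambda>z. \<D> (\<lambda>y. g y w (snd z)) (fst z) a)" for w
      by (rule smooth_on_linear_family_snd[where h = "\<lambda>x u. \<D> (\<lambda>y. g y w u) x a", OF open_S])
        (auto intro: linear_deriv_family[OF open_S _ g_lin2 g_smooth] smooth_on_deriv[OF g_smooth])
  qed (rule snd_smooth)
  have t3: "smooth_on (S \<times> UNIV) (\<lambda>z. k (fst z) (snd z) a)"
    by (rule smooth_on_linear_family_snd[where h = "\<lambda>x u. k x u a", OF open_S k_lin1 k_smooth])
  have t4: "smooth_on (S \<times> (UNIV :: 'e set)) (\<lambda>z. \<D> P (fst z) a)"
    by (rule smooth_on_compose_fst[OF open_S smooth_on_deriv[OF P_smooth]])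
  have half: "bounded_linear (\<lambda>r::real. 1 / 2 * r)" by (rule bounded_linear_mult_right)
  have "smooth_on (S \<times> UNIV) (\<lambda>z. ((- \<D> (\<lambda>y. g y (snd z) a) (fst z) (snd z)
      + 1 / 2 * \<D> (\<lambda>y. g y (snd z) (snd z)) (fst z) a) + - k (fst z) (snd z) a) + - \<D> P (fst z) a)"
    by (intro smooth_on_add[OF O] smooth_on_uminus[OF O] t1 t3 t4
        smooth_on_compose[OF smooth_on_bounded_linear[OF half open_UNIV] t2 O open_UNIV]) auto
  then show ?thesis by (simp add: force_def)
qed

text \<open>The equation for the acceleration is rewritten as a linear system for vectors by representing
  covectors through the inner product.\<close>

lemma metric_inner:
  assumes "x \<in> S"
  shows "(\<Sum>i\<in>Basis. g x u i *\<^sub>R i) \<bullet> a = g x u a"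
  using linear_eq_sum_Basis[OF g_lin2[OF assms], of u a]
  by (simp add: inner_sum_left inner_commute[of a] mult.commute)

lemma force_inner:
  assumes "x \<in> S"
  shows "(\<Sum>i\<in>Basis. force x u i *\<^sub>R i) \<bullet> a = force x u a"
  using linear_eq_sum_Basis[OF linear_force[OF assms], of u a]
  by (simp add: inner_sum_left inner_commute[of a] mult.commute)

lemma linear_metric_vector:
  assumes "x \<in> S"
  shows "linear (\<lambda>u. \<Sum>i\<in>Basis. g x u i *\<^sub>R i)"
  by (rule linearI)
    (simp_all add: linear_add[OF g_lin1[OF assms]] linear_cmul[OF g_lin1[OF assms]]
      scaleR_add_left sum.distrib scaleR_sum_right)

lemma accel_unique:
  assumes x: "x \<in> S" and b: "\<And>a. g x b a = force x u a"
  shows "accel x u = b"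
  unfolding accel_def
proof (rule the_equality)
  fix b' assume b': "\<forall>a. g x b' a = force x u a"
  have "g x (b' - b) (b' - b) = 0"
    using b b' linear_diff[OF g_lin1[OF x], of b' b "b' - b"] by simp
  then show "b' = b" using g_pos[OF x, of "b' - b"] by force
qed (use b in blast)

lemma accel:
  assumes x: "x \<in> S"
  shows "g x (accel x u) a = force x u a"
proof -
  let ?G = "\<lambda>u. \<Sum>i\<in>Basis. g x u i *\<^sub>R i"
  have "inj ?G"
  proof (rule linear_injective_0[OF linear_metric_vector[OF x], THEN iffD2], intro allI impI)
    fix w assume "?G w = 0"
    then have "g x w w = 0" using metric_inner[OF x, of w w] by simp
    then show "w = 0" using g_pos[OF x, of w] by force
  qed
  then have "surj ?G" using linear_injective_imp_surjective[OF linear_metric_vector[OF x]] by blast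
  then obtain b where b: "(\<Sum>i\<in>Basis. force x u i *\<^sub>R i) = ?G b" by (rule surjE)
  have "g x b a = force x u a" for a
    using metric_inner[OF x, of b a] force_inner[OF x, of u a] b by simp
  with accel_unique[OF x this] show ?thesis by simp
qed

lemma phase_field_lipschitz:
  assumes x: "x \<in> S"
  obtains r L where "0 < r" "cball (x, u) r \<subseteq> S \<times> UNIV" "0 \<le> L"
    "\<And>z w. \<lbrakk>z \<in> cball (x, u) r; w \<in> cball (x, u) r\<rbrakk>
      \<Longrightarrow> norm ((snd z, accel (fst z) (snd z)) - (snd w, accel (fst w) (snd w))) \<le> L * norm (z - w)"
proof -
  note O = open_phase_space
  let ?G = "\<lambda>(z::'e \<times> 'e) u. \<Sum>i\<in>Basis. g (fst z) u i *\<^sub>R i"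
  let ?F = "\<lambda>z. \<Sum>i\<in>Basis. force (fst z) (snd z) i *\<^sub>R i"
  have sum_smooth: "smooth_on (S \<times> UNIV) (\<lambda>z. \<Sum>i\<in>Basis. c i z *\<^sub>R i)"
    if "\<And>i. smooth_on (S \<times> UNIV) (c i)" for c :: "'e \<Rightarrow> 'e \<times> 'e \<Rightarrow> real"
    using that unfolding smooth_on_def by (intro allI Ck_on_sum[OF O] Ck_on_scaleR[OF O] Ck_on_const) blast
  obtain r L where rL: "0 < r" "cball (x, u) r \<subseteq> S \<times> UNIV" "0 \<le> L"
    "\<And>z w. \<lbrakk>z \<in> cball (x, u) r; w \<in> cball (x, u) r\<rbrakk>
      \<Longrightarrow> norm (accel (fst z) (snd z) - accel (fst w) (snd w)) \<le> L * norm (z - w)"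
  proof (rule positive_definite_solution_lipschitz[OF O])
    show "(x, u) \<in> S \<times> UNIV" using x by simp
    show "linear (?G z)" if "z \<in> S \<times> UNIV" for z
      by (rule linear_metric_vector) (use that in auto)
    show "smooth_on (S \<times> UNIV) (\<lambda>z. ?G z w)" for w
      by (intro sum_smooth smooth_on_compose_fst[OF open_S g_smooth])
    show "smooth_on (S \<times> UNIV) ?F" by (intro sum_smooth smooth_force)
    show "?G z w \<bullet> w > 0" if "z \<in> S \<times> UNIV" "w \<noteq> 0" for z w
      using that g_pos metric_inner[of "fst z" w w] by auto
    show "?G z (accel (fst z) (snd z)) = ?F z" if "z \<in> S \<times> UNIV" for z
      using that accel[of "fst z"] by (auto intro!: sum.cong)
    fix r L
    assume "0 < r" "cball (x, u) r \<subseteq> S \<times> UNIV" "0 \<le> (L::real)"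
      "\<And>z w. \<lbrakk>z \<in> cball (x, u) r; w \<in> cball (x, u) r\<rbrakk>
        \<Longrightarrow> norm (accel (fst z) (snd z) - accel (fst w) (snd w)) \<le> L * norm (z - w)"
    then show thesis by (rule that)
  qed
  have "norm ((snd z, accel (fst z) (snd z)) - (snd w, accel (fst w) (snd w))) \<le> (1 + L) * norm (z - w)"
    if "z \<in> cball (x, u) r" "w \<in> cball (x, u) r" for z w
  proof -
    have "norm ((snd z, accel (fst z) (snd z)) - (snd w, accel (fst w) (snd w)))
        \<le> norm (snd z - snd w) + norm (accel (fst z) (snd z) - accel (fst w) (snd w))"
      using norm_Pair_le[of "snd z - snd w"] by simp
    also have "\<dots> \<le> norm (z - w) + L * norm (z - w)"
    proof (rule add_mono)
      have "norm (snd (z - w)) \<le> norm (z - w)" by (metis norm_snd_le prod.collapse)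
      then show "norm (snd z - snd w) \<le> norm (z - w)" by simp
    qed (rule rL(4)[OF that])
    finally show ?thesis by (simp add: algebra_simps)
  qed
  then show ?thesis using that[of r "1 + L"] rL(1-3) by simp
qed

lemma phase_curve_exists:
  assumes x: "x \<in> S"
  obtains e z where "0 < e" "z 0 = (x, u)"
    "\<And>t. \<bar>t\<bar> < e \<Longrightarrow> fst (z t) \<in> S
       \<and> (z has_vector_derivative (snd (z t), accel (fst (z t)) (snd (z t)))) (at t)"
proof -
  obtain r L where rL: "0 < r" "cball (x, u) r \<subseteq> S \<times> UNIV" "0 \<le> L"
    and lip: "\<And>z w. \<lbrakk>z \<in> cball (x, u) r; w \<in> cball (x, u) r\<rbrakk>
      \<Longrightarrow> norm ((snd z, accel (fst z) (snd z)) - (snd w, accel (fst w) (snd w))) \<le> L * norm (z - w)"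
    using phase_field_lipschitz[OF x, of u] by metis
  obtain e z where "0 < e" "z 0 = (x, u)"
    "\<And>t. \<bar>t\<bar> < e \<Longrightarrow> z t \<in> cball (x, u) r
       \<and> (z has_vector_derivative (snd (z t), accel (fst (z t)) (snd (z t)))) (at t)"
    using picard_local_existence[where V = "\<lambda>z. (snd z, accel (fst z) (snd z))", OF rL(1,3) lip] by metis
  then show ?thesis using that[of e z] rL(2) by (metis mem_Times_iff subset_iff)
qed

text \<open>Hamilton's equation \<open>i_X \<sigma> = - dH\<close> in coordinates, with \<open>X = (a, b)\<close> tested on \<open>(a', b')\<close>. Vertical
  test vectors force \<open>a = u\<close>, that is, \<open>X\<close> is a second order equation; horizontal ones then determine the
  acceleration. In particular \<open>X\<close> exists and is unique.\<close>

lemma hamilton_equation_iff: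
  assumes x: "x \<in> S"
  shows "(\<forall>a' b'. \<D> (\<lambda>y. g y u a') x a + g x b a' - \<D> (\<lambda>y. g y u a) x a' - g x b' a + k x a a'
            = - (1 / 2 * \<D> (\<lambda>y. g y u u) x a' + g x u b' + \<D> P x a'))
     \<longleftrightarrow> a = u \<and> b = accel x u" (is "?lhs \<longleftrightarrow> ?rhs")
proof
  assume ?lhs
  have zero: "\<D> (\<lambda>y. g y u a') x 0 = 0" "\<D> P x 0 = 0" for a'
    using linear_0[OF smooth_on_linear_deriv[OF g_smooth x]] linear_0[OF smooth_on_linear_deriv[OF P_smooth x]]
    by simp_all
  have zero': "\<D> (\<lambda>y. g y u 0) x a' = 0" for a'
    using linear_0[OF linear_deriv_family[OF open_S x g_lin2 g_smooth]] .
  \<comment> \<open>Purely vertical test vectors \<open>(0, b')\<close> see only \<open>g x a b' = g x u b'\<close>.\<close>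
  have "g x (a - u) (a - u) = 0"
    using \<open>?lhs\<close>[rule_format, of 0 "a - u"] zero zero' linear_0[OF g_lin2[OF x]] linear_0[OF k_lin2[OF x]]
      linear_diff[OF g_lin2[OF x], of "a - u" a u] g_sym[OF x, of u "a - u"]
    by simp
  then have a: "a = u" using g_pos[OF x, of "a - u"] by force
  have "g x b a' = force x u a'" for a'
    using \<open>?lhs\<close>[rule_format, of a' 0] linear_0[OF g_lin1[OF x]] linear_0[OF g_lin2[OF x]]
    unfolding force_def a by simp
  then have "accel x u = b" by (rule accel_unique[OF x])
  with a show ?rhs by simp
next
  assume ?rhs
  then show ?lhs using accel[OF x, of u] g_sym[OF x] by (auto simp: force_def)
qed

lemma kinetic_smooth: "smooth_on (S \<times> UNIV) (\<lambda>z. g (fst z) (snd z) (snd z))"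
  by (rule smooth_on_linear_family[where h = "\<lambda>z. g (fst z) (snd z)" and L = snd, OF open_phase_space])
    (use g_lin2 in \<open>auto intro: smooth_on_linear_family_snd[OF open_S g_lin1 g_smooth]
      smooth_on_bounded_linear[OF bounded_linear_snd open_phase_space]\<close>)

lemma kinetic_has_derivative:
  assumes x: "x \<in> S"
  shows "((\<lambda>z. g (fst z) (snd z) (snd z)) has_derivative
      (\<lambda>c. \<D> (\<lambda>y. g y u u) x (fst c) + 2 * g x u (snd c))) (at (x, u))"
proof -
  have snd': "(snd has_derivative snd) (at (x, u))"
    by (intro bounded_linear_imp_has_derivative bounded_linear_snd)
  have "((\<lambda>z. g (fst z) (snd z) w) has_derivative
      (\<lambda>c. \<D> (\<lambda>y. g y u w) x (fst c) + g x (snd c) w)) (at (x, u))" for w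
    by (rule has_derivative_linear_family_fst[where h = "\<lambda>y u. g y u w", OF open_S x g_lin1 g_smooth])
  from has_derivative_linear_family[where h = "\<lambda>z. g (fst z) (snd z)" and S = "S \<times> UNIV",
      OF open_phase_space _ _ this snd']
  have "((\<lambda>z. g (fst z) (snd z) (snd z)) has_derivative
      (\<lambda>c. (\<D> (\<lambda>y. g y u u) x (fst c) + g x (snd c) u) + g x u (snd c))) (at (x, u))"
    using x g_lin2 by auto
  moreover have "g x w u + g x u w = 2 * g x u w" for w using g_sym[OF x, of w u] by simp
  ultimately show ?thesis by (simp add: add.assoc)
qed

lemma energy_phase_derivative:
  assumes x: "x \<in> S"
  shows "\<D> (\<lambda>z. 1 / 2 * g (fst z) (snd z) (snd z) + P (fst z)) (x, u) (a, b)
       = 1 / 2 * \<D> (\<lambda>y. g y u u) x a + g x u b + \<D> P x a"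
proof -
  have pot: "((\<lambda>z. P (fst z)) has_derivative (\<lambda>c. \<D> P x (fst c))) (at (x, u))"
    by (rule has_derivative_compose[OF bounded_linear_imp_has_derivative[OF bounded_linear_fst]])
      (use smooth_on_has_derivative[OF P_smooth x] in simp)
  have "((\<lambda>z. 1 / 2 * g (fst z) (snd z) (snd z) + P (fst z)) has_derivative
      (\<lambda>c. 1 / 2 * (\<D> (\<lambda>y. g y u u) x (fst c) + 2 * g x u (snd c)) + \<D> P x (fst c))) (at (x, u))"
    by (rule has_derivative_add[OF has_derivative_mult_right[OF kinetic_has_derivative[OF x]] pot])
  from frechet_derivative_at[OF this, symmetric] show ?thesis by simp
qed

text \<open>The heart of the theorem. Differentiating \<open>g(v, u) + f\<close> along \<open>(u, b)\<close>, the acceleration contributes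
  \<open>g(v, b)\<close>, which is the force evaluated on \<open>v\<close>. Its metric part cancels by the Killing equation and its
  potential part by invariance of \<open>P\<close>; only the gyroscopic force and \<open>df\<close> are left.\<close>

lemma linear_integral_phase_derivative:
  assumes x: "x \<in> S" and v: "smooth_on S v" and f: "smooth_on S f"
    and killing: "1 / 2 * \<D> (\<lambda>y. g y u u) x (v x) + g x u (\<D> v x u) = 0"
    and sym: "\<D> P x (v x) = 0" and k_alt: "k x u (v x) = - k x (v x) u"
  shows "\<D> (\<lambda>z. g (fst z) (v (fst z)) (snd z) + f (fst z)) (x, u) (u, accel x u)
       = k x (v x) u + \<D> f x u"
proof -
  let ?h = "\<lambda>y w. g y (v y) w"
  have hs: "smooth_on S (\<lambda>y. ?h y w)" for w
    by (rule smooth_on_linear_family[OF open_S g_lin1 g_smooth v])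
  have fd: "((\<lambda>z. f (fst z)) has_derivative (\<lambda>w. \<D> f x (fst w))) (at (x, u))"
    by (rule has_derivative_compose[OF bounded_linear_imp_has_derivative[OF bounded_linear_fst]])
      (use smooth_on_has_derivative[OF f x] in simp)
  have "((\<lambda>z. ?h (fst z) (snd z) + f (fst z)) has_derivative
      (\<lambda>w. (\<D> (\<lambda>y. ?h y u) x (fst w) + ?h x (snd w)) + \<D> f x (fst w))) (at (x, u))"
    by (rule has_derivative_add[OF has_derivative_linear_family_fst[where h = ?h, OF open_S x g_lin2 hs] fd])
  then have "\<D> (\<lambda>z. ?h (fst z) (snd z) + f (fst z)) (x, u)
      = (\<lambda>w. (\<D> (\<lambda>y. ?h y u) x (fst w) + ?h x (snd w)) + \<D> f x (fst w))"
    by (rule frechet_derivative_at[symmetric])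
  moreover have "\<D> (\<lambda>y. ?h y u) x u = \<D> (\<lambda>y. g y (v x) u) x u + g x (\<D> v x u) u"
  proof -
    have "((\<lambda>y. ?h y u) has_derivative (\<lambda>a. \<D> (\<lambda>y. g y (v x) u) x a + g x (\<D> v x a) u)) (at x)"
      by (rule has_derivative_linear_family[where h = "\<lambda>y w. g y w u", OF open_S x g_lin1
            smooth_on_has_derivative[OF g_smooth x] smooth_on_has_derivative[OF v x]])
    from frechet_derivative_at[OF this, symmetric] show ?thesis by simp
  qed
  moreover have "g x (v x) (accel x u) = force x u (v x)"
    using accel[OF x] g_sym[OF x] by metis
  moreover have "\<D> (\<lambda>y. g y (v x) u) x u = \<D> (\<lambda>y. g y u (v x)) x u"
    by (rule fun_cong[OF frechet_derivative_cong_open[OF _ open_S x]]) (rule g_sym)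
  ultimately show ?thesis
    using killing sym k_alt g_sym[OF x, of "\<D> v x u" u] by (simp add: force_def)
qed

end

section \<open>The tangent bundle as a manifold\<close>

definition cov2_coeff ::
  "('a, 'e::euclidean_space) chart set \<Rightarrow> ('a, 'e) cov2 \<Rightarrow> ('a, 'e) chart \<Rightarrow> 'e \<Rightarrow> 'e \<Rightarrow> 'e \<Rightarrow> real" where
  "cov2_coeff B \<beta> c x u u' =
     \<beta> (param c x) (coord_vector B c (param c x) u) (coord_vector B c (param c x) u')"

lemma smooth_manifold_atlas:
  assumes "smooth_manifold A"
  shows "smooth_atlas A"
  by standard (use assms in \<open>auto simp: smooth_manifold_def\<close>)

lemma dom_tangent_chart:
  "dom_of (tangent_chart B c) = {w. fst w \<in> dom_of c \<and> snd w \<in> tangent_space B (fst w)}"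
  by (auto simp: tangent_chart_def)

lemma coord_tangent_chart: "coord (tangent_chart B c) w = (coord c (fst w), snd w c)"
  by (simp add: tangent_chart_def case_prod_unfold)

context smooth_atlas
begin

lemma tangent_space_combination:
  assumes "\<xi> \<in> tangent_space B p" "\<eta> \<in> tangent_space B p"
  shows "(\<lambda>c. a *\<^sub>R \<xi> c + b *\<^sub>R \<eta> c) \<in> tangent_space B p"
  unfolding tangent_space_def mem_Collect_eq
proof (intro conjI allI ballI impI)
  fix c assume "c \<notin> B \<or> p \<notin> dom_of c"
  then have "\<xi> c = 0" "\<eta> c = 0" using assms unfolding tangent_space_def by blast+
  then show "a *\<^sub>R \<xi> c + b *\<^sub>R \<eta> c = 0" by simp
next
  fix c d assume c: "c \<in> B" and d: "d \<in> B" and p: "p \<in> dom_of c \<inter> dom_of d"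
  then have lin: "linear (\<D> (transition c d) (coord c p))" using linear_deriv_transition[of c d p] by simp
  show "a *\<^sub>R \<xi> d + b *\<^sub>R \<eta> d = \<D> (transition c d) (coord c p) (a *\<^sub>R \<xi> c + b *\<^sub>R \<eta> c)"
    unfolding linear_add[OF lin] linear_cmul[OF lin]
    using tangent_space_apply[OF assms(1) c d] tangent_space_apply[OF assms(2) c d] p by simp
qed

lemma inj_tangent_chart:
  assumes "c \<in> B"
  shows "inj_on (coord (tangent_chart B c)) (dom_of (tangent_chart B c))"
proof (rule inj_onI)
  fix w w' assume w: "w \<in> dom_of (tangent_chart B c)" "w' \<in> dom_of (tangent_chart B c)"
    and eq: "coord (tangent_chart B c) w = coord (tangent_chart B c) w'"
  then have "fst w = fst w'"
    using inj_coord[OF assms] by (auto simp: dom_tangent_chart coord_tangent_chart inj_on_def)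
  moreover from this have "snd w = snd w'"
    using w eq tangent_eqI[of "snd w" "fst w" "snd w'" c] assms
    by (auto simp: dom_tangent_chart coord_tangent_chart)
  ultimately show "w = w'" by (simp add: prod_eq_iff)
qed

lemma tangent_chart_point:
  assumes "c \<in> B" "x \<in> img_of c"
  shows "(param c x, coord_vector B c (param c x) u) \<in> dom_of (tangent_chart B c)"
    and "coord (tangent_chart B c) (param c x, coord_vector B c (param c x) u) = (x, u)"
  using assms
  by (simp_all add: dom_tangent_chart coord_tangent_chart param_in_dom coord_vector_in_tangent_space
      coord_vector_apply_self coord_param)

lemma coord_tangent_chart_image:
  assumes c: "c \<in> B"
  shows "coord (tangent_chart B c) ` (dom_of (tangent_chart B c) \<inter> fst -` U) = coord c ` (dom_of c \<inter> U) \<times> UNIV"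
proof (intro equalityI subsetI)
  fix z assume "z \<in> coord (tangent_chart B c) ` (dom_of (tangent_chart B c) \<inter> fst -` U)"
  then show "z \<in> coord c ` (dom_of c \<inter> U) \<times> UNIV"
    by (auto simp: dom_tangent_chart coord_tangent_chart)
next
  fix z assume "z \<in> coord c ` (dom_of c \<inter> U) \<times> (UNIV :: 'e set)"
  then have x: "fst z \<in> img_of c" "param c (fst z) \<in> U"
    using coord_image_iff[OF c, of "fst z" U] by (simp_all add: mem_Times_iff)
  show "z \<in> coord (tangent_chart B c) ` (dom_of (tangent_chart B c) \<inter> fst -` U)"
    by (rule image_eqI[of _ _ "(param c (fst z), coord_vector B c (param c (fst z)) (snd z))"])
      (use tangent_chart_point[OF c x(1), of "snd z"] x(2) in simp_all)
qed

lemma img_tangent_chart: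
  assumes "c \<in> B"
  shows "img_of (tangent_chart B c) = img_of c \<times> UNIV"
  using coord_tangent_chart_image[OF assms, of UNIV] by (simp add: img_of_def)

lemma param_tangent_chart:
  assumes "c \<in> B" "x \<in> img_of c"
  shows "param (tangent_chart B c) (x, u) = (param c x, coord_vector B c (param c x) u)"
  using inv_into_f_f[OF inj_tangent_chart[OF assms(1)] tangent_chart_point(1)[OF assms, of u]]
  by (simp add: param_def[of "tangent_chart B c"] tangent_chart_point(2)[OF assms])

lemma overlap_tangent_chart:
  assumes "c \<in> B" "d \<in> B"
  shows "overlap (tangent_chart B c) (tangent_chart B d) = overlap c d \<times> UNIV"
proof -
  have "dom_of (tangent_chart B c) \<inter> dom_of (tangent_chart B d)
      = dom_of (tangent_chart B c) \<inter> fst -` dom_of d"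
    by (auto simp: dom_tangent_chart)
  then show ?thesis using coord_tangent_chart_image[OF assms(1)] by simp
qed

lemma transition_tangent_chart:
  assumes "c \<in> B" "d \<in> B" "x \<in> overlap c d"
  shows "transition (tangent_chart B c) (tangent_chart B d) (x, u)
       = (transition c d x, \<D> (transition c d) x u)"
proof -
  have x: "x \<in> img_of c" "param c x \<in> dom_of d"
    using assms coord_image_iff[of c x "dom_of d"] by auto
  show ?thesis
    using param_tangent_chart[OF assms(1) x(1)] coord_vector_apply[OF assms(2) x(2)]
    by (simp add: coord_tangent_chart coord_param x(1))
qed

text \<open>In the tangent charts the transition maps are \<open>(x, u) \<mapsto> (T x, DT(x) u)\<close>.\<close>

lemma smooth_atlas_tangent_bundle: "smooth_atlas (tangent_bundle B)"
proof
  fix c' assume "c' \<in> tangent_bundle B"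
  then obtain c where c: "c \<in> B" "c' = tangent_chart B c" by (auto simp: tangent_bundle_def)
  then show "inj_on (coord c') (dom_of c')" "open (img_of c')"
    by (simp_all add: inj_tangent_chart img_tangent_chart open_Times open_img)
  fix d' assume "d' \<in> tangent_bundle B"
  then obtain d where d: "d \<in> B" "d' = tangent_chart B d" by (auto simp: tangent_bundle_def)
  note O = open_overlap[OF c(1) d(1)]
  show op: "open (overlap c' d')"
    unfolding c(2) d(2) overlap_tangent_chart[OF c(1) d(1)] by (intro open_Times O open_UNIV)
  note sm = smooth_transition[OF c(1) d(1)]
  have "smooth_on (overlap c d \<times> UNIV)
      (\<lambda>z. (transition c d (fst z), \<D> (transition c d) (fst z) (snd z)))"
    by (intro smooth_on_Pair smooth_on_compose_fst smooth_on_linear_family_snd O sm smooth_on_deriv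
        open_Times open_UNIV smooth_on_linear_deriv[OF sm])
  then show "smooth_on (overlap c' d') (transition c' d')"
    unfolding c(2) d(2) overlap_tangent_chart[OF c(1) d(1)]
  proof (rule smooth_on_cong)
    show "open (overlap c d \<times> (UNIV :: 'e set))" by (intro open_Times O open_UNIV)
    show "(transition c d (fst z), \<D> (transition c d) (fst z) (snd z))
        = transition (tangent_chart B c) (tangent_chart B d) z" if "z \<in> overlap c d \<times> UNIV" for z
      using transition_tangent_chart[OF c(1) d(1), of "fst z" "snd z"] that by (simp only: prod.collapse mem_Times_iff)
  qed
qed

end

section \<open>The dynamical field in charts and its trajectories\<close>

locale gyroscopic =
  fixes A :: "('a, 'e::euclidean_space) chart set"
    and m \<kappa> :: "('a, 'e) cov2" and pot :: "'a \<Rightarrow> real"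
  assumes system: "gyroscopic_system A m pot \<kappa>"
begin

sublocale M: smooth_atlas A
  by (rule smooth_manifold_atlas) (use system in \<open>simp add: gyroscopic_system_def\<close>)

sublocale TM: smooth_atlas "tangent_bundle A"
  by (rule M.smooth_atlas_tangent_bundle)

abbreviation tc where "tc \<equiv> tangent_chart A"
abbreviation g where "g \<equiv> cov2_coeff A m"
abbreviation k where "k \<equiv> cov2_coeff A \<kappa>"

lemma cov2_m: "smooth_cov2 A m" and cov2_\<kappa>: "smooth_cov2 A \<kappa>"
  and smooth_pot: "smooth_fun A pot"
  using system by (auto simp: gyroscopic_system_def riemannian_metric_def two_form_def)

lemma point_param: "\<lbrakk>c \<in> A; x \<in> img_of c\<rbrakk> \<Longrightarrow> param c x \<in> points A"
  unfolding points_iff by (rule bexI, rule param_in_dom)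

lemma cov2_coeff_chart:
  assumes "\<xi> \<in> tangent_space A p" "\<eta> \<in> tangent_space A p" "c \<in> A" "p \<in> dom_of c"
  shows "cov2_coeff A \<beta> c (coord c p) (\<xi> c) (\<eta> c) = \<beta> p \<xi> \<eta>"
  using assms by (simp add: cov2_coeff_def M.param_coord M.coord_vector_of_tangent)

lemma cov2_coeff_linear:
  assumes "smooth_cov2 A \<beta>" "c \<in> A" "x \<in> img_of c"
  shows "linear (\<lambda>u. cov2_coeff A \<beta> c x u a)" "linear (cov2_coeff A \<beta> c x u)"
proof -
  note p = param_in_dom[OF assms(3)]
  have T: "coord_vector A c (param c x) w \<in> tangent_space A (param c x)" for w
    by (rule M.coord_vector_in_tangent_space[OF assms(2) p])
  have L: "linear_on_tangent A (param c x) (\<lambda>\<eta>. \<beta> (param c x) \<xi> \<eta>)"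
    "linear_on_tangent A (param c x) (\<lambda>\<eta>. \<beta> (param c x) \<eta> \<xi>)" if "\<xi> \<in> tangent_space A (param c x)" for \<xi>
    using assms(1) point_param[OF assms(2,3)] that unfolding smooth_cov2_def by blast+
  show "linear (\<lambda>u. cov2_coeff A \<beta> c x u a)"
    using M.linear_coord_vector[OF L(2)[OF T] assms(2) p] unfolding cov2_coeff_def .
  show "linear (cov2_coeff A \<beta> c x u)"
    using M.linear_coord_vector[OF L(1)[OF T] assms(2) p] unfolding cov2_coeff_def[abs_def] .
qed

lemma cov2_coeff_smooth:
  assumes "smooth_cov2 A \<beta>" "c \<in> A"
  shows "smooth_on (img_of c) (\<lambda>x. cov2_coeff A \<beta> c x u a)"
  using assms unfolding smooth_cov2_def cov2_coeff_def by blast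

text \<open>Every chart of the configuration manifold carries a system of the kind studied above, which gives
  access to the computations made there.\<close>

lemma local_mechanics_chart:
  assumes c: "c \<in> A"
  shows "local_mechanics (img_of c) (g c) (k c) (pot \<circ> param c)"
proof (rule local_mechanics.intro)
  show "smooth_on (img_of c) (pot \<circ> param c)" using smooth_pot c by (simp add: smooth_fun_def)
  fix x u a assume x: "x \<in> img_of c"
  have T: "coord_vector A c (param c x) w \<in> tangent_space A (param c x)" for w
    by (rule M.coord_vector_in_tangent_space[OF c param_in_dom[OF x]])
  show "g c x u a = g c x a u"
    using system point_param[OF c x] T
    by (simp add: cov2_coeff_def gyroscopic_system_def riemannian_metric_def)
  assume u: "u \<noteq> 0"
  have "coord_vector A c (param c x) u \<noteq> (\<lambda>c. 0)"
    using M.coord_vector_apply_self[OF c param_in_dom[OF x], of u] u by metis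
  then show "g c x u u > 0"
    using system point_param[OF c x] T
    by (simp add: cov2_coeff_def gyroscopic_system_def riemannian_metric_def)
qed (use M.open_img[OF c] cov2_coeff_linear[OF cov2_m c] cov2_coeff_linear[OF cov2_\<kappa> c]
    cov2_coeff_smooth[OF cov2_m c] cov2_coeff_smooth[OF cov2_\<kappa> c] in auto)

lemma tangent_chart_in: "c \<in> A \<Longrightarrow> tc c \<in> tangent_bundle A"
  by (simp add: tangent_bundle_def)

lemma tangent_bundleE:
  assumes "c' \<in> tangent_bundle A"
  obtains c where "c \<in> A" "c' = tc c"
  using assms by (auto simp: tangent_bundle_def)

lemma points_tangent_bundle: "w \<in> points (tangent_bundle A) \<longleftrightarrow> fst w \<in> points A \<and> snd w \<in> tangent_space A (fst w)"
  by (auto simp: points_iff tangent_bundle_def dom_tangent_chart)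

lemma coord_fst_param:
  assumes "c \<in> A" "d \<in> A" "z \<in> img_of c \<times> UNIV"
  shows "(coord d \<circ> fst \<circ> param (tc c)) z = transition c d (fst z)"
  using M.param_tangent_chart[OF assms(1), of "fst z" "snd z"] assms(3) by (auto simp: mem_Times_iff)

lemma smooth_map_fst: "smooth_map (tangent_bundle A) A fst"
  unfolding smooth_map_def
proof (intro conjI ballI)
  show "fst ` points (tangent_bundle A) \<subseteq> points A" by (auto simp: points_tangent_bundle)
  fix c' d assume "c' \<in> tangent_bundle A" and d: "d \<in> A"
  then obtain c where c: "c \<in> A" "c' = tc c" by (auto elim: tangent_bundleE)
  note O = M.open_overlap[OF c(1) d]
  show "open (coord c' ` (dom_of c' \<inter> fst -` dom_of d))"
    unfolding c(2) M.coord_tangent_chart_image[OF c(1)] by (intro open_Times O open_UNIV)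
  show "smooth_on (coord c' ` (dom_of c' \<inter> fst -` dom_of d)) (coord d \<circ> fst \<circ> param c')"
    unfolding c(2) M.coord_tangent_chart_image[OF c(1)]
  proof (rule smooth_on_cong[OF smooth_on_compose_fst[OF O M.smooth_transition[OF c(1) d]]])
    show "transition c d (fst z) = (coord d \<circ> fst \<circ> param (tc c)) z" if "z \<in> overlap c d \<times> UNIV" for z
      using that c d by (intro coord_fst_param[symmetric]) (auto simp: img_of_def)
  qed (intro open_Times O open_UNIV)
qed

lemma tangent_map_fst:
  assumes c: "c \<in> A" and w: "w \<in> dom_of (tc c)" and Y: "Y \<in> tangent_space (tangent_bundle A) w"
  shows "tangent_map (tangent_bundle A) A fst w Y = coord_vector A c (fst w) (fst (Y (tc c)))"
proof -
  have p: "fst w \<in> dom_of c" using w by (simp add: dom_tangent_chart)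
  have "\<D> (coord c \<circ> fst \<circ> param (tc c)) (coord (tc c) w) = \<D> fst (coord (tc c) w)"
  proof (rule frechet_derivative_cong_open)
    show "open (img_of c \<times> (UNIV :: 'e set))" by (intro open_Times M.open_img c open_UNIV)
    show "coord (tc c) w \<in> img_of c \<times> UNIV" using p by (simp add: coord_tangent_chart coord_in_img)
    show "(coord c \<circ> fst \<circ> param (tc c)) z = fst z" if "z \<in> img_of c \<times> UNIV" for z
      using coord_fst_param[OF c c that] that by (auto simp: coord_param)
  qed
  also have "\<dots> = fst"
    by (rule frechet_derivative_at[symmetric, OF bounded_linear_imp_has_derivative[OF bounded_linear_fst]])
  finally show ?thesis
    using tangent_map_chart[OF TM.smooth_atlas_axioms M.smooth_atlas_axioms smooth_map_fst Y
        tangent_chart_in[OF c] w c p] by simp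
qed

lemma theta_form_chart:
  assumes c: "c \<in> A" and w: "w \<in> dom_of (tc c)" and Y: "Y \<in> tangent_space (tangent_bundle A) w"
  shows "theta_form A m w Y = g c (coord c (fst w)) (snd w c) (fst (Y (tc c)))"
  using w c
  by (simp add: theta_form_def tangent_map_fst[OF c w Y] cov2_coeff_def dom_tangent_chart M.param_coord
      M.coord_vector_of_tangent)

lemma theta_coeff:
  assumes c: "c \<in> A" and z: "z \<in> img_of c \<times> UNIV"
  shows "cov1_coeff (tangent_bundle A) (theta_form A m) (tc c) z ab = g c (fst z) (snd z) (fst ab)"
proof -
  define w where "w = param (tc c) z"
  have z': "z \<in> img_of (tc c)" using z by (simp add: M.img_tangent_chart[OF c])
  have w: "w \<in> dom_of (tc c)" unfolding w_def by (rule param_in_dom[OF z'])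
  have "coord (tc c) w = z" unfolding w_def by (rule coord_param[OF z'])
  then have "coord c (fst w) = fst z" "snd w c = snd z" by (auto simp: coord_tangent_chart)
  then show ?thesis
    using theta_form_chart[OF c w TM.coord_vector_in_tangent_space[OF tangent_chart_in[OF c] w]]
      TM.coord_vector_apply_self[OF tangent_chart_in[OF c] w]
    by (simp add: cov1_coeff_def w_def[symmetric])
qed

lemma smooth_cov1_theta: "smooth_cov1 (tangent_bundle A) (theta_form A m)"
  unfolding smooth_cov1_def
proof (intro conjI ballI allI)
  fix w assume "w \<in> points (tangent_bundle A)"
  then obtain c' where "c' \<in> tangent_bundle A" "w \<in> dom_of c'" unfolding points_iff by blast
  then obtain c where c: "c \<in> A" and w: "w \<in> dom_of (tc c)" by (auto elim: tangent_bundleE)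
  have x: "coord c (fst w) \<in> img_of c" using w by (simp add: dom_tangent_chart coord_in_img)
  note lin = cov2_coeff_linear(2)[OF cov2_m c x, of "snd w c"]
  show "linear_on_tangent (tangent_bundle A) w (theta_form A m w)"
    unfolding linear_on_tangent_def
    using TM.tangent_space_combination
    by (simp add: theta_form_chart[OF c w] linear_add[OF lin] linear_cmul[OF lin])
next
  fix c' :: "('a \<times> ('a, 'e) tvec, 'e \<times> 'e) chart" and ab :: "'e \<times> 'e" assume "c' \<in> tangent_bundle A"
  then obtain c where c: "c \<in> A" and c': "c' = tc c" by (auto elim: tangent_bundleE)
  have "smooth_on (img_of c \<times> UNIV) (\<lambda>z. g c (fst z) (snd z) (fst ab))"
    by (rule smooth_on_linear_family_snd[where h = "\<lambda>x u. g c x u (fst ab)"])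
      (use M.open_img[OF c] cov2_coeff_linear[OF cov2_m c] cov2_coeff_smooth[OF cov2_m c] in auto)
  then show "smooth_on (img_of c') (\<lambda>z. cov1_coeff (tangent_bundle A) (theta_form A m) c' z ab)"
    unfolding c' M.img_tangent_chart[OF c]
    by (rule smooth_on_cong) (auto intro: open_Times M.open_img c simp: theta_coeff[OF c])
qed

lemma sigma_form_chart:
  assumes c: "c \<in> A" and w: "w \<in> dom_of (tc c)"
    and X: "X \<in> tangent_space (tangent_bundle A) w" and Y: "Y \<in> tangent_space (tangent_bundle A) w"
    and xu: "coord (tc c) w = (x, u)" and Xc: "X (tc c) = (a, b)" and Yc: "Y (tc c) = (a', b')"
  shows "sigma_form A m \<kappa> w X Y = \<D> (\<lambda>y. g c y u a') x a + g c x b a'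
      - \<D> (\<lambda>y. g c y u a) x a' - g c x b' a + k c x a a'"
proof -
  have x: "x \<in> img_of c" "x = coord c (fst w)" "u = snd w c" "fst w \<in> dom_of c"
    using xu w by (auto simp: coord_tangent_chart dom_tangent_chart coord_in_img)
  note O = M.open_img[OF c]
  have D: "\<D> (\<lambda>z. cov1_coeff (tangent_bundle A) (theta_form A m) (tc c) z ab) (x, u) ab'
      = \<D> (\<lambda>y. g c y u (fst ab)) x (fst ab') + g c x (snd ab') (fst ab)" for ab ab' :: "'e \<times> 'e"
  proof -
    have "((\<lambda>z. g c (fst z) (snd z) (fst ab)) has_derivative
       (\<lambda>w. \<D> (\<lambda>y. g c y u (fst ab)) x (fst w) + g c x (snd w) (fst ab))) (at (x, u))"
      by (rule has_derivative_linear_family_fst[where h = "\<lambda>y u. g c y u (fst ab)", OF O x(1)])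
        (use cov2_coeff_linear[OF cov2_m c] cov2_coeff_smooth[OF cov2_m c] in auto)
    from frechet_derivative_at[OF this, symmetric]
    have "\<D> (\<lambda>z. g c (fst z) (snd z) (fst ab)) (x, u) ab'
        = \<D> (\<lambda>y. g c y u (fst ab)) x (fst ab') + g c x (snd ab') (fst ab)" by simp
    moreover have "\<D> (\<lambda>z. cov1_coeff (tangent_bundle A) (theta_form A m) (tc c) z ab) (x, u)
        = \<D> (\<lambda>z. g c (fst z) (snd z) (fst ab)) (x, u)"
      by (rule frechet_derivative_cong_open[OF theta_coeff[OF c]]) (use x O in \<open>auto intro: open_Times\<close>)
    ultimately show ?thesis by simp
  qed
  have "pullback2 (tangent_bundle A) A fst \<kappa> w X Y = k c x a a'"
    using x c by (simp add: pullback2_def tangent_map_fst[OF c w] X Y Xc Yc cov2_coeff_def M.param_coord)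
  then show ?thesis
    unfolding sigma_form_def TM.ext_deriv1_chart[OF smooth_cov1_theta X Y tangent_chart_in[OF c] w] xu D
    by (simp add: Xc Yc)
qed

lemma total_energy_chart:
  assumes c: "c \<in> A" and z: "z \<in> img_of c \<times> UNIV"
  shows "(total_energy m pot \<circ> param (tc c)) z
       = 1 / 2 * g c (fst z) (snd z) (snd z) + (pot \<circ> param c) (fst z)"
  using z M.param_tangent_chart[OF c, of "fst z" "snd z"]
  by (auto simp: total_energy_def cov2_coeff_def)

lemma smooth_total_energy: "smooth_fun (tangent_bundle A) (total_energy m pot)"
  unfolding smooth_fun_def
proof
  fix c' assume "c' \<in> tangent_bundle A"
  then obtain c where c: "c \<in> A" and c': "c' = tc c" by (auto elim: tangent_bundleE)
  interpret L: local_mechanics "img_of c" "g c" "k c" "pot \<circ> param c" by (rule local_mechanics_chart[OF c])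
  have half: "bounded_linear (\<lambda>r::real. 1 / 2 * r)" by (rule bounded_linear_mult_right)
  have "smooth_on (img_of c \<times> UNIV) (\<lambda>z. 1 / 2 * g c (fst z) (snd z) (snd z) + (pot \<circ> param c) (fst z))"
    by (intro smooth_on_add L.open_phase_space smooth_on_compose_fst L.open_S L.P_smooth
        smooth_on_compose[OF smooth_on_bounded_linear[OF half open_UNIV] L.kinetic_smooth]) auto
  then show "smooth_on (img_of c') (total_energy m pot \<circ> param c')"
    unfolding c' M.img_tangent_chart[OF c]
    by (rule smooth_on_cong[OF _ L.open_phase_space]) (rule total_energy_chart[OF c, symmetric])
qed

lemma differential_energy_chart:
  assumes c: "c \<in> A" and w: "w \<in> dom_of (tc c)" and Y: "Y \<in> tangent_space (tangent_bundle A) w"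
    and xu: "coord (tc c) w = (x, u)" and Yc: "Y (tc c) = (a, b)"
  shows "differential (tangent_bundle A) (total_energy m pot) w Y
       = 1 / 2 * \<D> (\<lambda>y. g c y u u) x a + g c x u b + \<D> (pot \<circ> param c) x a"
proof -
  interpret L: local_mechanics "img_of c" "g c" "k c" "pot \<circ> param c" by (rule local_mechanics_chart[OF c])
  have x: "x \<in> img_of c" using xu w by (auto simp: coord_tangent_chart dom_tangent_chart coord_in_img)
  have "\<D> (total_energy m pot \<circ> param (tc c)) (x, u)
      = \<D> (\<lambda>z. 1 / 2 * g c (fst z) (snd z) (snd z) + (pot \<circ> param c) (fst z)) (x, u)"
    by (rule frechet_derivative_cong_open[OF total_energy_chart[OF c] L.open_phase_space]) (use x in auto)
  then show ?thesis
    using TM.differential_chart[OF smooth_total_energy Y tangent_chart_in[OF c] w]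
      L.energy_phase_derivative[OF x, of u a b] xu Yc by simp
qed

definition spray :: "('a, 'e) chart \<Rightarrow> 'e \<times> 'e \<Rightarrow> 'e \<times> 'e" where
  "spray c z = (snd z, local_mechanics.accel (g c) (k c) (pot \<circ> param c) (fst z) (snd z))"

text \<open>The dynamical field is defined by unique solvability of an equation that is written in an arbitrary
  chart. Since \<open>\<sigma>\<close> and \<open>dH\<close> may be computed in any tangent chart, it has the expected coordinates in
  all of them, and hence in a neighbourhood of each point.\<close>

lemma dynamical_field_chart:
  assumes c: "c \<in> A" and w: "w \<in> dom_of (tc c)"
  shows "dynamical_field A m pot \<kappa> w \<in> tangent_space (tangent_bundle A) w"
    and "dynamical_field A m pot \<kappa> w (tc c) = spray c (coord (tc c) w)"
proof -
  interpret L: local_mechanics "img_of c" "g c" "k c" "pot \<circ> param c" by (rule local_mechanics_chart[OF c])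
  obtain x u where xu: "coord (tc c) w = (x, u)" by (cases "coord (tc c) w")
  then have x: "x \<in> img_of c" using w by (auto simp: coord_tangent_chart dom_tangent_chart coord_in_img)
  note tcc = tangent_chart_in[OF c]
  have iff: "(\<forall>Y\<in>tangent_space (tangent_bundle A) w.
        sigma_form A m \<kappa> w X Y = - differential (tangent_bundle A) (total_energy m pot) w Y)
      \<longleftrightarrow> X (tc c) = spray c (x, u)" if X: "X \<in> tangent_space (tangent_bundle A) w" for X
  proof -
    obtain a b where Xc: "X (tc c) = (a, b)" by (cases "X (tc c)")
    have "(\<forall>Y\<in>tangent_space (tangent_bundle A) w.
        sigma_form A m \<kappa> w X Y = - differential (tangent_bundle A) (total_energy m pot) w Y)
      \<longleftrightarrow> (\<forall>a' b'. \<D> (\<lambda>y. g c y u a') x a + g c x b a' - \<D> (\<lambda>y. g c y u a) x a' - g c x b' a + k c x a a'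
            = - (1 / 2 * \<D> (\<lambda>y. g c y u u) x a' + g c x u b' + \<D> (pot \<circ> param c) x a'))"
      (is "?l \<longleftrightarrow> ?r")
    proof
      assume l: ?l
      show ?r
      proof (intro allI)
        fix a' b'
        let ?Y = "coord_vector (tangent_bundle A) (tc c) w (a', b')"
        have Y: "?Y \<in> tangent_space (tangent_bundle A) w" by (rule TM.coord_vector_in_tangent_space[OF tcc w])
        have Yc: "?Y (tc c) = (a', b')" by (rule TM.coord_vector_apply_self[OF tcc w])
        show "\<D> (\<lambda>y. g c y u a') x a + g c x b a' - \<D> (\<lambda>y. g c y u a) x a' - g c x b' a + k c x a a'
            = - (1 / 2 * \<D> (\<lambda>y. g c y u u) x a' + g c x u b' + \<D> (pot \<circ> param c) x a')"
          using l[rule_format, OF Y]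
          unfolding sigma_form_chart[OF c w X Y xu Xc Yc] differential_energy_chart[OF c w Y xu Yc] .
      qed
    next
      assume r: ?r
      show ?l
      proof
        fix Y assume Y: "Y \<in> tangent_space (tangent_bundle A) w"
        obtain a' b' where Yc: "Y (tc c) = (a', b')" by (cases "Y (tc c)")
        show "sigma_form A m \<kappa> w X Y = - differential (tangent_bundle A) (total_energy m pot) w Y"
          unfolding sigma_form_chart[OF c w X Y xu Xc Yc] differential_energy_chart[OF c w Y xu Yc]
          using r by blast
      qed
    qed
    also have "\<dots> \<longleftrightarrow> X (tc c) = spray c (x, u)"
      unfolding L.hamilton_equation_iff[OF x] by (simp add: Xc spray_def)
    finally show ?thesis .
  qed
  let ?X = "coord_vector (tangent_bundle A) (tc c) w (spray c (x, u))"
  have X: "?X \<in> tangent_space (tangent_bundle A) w" by (rule TM.coord_vector_in_tangent_space[OF tcc w])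
  have Xc: "?X (tc c) = spray c (x, u)" by (rule TM.coord_vector_apply_self[OF tcc w])
  have "dynamical_field A m pot \<kappa> w = ?X"
    unfolding dynamical_field_def
  proof (rule the_equality)
    show "?X \<in> tangent_space (tangent_bundle A) w \<and> (\<forall>Y\<in>tangent_space (tangent_bundle A) w.
        sigma_form A m \<kappa> w ?X Y = - differential (tangent_bundle A) (total_energy m pot) w Y)"
      using X iff[OF X] Xc by blast
    fix Z assume Z: "Z \<in> tangent_space (tangent_bundle A) w \<and> (\<forall>Y\<in>tangent_space (tangent_bundle A) w.
        sigma_form A m \<kappa> w Z Y = - differential (tangent_bundle A) (total_energy m pot) w Y)"
    then have "Z (tc c) = spray c (x, u)" using iff by blast
    with Z X Xc show "Z = ?X" by (intro TM.tangent_eqI[OF _ _ tcc w]) auto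
  qed
  with X Xc xu show "dynamical_field A m pot \<kappa> w \<in> tangent_space (tangent_bundle A) w"
    "dynamical_field A m pot \<kappa> w (tc c) = spray c (coord (tc c) w)" by simp_all
qed

text \<open>Solutions of the coordinate equation exist because its right-hand side is locally Lipschitz. Without
  trajectories through every point, constancy along trajectories would say nothing about a function.\<close>

lemma trajectory_through:
  assumes w: "w \<in> points (tangent_bundle A)"
  obtains I \<gamma> where "trajectory (tangent_bundle A) (dynamical_field A m pot \<kappa>) I \<gamma>" "0 \<in> I" "\<gamma> 0 = w"
proof -
  obtain c where c: "c \<in> A" and wc: "w \<in> dom_of (tc c)"
    using w unfolding points_iff by (auto elim: tangent_bundleE)
  interpret L: local_mechanics "img_of c" "g c" "k c" "pot \<circ> param c" by (rule local_mechanics_chart[OF c])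
  obtain x u where xu: "coord (tc c) w = (x, u)" by (cases "coord (tc c) w")
  then have x: "x \<in> img_of c" using wc by (auto simp: coord_tangent_chart dom_tangent_chart coord_in_img)
  obtain e z where e: "0 < e" and z0: "z 0 = (x, u)"
    and z: "\<And>t. \<bar>t\<bar> < e \<Longrightarrow> fst (z t) \<in> img_of c
       \<and> (z has_vector_derivative (snd (z t), L.accel (fst (z t)) (snd (z t)))) (at t)"
    using L.phase_curve_exists[OF x, of u] by metis
  define \<gamma> where "\<gamma> = (\<lambda>t. param (tc c) (z t))"
  note tcc = tangent_chart_in[OF c]
  have zi: "z t \<in> img_of (tc c)" if "\<bar>t\<bar> < e" for t
    using z[OF that] by (simp add: M.img_tangent_chart[OF c] mem_Times_iff)
  have dom: "\<gamma> t \<in> dom_of (tc c)" if "\<bar>t\<bar> < e" for t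
    unfolding \<gamma>_def by (rule param_in_dom[OF zi[OF that]])
  have cz: "coord (tc c) (\<gamma> t) = z t" if "\<bar>t\<bar> < e" for t
    unfolding \<gamma>_def by (rule coord_param[OF zi[OF that]])
  have "has_velocity (tangent_bundle A) \<gamma> t (dynamical_field A m pot \<kappa> (\<gamma> t))" if t: "\<bar>t\<bar> < e" for t
  proof (rule TM.has_velocityI[where \<gamma> = \<gamma> and t = t, OF dynamical_field_chart(1)[OF c dom[OF t]] tcc dom[OF t]])
    have I: "{-e<..<e} \<in> {S. open S \<and> t \<in> S}" using t by auto
    show "\<forall>\<^sub>F s in nhds t. \<gamma> s \<in> dom_of (tc c)"
      by (rule eventually_nhds[THEN iffD2], rule exI[of _ "{-e<..<e}"]) (use I dom in \<open>auto simp: abs_less_iff\<close>)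
    have "(z has_vector_derivative spray c (z t)) (at t)" using z[OF t] by (simp add: spray_def)
    then show "((coord (tc c) \<circ> \<gamma>) has_vector_derivative dynamical_field A m pot \<kappa> (\<gamma> t) (tc c)) (at t)"
      unfolding dynamical_field_chart(2)[OF c dom[OF t]] cz[OF t]
      by (rule has_vector_derivative_transform_within_open[of _ _ _ "{-e<..<e}"])
        (use I cz in \<open>auto simp: abs_less_iff\<close>)
  qed
  then have "trajectory (tangent_bundle A) (dynamical_field A m pot \<kappa>) {-e<..<e} \<gamma>"
    by (auto simp: trajectory_def is_interval_oo)
  moreover have "\<gamma> 0 = w" using TM.param_coord[OF tcc wc] by (simp add: \<gamma>_def z0 xu)
  ultimately show ?thesis using that[of "{-e<..<e}" \<gamma>] e by simp
qed

text \<open>A first integral is a function annihilated by the field: one direction differentiates along a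
  trajectory through the given point, the other uses that a function with zero derivative on an interval is
  constant.\<close>

lemma first_integral_iff:
  assumes G: "smooth_fun (tangent_bundle A) G"
  shows "first_integral (tangent_bundle A) (dynamical_field A m pot \<kappa>) G \<longleftrightarrow>
     (\<forall>w\<in>points (tangent_bundle A).
        differential (tangent_bundle A) G w (dynamical_field A m pot \<kappa> w) = 0)" (is "?l \<longleftrightarrow> ?r")
proof
  assume l: ?l
  show ?r
  proof
    fix w assume "w \<in> points (tangent_bundle A)"
    then obtain I \<gamma> where traj: "trajectory (tangent_bundle A) (dynamical_field A m pot \<kappa>) I \<gamma>"
      and I: "0 \<in> I" and w: "\<gamma> 0 = w" by (rule trajectory_through)
    have "((\<lambda>s. G (\<gamma> s)) has_real_derivative
        differential (tangent_bundle A) G w (dynamical_field A m pot \<kappa> w)) (at 0)"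
      using TM.has_velocity_differential[OF _ G, of \<gamma> 0] traj I w by (auto simp: trajectory_def)
    moreover have "((\<lambda>s. G (\<gamma> s)) has_real_derivative 0) (at 0)"
    proof (rule has_field_derivative_transform_within_open[OF DERIV_const _ I])
      show "open I" using traj by (simp add: trajectory_def)
      show "G w = G (\<gamma> s)" if "s \<in> I" for s using l traj I that w unfolding first_integral_def by blast
    qed
    ultimately show "differential (tangent_bundle A) G w (dynamical_field A m pot \<kappa> w) = 0"
      by (rule DERIV_unique)
  qed
next
  assume r: ?r
  have "G (\<gamma> s) = G (\<gamma> t)"
    if traj: "trajectory (tangent_bundle A) (dynamical_field A m pot \<kappa>) I \<gamma>" and st: "s \<in> I" "t \<in> I" for I \<gamma> s t
  proof -
    have conv: "convex I" using traj by (simp add: trajectory_def is_interval_convex)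
    have "((\<lambda>s. G (\<gamma> s)) has_derivative (\<lambda>h. 0)) (at s within I)" if "s \<in> I" for s
    proof -
      have vel: "has_velocity (tangent_bundle A) \<gamma> s (dynamical_field A m pot \<kappa> (\<gamma> s))"
        using traj that by (simp add: trajectory_def)
      then have "differential (tangent_bundle A) G (\<gamma> s) (dynamical_field A m pot \<kappa> (\<gamma> s)) = 0"
        using r by (auto simp: has_velocity_def)
      with TM.has_velocity_differential[OF vel G] have "((\<lambda>s. G (\<gamma> s)) has_real_derivative 0) (at s)" by simp
      then show ?thesis by (simp add: has_field_derivative_def has_derivative_at_withinI lambda_zero)
    qed
    from has_derivative_zero_unique[OF conv this st(1,2)] show ?thesis by simp
  qed
  then show ?l using G unfolding first_integral_def by blast
qed

end

section \<open>Symmetries and linear first integrals\<close>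

lemma smooth_fun_uminus:
  assumes "smooth_atlas A" "smooth_fun A f"
  shows "smooth_fun A (\<lambda>p. - f p)"
  using assms smooth_on_uminus[OF smooth_atlas.open_img[OF assms(1)]]
  by (auto simp: smooth_fun_def comp_def)

lemma differential_uminus:
  assumes "smooth_atlas A" "smooth_fun A f" "p \<in> points A"
  shows "differential A (\<lambda>p. - f p) p \<xi> = - differential A f p \<xi>"
proof -
  let ?c = "chart_at A p"
  have "((\<lambda>x. - (f \<circ> param ?c) x) has_derivative (\<lambda>u. - \<D> (f \<circ> param ?c) (coord ?c p) u)) (at (coord ?c p))"
    by (rule has_derivative_minus)
      (rule smooth_atlas.smooth_fun_has_derivative[OF assms(1,2) chart_at[OF assms(3)]])
  from frechet_derivative_at[OF this, symmetric] show ?thesis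
    by (simp add: differential_def Let_def comp_def)
qed

locale gyroscopic_symmetry = gyroscopic A m \<kappa> pot
  for A :: "('a, 'e::euclidean_space) chart set" and m \<kappa> and pot :: "'a \<Rightarrow> real" +
  fixes \<psi> :: "real \<Rightarrow> 'a \<Rightarrow> 'a"
  assumes group: "one_parameter_group A \<psi>"
    and isometry: "preserves_metric A m (\<psi> \<tau>)"
    and preserves_pot: "preserves_fun A pot (\<psi> \<tau>)"
begin

text \<open>The flow in one chart, for those \<open>(\<tau>, x)\<close> for which the moved point is still in the chart. Comparing
  source and target in the same chart suffices, since only times near \<open>0\<close> matter.\<close>

definition flow_chart :: "('a, 'e) chart \<Rightarrow> real \<times> 'e \<Rightarrow> 'e" where
  "flow_chart c z = coord c (\<psi> (fst z) (param c (snd z)))"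

definition flow_dom :: "('a, 'e) chart \<Rightarrow> (real \<times> 'e) set" where
  "flow_dom c = {z. snd z \<in> img_of c \<and> \<psi> (fst z) (param c (snd z)) \<in> dom_of c}"

definition field_chart :: "('a, 'e) chart \<Rightarrow> 'e \<Rightarrow> 'e" where
  "field_chart c x = \<D> (flow_chart c) (0, x) (1, 0)"

abbreviation v where "v \<equiv> generating_field A \<psi>"

lemma flow_zero: "p \<in> points A \<Longrightarrow> \<psi> 0 p = p"
  using group by (simp add: one_parameter_group_def)

lemma flow_chart_smooth:
  assumes c: "c \<in> A"
  shows "open (flow_dom c)" "smooth_on (flow_dom c) (flow_chart c)"
proof -
  \<comment> \<open>The chart of the product manifold from which the domain of \<open>flow_chart c\<close> is cut out.\<close>
  define b :: "(real \<times> 'a, real \<times> 'e) chart" where "b = (UNIV \<times> dom_of c, map_prod id (coord c))"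
  define F where "F = (\<lambda>(\<tau>, x). \<psi> \<tau> x)"
  have "b = (dom_of (UNIV, id) \<times> dom_of c, map_prod (coord (UNIV, id)) (coord c)) \<and> (UNIV, id) \<in> real_atlas"
    by (simp add: b_def real_atlas_def)
  with c have b: "b \<in> prod_atlas real_atlas A" unfolding prod_atlas_def by blast
  have inj: "inj_on (coord b) (dom_of b)" using M.inj_coord[OF c] by (auto simp: b_def inj_on_def)
  have im: "coord b ` (dom_of b \<inter> F -` dom_of c) = flow_dom c"
  proof (intro equalityI subsetI)
    fix z assume "z \<in> coord b ` (dom_of b \<inter> F -` dom_of c)"
    then show "z \<in> flow_dom c"
      by (auto simp: b_def F_def flow_dom_def coord_in_img M.param_coord[OF c])
  next
    fix z assume "z \<in> flow_dom c"
    then show "z \<in> coord b ` (dom_of b \<inter> F -` dom_of c)"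
      by (intro image_eqI[of _ _ "(fst z, param c (snd z))"])
        (auto simp: b_def F_def flow_dom_def coord_param param_in_dom prod_eq_iff)
  qed
  have sm: "open (coord b ` (dom_of b \<inter> F -` dom_of c))"
    "smooth_on (coord b ` (dom_of b \<inter> F -` dom_of c)) (coord c \<circ> F \<circ> param b)"
    using group b c unfolding one_parameter_group_def smooth_map_def F_def by blast+
  show op: "open (flow_dom c)" using sm(1) im by simp
  have par: "param b z = (fst z, param c (snd z))" if "z \<in> flow_dom c" for z
  proof -
    have "(fst z, param c (snd z)) \<in> dom_of b" "coord b (fst z, param c (snd z)) = z"
      using that by (auto simp: b_def flow_dom_def param_in_dom coord_param prod_eq_iff)
    then show ?thesis using inv_into_f_f[OF inj, of "(fst z, param c (snd z))"] by (simp add: param_def[of b])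
  qed
  show "smooth_on (flow_dom c) (flow_chart c)"
    by (rule smooth_on_cong[OF sm(2)[unfolded im] op]) (simp add: par F_def flow_chart_def)
qed

lemma zero_in_flow_dom:
  assumes "c \<in> A" "x \<in> img_of c"
  shows "(0, x) \<in> flow_dom c" "flow_chart c (0, x) = x"
  using assms flow_zero[OF point_param[OF assms]]
  by (simp_all add: flow_dom_def flow_chart_def param_in_dom coord_param)

lemma flow_chart_curve:
  assumes c: "c \<in> A" and x: "x \<in> img_of c"
  shows "((\<lambda>\<tau>. flow_chart c (\<tau>, x)) has_derivative (\<lambda>h. h *\<^sub>R field_chart c x)) (at 0)"
proof -
  have d: "(flow_chart c has_derivative \<D> (flow_chart c) (0, x)) (at (0, x))"
    by (rule smooth_on_has_derivative[OF flow_chart_smooth(2)[OF c] zero_in_flow_dom(1)[OF c x]])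
  have l: "((\<lambda>\<tau>::real. (\<tau>, x)) has_derivative (\<lambda>h. (h, 0))) (at 0)"
    by (intro has_derivative_Pair has_derivative_ident has_derivative_const)
  have "((\<lambda>\<tau>. flow_chart c (\<tau>, x)) has_derivative (\<lambda>h. \<D> (flow_chart c) (0, x) (h, 0))) (at 0)"
    by (rule has_derivative_compose[OF l d])
  moreover have "\<D> (flow_chart c) (0, x) (h, 0) = h *\<^sub>R field_chart c x" for h
    using linear_cmul[OF has_derivative_linear[OF d], of h "(1, 0)"] by (simp add: field_chart_def)
  ultimately show ?thesis by simp
qed

lemma eventually_in_flow_dom:
  assumes c: "c \<in> A" and x: "x \<in> img_of c"
  shows "\<forall>\<^sub>F \<tau> in nhds 0. (\<tau>, x) \<in> flow_dom c"
proof -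
  have "((\<lambda>\<tau>::real. (\<tau>, x)) \<longlongrightarrow> (0, x)) (nhds 0)" by (intro tendsto_intros filterlim_ident)
  from topological_tendstoD[OF this flow_chart_smooth(1)[OF c] zero_in_flow_dom(1)[OF c x]]
  show ?thesis .
qed

text \<open>The velocity by which the generating field is defined exists because the flow is differentiable in
  time in every chart.\<close>

lemma generating_field_chart:
  assumes c: "c \<in> A" and p: "p \<in> dom_of c"
  shows "v p = coord_vector A c p (field_chart c (coord c p))"
  unfolding generating_field_def
proof (rule M.velocity_eqI, rule M.has_velocityI[where c = c])
  have pp: "p \<in> points A" using c p by (auto simp: points_iff)
  have x: "coord c p \<in> img_of c" by (rule coord_in_img[OF p])
  show "coord_vector A c p (field_chart c (coord c p)) \<in> tangent_space A (\<psi> 0 p)"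
    by (simp add: flow_zero[OF pp] M.coord_vector_in_tangent_space[OF c p])
  show "\<psi> 0 p \<in> dom_of c" by (simp add: flow_zero[OF pp] p)
  show "\<forall>\<^sub>F s in nhds 0. \<psi> s p \<in> dom_of c"
    using eventually_in_flow_dom[OF c x] by eventually_elim (simp add: flow_dom_def M.param_coord[OF c p])
  show "((coord c \<circ> (\<lambda>\<tau>. \<psi> \<tau> p)) has_vector_derivative coord_vector A c p (field_chart c (coord c p)) c) (at 0)"
    using flow_chart_curve[OF c x]
    by (simp add: has_vector_derivative_def flow_chart_def M.param_coord[OF c p]
        M.coord_vector_apply_self[OF c p] comp_def)
qed (rule c)

lemma generating_field_tangent: "p \<in> points A \<Longrightarrow> v p \<in> tangent_space A p"
  unfolding points_iff using generating_field_chart M.coord_vector_in_tangent_space by force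

text \<open>Smoothness in \<open>x\<close> comes from joint smoothness of the flow in time and position.\<close>

lemma field_chart_smooth:
  assumes c: "c \<in> A"
  shows "smooth_on (img_of c) (field_chart c)"
proof -
  have "smooth_on (img_of c) (\<lambda>x. (\<lambda>z. \<D> (flow_chart c) z (1, 0)) (0, x))"
  proof (rule smooth_on_compose[OF smooth_on_deriv[OF flow_chart_smooth(2)[OF c]]])
    show "smooth_on (img_of c) (\<lambda>x. (0::real, x))"
      by (intro smooth_on_Pair smooth_on_const M.open_img[OF c] smooth_on_bounded_linear[OF bounded_linear_ident])
  qed (use M.open_img[OF c] flow_chart_smooth(1)[OF c] zero_in_flow_dom(1)[OF c] in auto)
  then show ?thesis by (simp add: field_chart_def[abs_def])
qed

lemma deriv_flow_space:
  assumes c: "c \<in> A" and z: "(\<tau>, x) \<in> flow_dom c"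
  shows "\<D> (coord c \<circ> \<psi> \<tau> \<circ> param c) x u = \<D> (flow_chart c) (\<tau>, x) (0, u)"
proof -
  have l: "((\<lambda>y. (\<tau>, y)) has_derivative (\<lambda>u. (0, u))) (at x)"
    by (intro has_derivative_Pair has_derivative_ident has_derivative_const)
  have "((\<lambda>y. flow_chart c (\<tau>, y)) has_derivative (\<lambda>u. \<D> (flow_chart c) (\<tau>, x) (0, u))) (at x)"
    by (rule has_derivative_compose[OF l smooth_on_has_derivative[OF flow_chart_smooth(2)[OF c] z]])
  from frechet_derivative_at[OF this, symmetric] show ?thesis
    by (simp add: flow_chart_def comp_def)
qed

lemma metric_invariant_chart:
  assumes c: "c \<in> A" and z: "(\<tau>, x) \<in> flow_dom c"
  shows "g c (flow_chart c (\<tau>, x)) (\<D> (flow_chart c) (\<tau>, x) (0, u)) (\<D> (flow_chart c) (\<tau>, x) (0, u))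
       = g c x u u"
proof -
  define p where "p = param c x"
  have x: "x \<in> img_of c" and q: "\<psi> \<tau> p \<in> dom_of c" using z by (auto simp: flow_dom_def p_def)
  have p: "p \<in> dom_of c" "coord c p = x" by (simp_all add: p_def param_in_dom coord_param x)
  define \<xi> where "\<xi> = coord_vector A c p u"
  have \<xi>: "\<xi> \<in> tangent_space A p" "\<xi> c = u"
    by (simp_all add: \<xi>_def M.coord_vector_in_tangent_space M.coord_vector_apply_self c p)
  have "smooth_map A A (\<psi> \<tau>)" using group by (simp add: one_parameter_group_def diffeomorphism_def)
  from tangent_map_chart[OF M.smooth_atlas_axioms M.smooth_atlas_axioms this \<xi>(1) c p(1) c q]
  have T: "tangent_map A A (\<psi> \<tau>) p \<xi> = coord_vector A c (\<psi> \<tau> p) (\<D> (flow_chart c) (\<tau>, x) (0, u))"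
    by (simp add: p(2) \<xi>(2) deriv_flow_space[OF c z])
  have "p \<in> points A" using c p(1) by (auto simp: points_iff)
  then have "pullback2 A A (\<psi> \<tau>) m p \<xi> \<xi> = m p \<xi> \<xi>"
    using isometry[of \<tau>] \<xi>(1) unfolding preserves_metric_def by blast
  moreover have "param c (flow_chart c (\<tau>, x)) = \<psi> \<tau> p"
    using q by (simp add: flow_chart_def p_def[symmetric] M.param_coord[OF c])
  ultimately show ?thesis
    by (simp add: pullback2_def T cov2_coeff_def \<xi>_def[symmetric] p_def[symmetric])
qed

text \<open>Differentiating the invariance of \<open>g\<close> under the flow at time \<open>0\<close>. The space derivative of the flow is the
  identity at time \<open>0\<close>, and its time derivative is the derivative of the generating field because second
  derivatives commute.\<close>

lemma killing_equation:
  assumes c: "c \<in> A" and x: "x \<in> img_of c"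
  shows "1 / 2 * \<D> (\<lambda>y. g c y u u) x (field_chart c x) + g c x u (\<D> (field_chart c) x u) = 0"
proof -
  interpret L: local_mechanics "img_of c" "g c" "k c" "pot \<circ> param c" by (rule local_mechanics_chart[OF c])
  note O = flow_chart_smooth(1)[OF c] and sm = flow_chart_smooth(2)[OF c]
    and z0 = zero_in_flow_dom(1)[OF c x]
  define W where "W = (\<lambda>z. \<D> (flow_chart c) z (0, u))"
  have smW: "smooth_on (flow_dom c) W" unfolding W_def by (rule smooth_on_deriv[OF sm])
  have l: "((\<lambda>\<tau>::real. (\<tau>, x)) has_derivative (\<lambda>h. (h, 0))) (at 0)"
    by (intro has_derivative_Pair has_derivative_ident has_derivative_const)
  have W0: "W (0, x) = u"
  proof -
    have "\<D> (coord c \<circ> \<psi> 0 \<circ> param c) x = \<D> (\<lambda>y. y) x"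
      by (rule frechet_derivative_cong_open[OF _ M.open_img[OF c] x])
        (use zero_in_flow_dom(2)[OF c] in \<open>simp add: flow_chart_def\<close>)
    then show ?thesis using deriv_flow_space[OF c z0, of u] by (simp add: W_def)
  qed
  have mixed: "\<D> W (0, x) (1, 0) = \<D> (field_chart c) x u"
  proof -
    have "\<D> W (0, x) (1, 0) = \<D> (\<lambda>z. \<D> (flow_chart c) z (1, 0)) (0, x) (0, u)"
      unfolding W_def by (rule smooth_on_second_derivative_symmetric[OF sm O z0])
    also have "\<dots> = \<D> (field_chart c) x u"
    proof -
      have l': "((\<lambda>y. (0::real, y)) has_derivative (\<lambda>u. (0, u))) (at x)"
        by (intro has_derivative_Pair has_derivative_ident has_derivative_const)
      have "((\<lambda>y. (\<lambda>z. \<D> (flow_chart c) z (1, 0)) (0, y)) has_derivative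
          (\<lambda>u. \<D> (\<lambda>z. \<D> (flow_chart c) z (1, 0)) (0, x) (0, u))) (at x)"
        by (rule has_derivative_compose[OF l' smooth_on_has_derivative[OF smooth_on_deriv[OF sm] z0]])
      from frechet_derivative_at[OF this, symmetric] show ?thesis
        by (simp add: field_chart_def[abs_def])
    qed
    finally show ?thesis .
  qed
  have W': "((\<lambda>\<tau>. W (\<tau>, x)) has_derivative (\<lambda>h. \<D> W (0, x) (h, 0))) (at 0)"
    by (rule has_derivative_compose[OF l smooth_on_has_derivative[OF smW z0]])
  have E: "((\<lambda>z. g c (fst z) (snd z) (snd z)) has_derivative
      (\<lambda>w. \<D> (\<lambda>y. g c y u u) x (fst w) + 2 * g c x u (snd w))) (at (flow_chart c (0, x), W (0, x)))"
    unfolding W0 zero_in_flow_dom(2)[OF c x] by (rule L.kinetic_has_derivative[OF x])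
  have "((\<lambda>\<tau>. g c (flow_chart c (\<tau>, x)) (W (\<tau>, x)) (W (\<tau>, x))) has_derivative
      (\<lambda>h. \<D> (\<lambda>y. g c y u u) x (h *\<^sub>R field_chart c x) + 2 * g c x u (\<D> W (0, x) (h, 0)))) (at 0)"
    using has_derivative_compose[OF has_derivative_Pair[OF flow_chart_curve[OF c x] W'] E] by simp
  moreover have "((\<lambda>\<tau>. g c (flow_chart c (\<tau>, x)) (W (\<tau>, x)) (W (\<tau>, x))) has_derivative (\<lambda>h. 0)) (at 0)"
  proof (rule has_derivative_transform_eventually[OF has_derivative_const])
    have "\<forall>\<^sub>F \<tau> in nhds 0. g c x u u = g c (flow_chart c (\<tau>, x)) (W (\<tau>, x)) (W (\<tau>, x))"
      using eventually_in_flow_dom[OF c x]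
      by eventually_elim (simp add: W_def metric_invariant_chart[OF c])
    then show "\<forall>\<^sub>F \<tau> in at 0. g c x u u = g c (flow_chart c (\<tau>, x)) (W (\<tau>, x)) (W (\<tau>, x))"
      by (rule eventually_nhds_conv_at[THEN iffD1, THEN conjunct1])
  qed (use metric_invariant_chart[OF c z0] in \<open>simp_all add: W_def\<close>)
  ultimately have "(\<lambda>h. \<D> (\<lambda>y. g c y u u) x (h *\<^sub>R field_chart c x) + 2 * g c x u (\<D> W (0, x) (h, 0))) = (\<lambda>h. 0)"
    by (rule has_derivative_unique)
  from fun_cong[OF this, of 1] show ?thesis by (simp add: mixed)
qed

lemma potential_invariant_chart:
  assumes c: "c \<in> A" and x: "x \<in> img_of c"
  shows "\<D> (pot \<circ> param c) x (field_chart c x) = 0"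
proof -
  have P: "((pot \<circ> param c) has_derivative \<D> (pot \<circ> param c) x) (at (flow_chart c (0, x)))"
    unfolding zero_in_flow_dom(2)[OF c x]
    by (rule smooth_on_has_derivative[OF _ x]) (use smooth_pot c in \<open>simp add: smooth_fun_def\<close>)
  have inv: "(pot \<circ> param c) (flow_chart c (\<tau>, x)) = pot (param c x)" if "(\<tau>, x) \<in> flow_dom c" for \<tau>
    using that preserves_pot[of \<tau>] point_param[OF c x]
    by (simp add: flow_dom_def flow_chart_def M.param_coord[OF c] preserves_fun_def)
  have "((\<lambda>\<tau>. (pot \<circ> param c) (flow_chart c (\<tau>, x))) has_derivative
      (\<lambda>h. \<D> (pot \<circ> param c) x (h *\<^sub>R field_chart c x))) (at 0)"
    by (rule has_derivative_compose[OF flow_chart_curve[OF c x] P])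
  moreover have "((\<lambda>\<tau>. (pot \<circ> param c) (flow_chart c (\<tau>, x))) has_derivative (\<lambda>h. 0)) (at 0)"
  proof (rule has_derivative_transform_eventually[OF has_derivative_const])
    have "\<forall>\<^sub>F \<tau> in nhds 0. pot (param c x) = (pot \<circ> param c) (flow_chart c (\<tau>, x))"
      using eventually_in_flow_dom[OF c x] by eventually_elim (simp only: inv)
    then show "\<forall>\<^sub>F \<tau> in at 0. pot (param c x) = (pot \<circ> param c) (flow_chart c (\<tau>, x))"
      by (rule eventually_nhds_conv_at[THEN iffD1, THEN conjunct1])
    show "pot (param c x) = (pot \<circ> param c) (flow_chart c (0, x))"
      using inv[OF zero_in_flow_dom(1)[OF c x]] by simp
  qed simp
  ultimately have "(\<lambda>h. \<D> (pot \<circ> param c) x (h *\<^sub>R field_chart c x)) = (\<lambda>h. 0)"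
    by (rule has_derivative_unique)
  from fun_cong[OF this, of 1] show ?thesis by simp
qed

lemma linear_integral_chart:
  assumes c: "c \<in> A" and z: "z \<in> img_of c \<times> UNIV"
  shows "(linear_integral m v f \<circ> param (tc c)) z
       = g c (fst z) (field_chart c (fst z)) (snd z) + (f \<circ> param c) (fst z)"
proof -
  have x: "fst z \<in> img_of c" using z by (simp add: mem_Times_iff)
  show ?thesis
    using M.param_tangent_chart[OF c x, of "snd z"] generating_field_chart[OF c param_in_dom[OF x]]
    by (simp add: linear_integral_def cov2_coeff_def coord_param[OF x])
qed

lemma smooth_linear_integral:
  assumes f: "smooth_fun A f"
  shows "smooth_fun (tangent_bundle A) (linear_integral m v f)"
  unfolding smooth_fun_def
proof
  fix c' assume "c' \<in> tangent_bundle A"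
  then obtain c where c: "c \<in> A" and c': "c' = tc c" by (auto elim: tangent_bundleE)
  interpret L: local_mechanics "img_of c" "g c" "k c" "pot \<circ> param c" by (rule local_mechanics_chart[OF c])
  have fc: "smooth_on (img_of c) (f \<circ> param c)" using f c by (simp add: smooth_fun_def)
  have gv: "smooth_on (img_of c) (\<lambda>x. g c x (field_chart c x) w)" for w
    by (rule smooth_on_linear_family[OF L.open_S L.g_lin1 L.g_smooth field_chart_smooth[OF c]])
  have "smooth_on (img_of c \<times> UNIV) (\<lambda>z. g c (fst z) (field_chart c (fst z)) (snd z))"
    by (rule smooth_on_linear_family_snd[where h = "\<lambda>x. g c x (field_chart c x)", OF L.open_S L.g_lin2 gv])
  then have "smooth_on (img_of c \<times> UNIV)
      (\<lambda>z. g c (fst z) (field_chart c (fst z)) (snd z) + (f \<circ> param c) (fst z))"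
    by (rule smooth_on_add[OF L.open_phase_space _ smooth_on_compose_fst[OF L.open_S fc]])
  then show "smooth_on (img_of c') (linear_integral m v f \<circ> param c')"
    unfolding c' M.img_tangent_chart[OF c]
    by (rule smooth_on_cong[OF _ L.open_phase_space]) (rule linear_integral_chart[OF c, symmetric])
qed

text \<open>The identity \<open>dG(X) = i_v \<kappa> + df\<close> on which the theorem rests. Both sides are independent of the chart, so
  that the coordinate computation applies with any chart around the base point.\<close>

lemma linear_integral_derivative:
  assumes f: "smooth_fun A f" and p: "p \<in> points A" and \<xi>: "\<xi> \<in> tangent_space A p"
  shows "differential (tangent_bundle A) (linear_integral m v f) (p, \<xi>) (dynamical_field A m pot \<kappa> (p, \<xi>))
       = \<kappa> p (v p) \<xi> + differential A f p \<xi>"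
proof -
  obtain c where c: "c \<in> A" and pc: "p \<in> dom_of c" using p by (auto simp: points_iff)
  interpret L: local_mechanics "img_of c" "g c" "k c" "pot \<circ> param c" by (rule local_mechanics_chart[OF c])
  define x where "x = coord c p"
  have x: "x \<in> img_of c" unfolding x_def by (rule coord_in_img[OF pc])
  have w: "(p, \<xi>) \<in> dom_of (tc c)" using pc \<xi> by (simp add: dom_tangent_chart)
  have cw: "coord (tc c) (p, \<xi>) = (x, \<xi> c)" by (simp add: coord_tangent_chart x_def)
  have vT: "v p \<in> tangent_space A p" by (rule generating_field_tangent[OF p])
  have vc: "v p c = field_chart c x"
    using generating_field_chart[OF c pc] M.coord_vector_apply_self[OF c pc] by (simp add: x_def)
  have k: "k c x (field_chart c x) (\<xi> c) = \<kappa> p (v p) \<xi>" "k c x (\<xi> c) (field_chart c x) = \<kappa> p \<xi> (v p)"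
    using cov2_coeff_chart[OF vT \<xi> c pc, of \<kappa>] cov2_coeff_chart[OF \<xi> vT c pc, of \<kappa>] by (simp_all add: vc x_def)
  have alt: "k c x (\<xi> c) (field_chart c x) = - k c x (field_chart c x) (\<xi> c)"
    unfolding k using system p \<xi> vT unfolding gyroscopic_system_def two_form_def by blast
  have fx: "smooth_on (img_of c) (f \<circ> param c)" using f c by (simp add: smooth_fun_def)
  have "differential (tangent_bundle A) (linear_integral m v f) (p, \<xi>) (dynamical_field A m pot \<kappa> (p, \<xi>))
      = \<D> (linear_integral m v f \<circ> param (tc c)) (x, \<xi> c) (\<xi> c, L.accel x (\<xi> c))"
    using TM.differential_chart[OF smooth_linear_integral[OF f] dynamical_field_chart(1)[OF c w]
        tangent_chart_in[OF c] w] dynamical_field_chart(2)[OF c w]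
    by (simp add: cw spray_def)
  also have "\<D> (linear_integral m v f \<circ> param (tc c)) (x, \<xi> c)
      = \<D> (\<lambda>z. g c (fst z) (field_chart c (fst z)) (snd z) + (f \<circ> param c) (fst z)) (x, \<xi> c)"
    by (rule frechet_derivative_cong_open[OF linear_integral_chart[OF c] L.open_phase_space]) (use x in auto)
  also have "\<dots> (\<xi> c, L.accel x (\<xi> c)) = k c x (field_chart c x) (\<xi> c) + \<D> (f \<circ> param c) x (\<xi> c)"
    by (rule L.linear_integral_phase_derivative[OF x field_chart_smooth[OF c] fx
          killing_equation[OF c x] potential_invariant_chart[OF c x] alt])
  also have "\<dots> = \<kappa> p (v p) \<xi> + differential A f p \<xi>"
    using M.differential_chart[OF f \<xi> c pc] by (simp add: k(1) x_def[symmetric])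
  finally show ?thesis .
qed

lemma linear_first_integral_iff:
  assumes f: "smooth_fun A f"
  shows "first_integral (tangent_bundle A) (dynamical_field A m pot \<kappa>) (linear_integral m v f)
     \<longleftrightarrow> eq_form1 A (contraction v \<kappa>) (\<lambda>p \<xi>. - differential A f p \<xi>)"
proof -
  have "first_integral (tangent_bundle A) (dynamical_field A m pot \<kappa>) (linear_integral m v f)
     \<longleftrightarrow> (\<forall>p\<in>points A. \<forall>\<xi>\<in>tangent_space A p. \<kappa> p (v p) \<xi> + differential A f p \<xi> = 0)"
    unfolding first_integral_iff[OF smooth_linear_integral[OF f]]
    using linear_integral_derivative[OF f] by (auto simp: points_tangent_bundle)
  then show ?thesis by (simp add: eq_form1_def contraction_def eq_neg_iff_add_eq_0)
qed

text \<open>The sign in \<open>i_v \<kappa> = - df\<close> disappears in the notion of exactness: \<open>- f\<close> is a primitive.\<close>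

lemma linear_first_integral_exists_iff:
  "(\<exists>f. smooth_fun A f \<and> first_integral (tangent_bundle A) (dynamical_field A m pot \<kappa>) (linear_integral m v f))
     \<longleftrightarrow> exact_form1 A (contraction v \<kappa>)"
proof -
  note neg = smooth_fun_uminus[OF M.smooth_atlas_axioms] differential_uminus[OF M.smooth_atlas_axioms]
  show ?thesis
  proof
    assume "\<exists>f. smooth_fun A f \<and> first_integral (tangent_bundle A) (dynamical_field A m pot \<kappa>) (linear_integral m v f)"
    then obtain f where f: "smooth_fun A f" "eq_form1 A (contraction v \<kappa>) (\<lambda>p \<xi>. - differential A f p \<xi>)"
      using linear_first_integral_iff by blast
    then have "eq_form1 A (contraction v \<kappa>) (differential A (\<lambda>p. - f p))"
      by (simp add: eq_form1_def neg)
    with neg(1)[OF f(1)] show "exact_form1 A (contraction v \<kappa>)" unfolding exact_form1_def by blast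
  next
    assume "exact_form1 A (contraction v \<kappa>)"
    then obtain f where f: "smooth_fun A f" "eq_form1 A (contraction v \<kappa>) (differential A f)"
      unfolding exact_form1_def by blast
    then have "eq_form1 A (contraction v \<kappa>) (\<lambda>p \<xi>. - differential A (\<lambda>p. - f p) p \<xi>)"
      by (simp add: eq_form1_def neg)
    then show "\<exists>f. smooth_fun A f \<and> first_integral (tangent_bundle A) (dynamical_field A m pot \<kappa>) (linear_integral m v f)"
      using linear_first_integral_iff[OF neg(1)[OF f(1)]] neg(1)[OF f(1)] by blast
  qed
qed

end

theorem theorem1:
  fixes A :: "('a, 'e::euclidean_space) chart set"
    and m \<kappa> :: "('a, 'e) cov2"
    and pot :: "'a \<Rightarrow> real"
    and \<psi> :: "real \<Rightarrow> 'a \<Rightarrow> 'a"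
    and v :: "'a \<Rightarrow> ('a, 'e) tvec"
    and X :: "'a \<times> ('a, 'e) tvec \<Rightarrow> ('a \<times> ('a, 'e) tvec, 'e \<times> 'e) tvec"
  assumes "gyroscopic_system A m pot \<kappa>"
    and "one_parameter_group A \<psi>"
    and "\<And>\<tau>. preserves_metric A m (\<psi> \<tau>)"
    and "\<And>\<tau>. preserves_fun A pot (\<psi> \<tau>)"
    and "v = generating_field A \<psi>"
    and "X = dynamical_field A m pot \<kappa>"
  shows "((\<exists>f. smooth_fun A f \<and> first_integral (tangent_bundle A) X (linear_integral m v f))
            \<longleftrightarrow> exact_form1 A (contraction v \<kappa>))
       \<and> (\<forall>f. smooth_fun A f \<longrightarrow>
            (first_integral (tangent_bundle A) X (linear_integral m v f)
               \<longleftrightarrow> eq_form1 A (contraction v \<kappa>) (\<lambda>p \<xi>. - differential A f p \<xi>)))"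
proof -
  interpret gyroscopic_symmetry A m \<kappa> pot \<psi>
    by unfold_locales (use assms in auto)
  show ?thesis
    unfolding assms(5,6) using linear_first_integral_exists_iff linear_first_integral_iff by blast
qed

end
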